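(* Fix $x\in\mathbb{Z}^2$. Let $\{B^\rho_{x-e_1,x}:1\le\rho<\infty\}$ be the Busemann process of the exponential corner growth model on the edge $(x-e_1,x)$, extended to $\rho=1$ by $B^1_{x-e_1,x}=Y_x$. Let $\{X(\rho):1\le\rho<\infty\}$ be defined by $X(\rho)=\sum_{s\in N\cap[1,\rho]}Z_s$, where $N$ is the simple point process on $[1,\infty)$ that has a point at $s=1$ with probability one and is on $(1,\infty)$ a Poisson point process with intensity measure $s^{-1}\,ds$, and where, to each point $t$ of $N$, an independent exponential weight $Z_t$ with rate $t^{-1}$ is attached. Then the nondecreasing cadlag processes $\{B^\rho_{x-e_1,x}\}_{\rho\in[1,\infty)}$ and $\{X(\rho)\}_{\rho\in[1,\infty)}$ are equal in distribution.
   Context: Notation: $e_1=(1,0)$, $e_2=(0,1)$, coordinatewise order on $\mathbb{Z}^2$, $a\wedge b=\min(a,b)$. Weights: $Y=(Y_x)_{x\in\mathbb{Z}^2}$ are i.i.d. exponential with mean $1$. Last-passage values: for $u\le v$ in $\mathbb{Z}^2$, $G_{u,v}=\max\sum_iY_{x_i}$, the maximum over nearest-neighbor paths from $u$ to $v$ with steps in $\{e_1,e_2\}$ (endpoints included). Busemann process (existence known): a process $\{B^\rho_{x,y}:x,y\in\mathbb{Z}^2,\ \rho\in(1,\infty)\}$, cadlag in $\rho$, a Borel function of $Y$, such that: for fixed $\rho$, with $u(\rho)=-\bigl(\frac1{1+(\rho-1)^2},\frac{(\rho-1)^2}{1+(\rho-1)^2}\bigr)$, almost surely $B^\rho_{x,y}=\lim_{n\to\infty}[G_{u_n,y}-G_{u_n,x}]$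 for every sequence $u_n\in\mathbb{Z}^2$ with $|u_n|_1\to\infty$ and $u_n/n\to u(\rho)$; and on a single event of probability one, for all $x,y,z$ and all $\lambda<\rho$ in $(1,\infty)$: $B^\lambda_{x,x+e_1}\le B^\rho_{x,x+e_1}$, $B^\lambda_{x,x+e_2}\ge B^\rho_{x,x+e_2}$, $B^\rho_{x,y}+B^\rho_{y,z}=B^\rho_{x,z}$, $Y_x=B^\rho_{x-e_1,x}\wedge B^\rho_{x-e_2,x}$. For fixed $\rho$, $B^\rho$ is stationary under lattice shifts, $B^\rho_{x-e_1,x}$ is exponential with rate $\rho^{-1}$, $B^\rho_{x-e_2,x}$ is exponential with rate $1-\rho^{-1}$, and increments $B^\rho_{y_k,y_{k+1}}$ along any down-right path ($y_{k+1}-y_k\in\{e_1,-e_2\}$) are independent. Setting $B^1_{x-e_1,x}=Y_x$ extends $\rho\mapsto B^\rho_{x-e_1,x}$ to a cadlag process on $[1,\infty)$, because almost surely $B^\rho_{x-e_1,x}=Y_x$ for all $\rho>1$ sufficiently close to $1$. *)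

theory Defs
  imports "HOL-Probability.Probability"
begin

section \<open>Last-passage percolation and Busemann processes\<close>

type_synonym site = "int \<times> int"

definition e1 :: site where "e1 = (1, 0)"
definition e2 :: site where "e2 = (0, 1)"

definition up_right_paths :: "site \<Rightarrow> site \<Rightarrow> site list set" where
  "up_right_paths u v =
     {p. p \<noteq> [] \<and> hd p = u \<and> last p = v \<and> successively (\<lambda>a b. b = a + e1 \<or> b = a + e2) p}"

text \<open>The last-passage value is only meaningful for \<open>u \<le> v\<close> coordinatewise; otherwise there is no
  path and \<open>Max\<close> is applied to the empty set.  In the limits below this concerns finitely many
  indices only.\<close>

definition last_passage :: "(site \<Rightarrow> real) \<Rightarrow> site \<Rightarrow> site \<Rightarrow> real" where
  "last_passage w u v = Max ((\<lambda>p. \<Sum>z\<leftarrow>p. w z) ` up_right_paths u v)"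

definition direction :: "real \<Rightarrow> real \<times> real" where
  "direction \<rho> = - (1 / (1 + (\<rho> - 1)\<^sup>2), (\<rho> - 1)\<^sup>2 / (1 + (\<rho> - 1)\<^sup>2))"

definition has_direction :: "(nat \<Rightarrow> site) \<Rightarrow> real \<times> real \<Rightarrow> bool" where
  "has_direction u d \<longleftrightarrow>
     filterlim (\<lambda>n. \<bar>fst (u n)\<bar> + \<bar>snd (u n)\<bar>) at_top sequentially \<and>
     (\<lambda>n. (of_int (fst (u n)) / real n, of_int (snd (u n)) / real n)) \<longlonglongrightarrow> d"

text \<open>Both limits are taken within \<open>S\<close>.  At the left endpoint of \<open>S = {1..}\<close> the filter of the left
  limit is trivial, so there only right-continuity is required.\<close>

definition cadlag_on :: "real set \<Rightarrow> (real \<Rightarrow> real) \<Rightarrow> bool" where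
  "cadlag_on S f \<longleftrightarrow>
     (\<forall>t\<in>S. (f \<longlongrightarrow> f t) (at t within S \<inter> {t<..}) \<and>
            (\<exists>l. (f \<longlongrightarrow> l) (at t within S \<inter> {..<t})))"

locale exponential_corner_growth = prob_space M
  for M :: "'a measure" +
  fixes Y :: "site \<Rightarrow> 'a \<Rightarrow> real"
  assumes Y_indep: "indep_vars (\<lambda>_. borel) Y UNIV"
    and Y_exponential: "distributed M lborel (Y x) (exponential_density 1)"

text \<open>\<open>B \<rho> x y\<close> is the Busemann function \<open>B\<^sup>\<rho>\<^bsub>x,y\<^esub>\<close>; its values for \<open>\<rho> \<le> 1\<close> are irrelevant.\<close>

locale busemann_process = exponential_corner_growth M Y
  for M :: "'a measure" and Y :: "site \<Rightarrow> 'a \<Rightarrow> real" +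
  fixes B :: "real \<Rightarrow> site \<Rightarrow> site \<Rightarrow> 'a \<Rightarrow> real"
  assumes borel_function_of_Y:
      "\<exists>\<Phi>. \<forall>\<rho>>1. \<forall>x y.
         \<Phi> \<rho> x y \<in> borel_measurable (\<Pi>\<^sub>M z\<in>UNIV. borel) \<and>
         (\<forall>\<omega>\<in>space M. B \<rho> x y \<omega> = \<Phi> \<rho> x y (\<lambda>z. Y z \<omega>))"
    and cadlag: "AE \<omega> in M. \<forall>x y. cadlag_on {1<..} (\<lambda>\<rho>. B \<rho> x y \<omega>)"
    and busemann_limit:
      "\<rho> > 1 \<Longrightarrow> AE \<omega> in M. \<forall>x y u. has_direction u (direction \<rho>) \<longrightarrow>
         (\<lambda>n. last_passage (\<lambda>z. Y z \<omega>) (u n) y - last_passage (\<lambda>z. Y z \<omega>) (u n) x)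
           \<longlonglongrightarrow> B \<rho> x y \<omega>"
    and single_event:
      "AE \<omega> in M.
         (\<forall>x \<kappa> \<rho>. 1 < \<kappa> \<and> \<kappa> < \<rho> \<longrightarrow>
            B \<kappa> x (x + e1) \<omega> \<le> B \<rho> x (x + e1) \<omega> \<and>
            B \<kappa> x (x + e2) \<omega> \<ge> B \<rho> x (x + e2) \<omega>) \<and>
         (\<forall>x y z. \<forall>\<rho>>1. B \<rho> x y \<omega> + B \<rho> y z \<omega> = B \<rho> x z \<omega>) \<and>
         (\<forall>x. \<forall>\<rho>>1. Y x \<omega> = min (B \<rho> (x - e1) x \<omega>) (B \<rho> (x - e2) x \<omega>))"
    and stationary:
      "\<rho> > 1 \<Longrightarrow>
         distr M (\<Pi>\<^sub>M p\<in>UNIV. borel) (\<lambda>\<omega> (x, y). B \<rho> (x + z) (y + z) \<omega>) =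
         distr M (\<Pi>\<^sub>M p\<in>UNIV. borel) (\<lambda>\<omega> (x, y). B \<rho> x y \<omega>)"
    and horizontal_exponential:
      "\<rho> > 1 \<Longrightarrow> distributed M lborel (B \<rho> (x - e1) x) (exponential_density (1 / \<rho>))"
    and vertical_exponential:
      "\<rho> > 1 \<Longrightarrow> distributed M lborel (B \<rho> (x - e2) x) (exponential_density (1 - 1 / \<rho>))"
    and down_right_indep:
      "\<rho> > 1 \<Longrightarrow> (\<And>k :: int. y (k + 1) - y k \<in> {e1, - e2}) \<Longrightarrow>
         indep_vars (\<lambda>_. borel) (\<lambda>k. B \<rho> (y k) (y (k + 1))) UNIV"

definition busemann_edge ::
  "(site \<Rightarrow> 'a \<Rightarrow> real) \<Rightarrow> (real \<Rightarrow> site \<Rightarrow> site \<Rightarrow> 'a \<Rightarrow> real) \<Rightarrow> site \<Rightarrow> real \<Rightarrow> 'a \<Rightarrow> real" where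
  "busemann_edge Y B x \<rho> \<omega> = (if \<rho> = 1 then Y x \<omega> else B \<rho> (x - e1) x \<omega>)"


section \<open>The marked point process\<close>

text \<open>A simple point process on \<open>[1, \<infinity>)\<close> is a random locally finite subset of \<open>[1, \<infinity>)\<close>.\<close>

locale simple_point_process = prob_space M
  for M :: "'a measure" +
  fixes N :: "'a \<Rightarrow> real set"
  assumes points_ge_1: "\<omega> \<in> space M \<Longrightarrow> N \<omega> \<subseteq> {1..}"
    and locally_finite: "\<omega> \<in> space M \<Longrightarrow> finite (N \<omega> \<inter> {1..r})"
    and counts_measurable:
      "A \<in> sets borel \<Longrightarrow> bounded A \<Longrightarrow> (\<lambda>\<omega>. card (N \<omega> \<inter> A)) \<in> measurable M (count_space UNIV)"

text \<open>The \<open>\<sigma>\<close>-algebra generated by the point process.\<close>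

definition point_process_algebra :: "'a measure \<Rightarrow> ('a \<Rightarrow> real set) \<Rightarrow> 'a measure" where
  "point_process_algebra M N =
     sigma (space M) {{\<omega> \<in> space M. card (N \<omega> \<inter> A) = k} | A k. A \<in> sets borel \<and> bounded A}"

definition poisson_on :: "'a measure \<Rightarrow> ('a \<Rightarrow> real set) \<Rightarrow> real set \<Rightarrow> real measure \<Rightarrow> bool" where
  "poisson_on M N S \<mu> \<longleftrightarrow>
     (\<forall>A \<in> sets borel. bounded A \<and> A \<subseteq> S \<longrightarrow>
        (\<forall>k. measure M {\<omega> \<in> space M. card (N \<omega> \<inter> A) = k} =
             measure \<mu> A ^ k / fact k * exp (- measure \<mu> A))) \<and>
     (\<forall>A :: nat \<Rightarrow> real set. disjoint_family A \<and>
        (\<forall>i. A i \<in> sets borel \<and> bounded (A i) \<and> A i \<subseteq> S) \<longrightarrow>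
        prob_space.indep_vars M (\<lambda>_. count_space UNIV) (\<lambda>i \<omega>. card (N \<omega> \<inter> A i)) UNIV)"

text \<open>The \<open>k\<close>-th point, counted from 0 in increasing order, of a locally finite subset of
  \<open>[1, \<infinity>)\<close> with more than \<open>k\<close> points.\<close>

definition nth_point :: "real set \<Rightarrow> nat \<Rightarrow> real" where
  "nth_point S k = (THE t. t \<in> S \<and> card (S \<inter> {..<t}) = k)"

text \<open>\<open>Z t \<omega>\<close> is the weight attached to the point \<open>t\<close>, and matters only for \<open>t \<in> N \<omega>\<close>.  That the
  weights are independent exponentials with rates \<open>1 / t\<close> means, the positions of the points
  being random, that this is their conditional law given the point process.\<close>

locale marked_point_process = simple_point_process M N
  for M :: "'a measure" and N :: "'a \<Rightarrow> real set" +
  fixes Z :: "real \<Rightarrow> 'a \<Rightarrow> real"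
  assumes point_at_1: "AE \<omega> in M. 1 \<in> N \<omega>"
    and poisson: "poisson_on M N {1<..} (density lborel (\<lambda>s. ennreal (1 / s)))"
    and weights_measurable: "(\<lambda>\<omega>. Z (nth_point (N \<omega>) k) \<omega>) \<in> borel_measurable M"
    and weights_cond_indep_exponential:
      "(\<And>i. i < n \<Longrightarrow> C i \<in> sets borel) \<Longrightarrow>
         AE \<omega> in M.
           real_cond_exp M (point_process_algebra M N)
             (indicator {\<omega> \<in> space M. \<forall>i<n. Z (nth_point (N \<omega>) i) \<omega> \<in> C i}) \<omega> =
           (\<Prod>i<n. measure (density lborel (exponential_density (1 / nth_point (N \<omega>) i))) (C i))"

definition jump_process ::
  "('a \<Rightarrow> real set) \<Rightarrow> (real \<Rightarrow> 'a \<Rightarrow> real) \<Rightarrow> real \<Rightarrow> 'a \<Rightarrow> real" where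
  "jump_process N Z \<rho> \<omega> = (\<Sum>s\<in>N \<omega> \<inter> {1..\<rho>}. Z s \<omega>)"

end

theory Submission
  imports Defs
begin

text \<open>Both processes have, with \<open>\<phi>\<close> the characteristic function of the exponential law of mean 1, the
  property that the value at \<open>\<kappa>\<close> is exponential with mean \<open>\<kappa>\<close> and independent of the later increments.
  For finite-dimensional characteristic functions \<open>\<Phi>\<^bsub>R\<^esub>(\<theta>)\<close> and \<open>\<kappa> < min R\<close> this reads
  \<open>\<Phi>\<^bsub>R \<union> {\<kappa>}\<^esub>(\<theta>) \<phi>(\<kappa> \<Sum>\<^bsub>R\<^esub> \<theta>) = \<phi>(\<kappa> \<Sum>\<^bsub>R \<union> {\<kappa>}\<^esub> \<theta>) \<Phi>\<^bsub>R\<^esub>(\<theta>)\<close>, and since \<open>\<phi>\<close> has no zeros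
  this recursion determines all of them.

  For the jump process it is Campbell's formula for the marked Poisson process.  For the Busemann
  process it rests on the move \<open>(a, b, c) \<mapsto> (c + (a - b)\<^sup>+, c + (b - a)\<^sup>+, min a b)\<close>, an involution
  by which the increments and the weight at one lattice site are updated.  It preserves products of
  exponential laws when the rate of \<open>c\<close> is the sum of those of \<open>a\<close> and \<open>b\<close>, and it satisfies a
  tetrahedron identity.  The latter allows one to couple the stationary lines of
  all parameters in a finite window so that the line of parameter \<open>\<kappa>\<close> decouples from the increments of the
  others over it.  The Busemann functions are compared with this coupling along growing windows by
  means of their last-passage approximations.\<close>


section \<open>Exchanges and the tetrahedron identity\<close>


text \<open>The hypotheses on laws concern one parameter at a time: exponential marginals and
  independence along down-right paths. The joint law over several parameters must come from the fact
  that all Busemann functions are limits of functions of the same weights. Hence the window coupling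
  need not reproduce the joint law of the Busemann increments on the boundary. It has to be right
  line by line: for each parameter separately, the swept line together with the weights has the
  correct law. Last-passage approximations read weights alone, so the error of each of them is a
  one-parameter quantity, the same in both models, and it tends to 0. This freedom permits
  independent boundary lines and one auxiliary variable per \<rho>, of rate 1/\<kappa> - 1/\<rho>,
  which balances the rates wherever the lines \<kappa> and \<rho> meet.

  The parameter 1 is treated apart, since its vertical rate 1 - 1/\<kappa> vanishes: there the
  increments over the weight at x read other weights only. On the Poisson side the intensity 1/s
  turns (1 - \<phi>(us))/s into a logarithmic derivative, which is why the value at \<kappa> is
  again exponential.\<close>

definition exchange :: "'k \<times> 'k \<times> 'k \<Rightarrow> ('k \<Rightarrow> real) \<Rightarrow> 'k \<Rightarrow> real" where
  "exchange = (\<lambda>(a, b, c) w.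
     w(a := w c + max 0 (w a - w b), b := w c + max 0 (w b - w a), c := min (w a) (w b)))"

text \<open>\<open>fold\<close> performs the head of the list first, so lists of moves are read from
  left to right in the order of time.\<close>

abbreviation exchanges :: "('k \<times> 'k \<times> 'k) list \<Rightarrow> ('k \<Rightarrow> real) \<Rightarrow> 'k \<Rightarrow> real" where
  "exchanges \<equiv> fold exchange"

definition slots :: "'k \<times> 'k \<times> 'k \<Rightarrow> 'k set" where
  "slots = (\<lambda>(a, b, c). {a, b, c})"

abbreviation slots_of :: "('k \<times> 'k \<times> 'k) list \<Rightarrow> 'k set" where
  "slots_of ms \<equiv> (\<Union>m\<in>set ms. slots m)"

text \<open>In terms of the difference of the entries at a and b, their minimum, and the entry at c,
  the move keeps the difference and swaps the minimum with the entry at c.\<close>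

lemma exchange_exchange:
  assumes "distinct [a, b, c]"
  shows "exchange (a, b, c) (exchange (a, b, c) w) = w"
proof
  fix z
  have "min (u + max 0 (x - y)) (u + max 0 (y - x)) = u"
    "min x y + max 0 (max 0 (x - y) - max 0 (y - x)) = x"
    "min x y + max 0 (max 0 (y - x) - max 0 (x - y)) = y" for x y u :: real
    by linarith+
  then show "exchange (a, b, c) (exchange (a, b, c) w) z = w z"
    using assms by (simp add: exchange_def min.commute)
qed

lemma exchange_outside: "z \<notin> slots m \<Longrightarrow> exchange m w z = w z"
  by (cases m) (simp add: exchange_def slots_def)

lemma exchange_cong:
  assumes "\<And>z. z \<in> slots m \<Longrightarrow> w z = w' z" and "w z = w' z"
  shows "exchange m w z = exchange m w' z"
  using assms by (cases m) (auto simp: exchange_def slots_def)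

lemma exchange_commute:
  assumes "slots m \<inter> slots m' = {}"
  shows "exchange m (exchange m' w) = exchange m' (exchange m w)"
proof
  fix z
  have *: "exchange n (exchange n' w) z = exchange n' (exchange n w) z"
    if "slots n \<inter> slots n' = {}" "z \<notin> slots n'" for n n'
  proof -
    have "exchange n (exchange n' w) z = exchange n w z"
      using that by (intro exchange_cong) (auto intro!: exchange_outside)
    also have "\<dots> = exchange n' (exchange n w) z"
      using that by (simp add: exchange_outside)
    finally show ?thesis .
  qed
  show "exchange m (exchange m' w) z = exchange m' (exchange m w) z"
  proof (cases "z \<in> slots m'")
    case True
    with assms have "z \<notin> slots m" by blast
    with *[of m' m] assms show ?thesis by (simp add: Int_commute)
  qed (use * assms in blast)
qed

lemma exchanges_outside: "z \<notin> slots_of ms \<Longrightarrow> exchanges ms w z = w z"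
  by (induction ms arbitrary: w) (auto simp: exchange_outside)

lemma exchanges_cong:
  assumes "slots_of ms \<subseteq> S" "\<And>z. z \<in> S \<Longrightarrow> w z = w' z" "z \<in> S"
  shows "exchanges ms w z = exchanges ms w' z"
  using assms(1,2)
proof (induction ms arbitrary: w w')
  case Nil
  with assms(3) show ?case by simp
next
  case (Cons m ms)
  have "exchange m w y = exchange m w' y" if "y \<in> S" for y
    using Cons.prems that by (intro exchange_cong) auto
  moreover have "slots_of ms \<subseteq> S"
    using Cons.prems(1) by simp
  ultimately show ?case
    using Cons.IH[of "exchange m w" "exchange m w'"] by simp
qed

lemma exchange_exchanges_commute:
  assumes "slots m \<inter> slots_of ms = {}"
  shows "exchanges ms (exchange m w) = exchange m (exchanges ms w)"
  using assms
proof (induction ms arbitrary: w)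
  case (Cons m' ms)
  then have "exchange m' (exchange m w) = exchange m (exchange m' w)"
    by (intro exchange_commute) auto
  with Cons show ?case by auto
qed auto

lemma exchanges_commute:
  assumes "slots_of ms \<inter> slots_of ms' = {}"
  shows "exchanges ms (exchanges ms' w) = exchanges ms' (exchanges ms w)"
  using assms
proof (induction ms arbitrary: w)
  case (Cons m ms)
  have "exchange m (exchanges ms' w) = exchanges ms' (exchange m w)"
    using Cons.prems by (intro exchange_exchanges_commute[symmetric]) auto
  with Cons show ?case by auto
qed auto

lemma exchanges_rev:
  assumes "\<And>a b c. (a, b, c) \<in> set ms \<Longrightarrow> distinct [a, b, c]"
  shows "exchanges ms (exchanges (rev ms) w) = w"
  using assms
proof (induction ms arbitrary: w)
  case (Cons m ms)
  obtain a b c where m: "m = (a, b, c)" by (cases m)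
  have "distinct [a, b, c]"
    using Cons.prems[of a b c] m by simp
  moreover have "exchanges ms (exchanges (rev ms) v) = v" for v
    using Cons.prems by (intro Cons.IH) (meson list.set_intros(2))
  ultimately show ?case
    using m by (simp add: exchange_exchange)
qed auto



text \<open>Without positive parts only \<open>+\<close>, \<open>-\<close> and \<open>min\<close>
  occur. This is the subtraction-tropical form in which the tetrahedron identity is
  computed.\<close>

lemma exchange_min:
  "exchange (a, b, c) w =
     w(a := w c + w a - min (w a) (w b), b := w c + w b - min (w a) (w b), c := min (w a) (w b))"
proof -
  have "w c + max 0 (w a - w b) = w c + w a - min (w a) (w b)"
    "w c + max 0 (w b - w a) = w c + w b - min (w a) (w b)"
    by linarith+
  then show ?thesis by (simp only: exchange_def prod.case)
qed

text \<open>In the semifield of reals with \<open>min\<close> as addition and \<open>+\<close> as multiplication both sides are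
  rational functions; \<open>T\<close>, \<open>U\<close>, \<open>W\<close> are their common denominators.\<close>

lemma tetrahedron:
  assumes "distinct [H, p, q, A, K, Y]"
  shows "exchanges [(H, p, A), (H, q, Y), (A, K, Y), (p, K, q)] w =
         exchanges [(p, K, q), (A, K, Y), (H, q, Y), (H, p, A)] w"
proof
  fix z
  define a h k y r s where vars: "a = w A" "h = w H" "k = w K" "y = w Y" "r = w p" "s = w q"
  define T where "T = min (a + h) (min (s + h) (s + r))"
  define U where "U = min h (min r k)"
  define W where "W = min (a + r) (min (a + k) (s + k))"
  have 1: "min (a + h - min h r) s = T - min h r"
    by (simp add: T_def min_def)
  have 2: "min (min h r) k = U" "min h (min r k) = U"
    by (simp_all add: U_def min.assoc)
  have 3: "min a (s + k - min r k) = W - min r k"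
    by (simp add: W_def min_def)
  \<comment> \<open>Distributed over \<open>min\<close>, both sides are the minimum of the same six
    sums. The same happens in the next identity of this kind.\<close>
  have "min (W + h) (s + r + U) = T + min r k"
    unfolding T_def U_def W_def by (simp only: min_add_distrib_left min_add_distrib_right ac_simps)
  then have 4: "min (W - min r k + h - U) (s + r - min r k) = T - U"
    by linarith
  have "min (a + r + U) (T + k) = W + min h r"
    unfolding T_def U_def W_def by (simp only: min_add_distrib_left min_add_distrib_right ac_simps)
  then have 5: "min (a + r - min h r) (T - min h r + k - U) = W - U"
    by linarith
  have d: "distinct [H, p, q, A, K, Y]" "distinct [Y, K, A, q, p, H]"
    using assms by auto
  define w1 where "w1 = exchange (H, p, A) w"
  define w2 where "w2 = exchange (H, q, Y) w1"
  define w3 where "w3 = exchange (A, K, Y) w2"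
  define w4 where "w4 = exchange (p, K, q) w3"
  define v1 where "v1 = exchange (p, K, q) w"
  define v2 where "v2 = exchange (A, K, Y) v1"
  define v3 where "v3 = exchange (H, q, Y) v2"
  define v4 where "v4 = exchange (H, p, A) v3"
  have w1: "w1 H = a + h - min h r" "w1 p = a + r - min h r" "w1 A = min h r"
    "w1 q = s" "w1 K = k" "w1 Y = y"
    using d by (simp_all add: w1_def exchange_min vars)
  have w2: "w2 H = y + a + h - T" "w2 q = y + s - (T - min h r)" "w2 Y = T - min h r"
    "w2 p = a + r - min h r" "w2 A = min h r" "w2 K = k"
    using d 1 by (simp_all add: w2_def exchange_min w1)
  have w3: "w3 A = T - U" "w3 K = T - min h r + k - U" "w3 Y = U"
    "w3 H = y + a + h - T" "w3 q = y + s - (T - min h r)" "w3 p = a + r - min h r"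
    using d 2 by (simp_all add: w3_def exchange_min w2)
  have w4: "w4 p = y + s - (T - min h r) + (a + r - min h r) - (W - U)"
    "w4 K = y + s - (T - min h r) + (T - min h r + k - U) - (W - U)" "w4 q = W - U"
    "w4 A = T - U" "w4 Y = U" "w4 H = y + a + h - T"
    using d 5 by (simp_all add: w4_def exchange_min w3)
  have v1: "v1 p = s + r - min r k" "v1 K = s + k - min r k" "v1 q = min r k"
    "v1 H = h" "v1 A = a" "v1 Y = y"
    using d by (simp_all add: v1_def exchange_min vars)
  have v2: "v2 A = y + a - (W - min r k)" "v2 K = y + (s + k - min r k) - (W - min r k)"
    "v2 Y = W - min r k" "v2 p = s + r - min r k" "v2 q = min r k" "v2 H = h"
    using d 3 by (simp_all add: v2_def exchange_min v1)
  have v3: "v3 H = W - min r k + h - U" "v3 q = W - U" "v3 Y = U"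
    "v3 A = y + a - (W - min r k)" "v3 K = y + (s + k - min r k) - (W - min r k)"
    "v3 p = s + r - min r k"
    using d 2 by (simp_all add: v3_def exchange_min v2)
  have v4: "v4 H = y + a - (W - min r k) + (W - min r k + h - U) - (T - U)"
    "v4 p = y + a - (W - min r k) + (s + r - min r k) - (T - U)" "v4 A = T - U"
    "v4 q = W - U" "v4 Y = U" "v4 K = y + (s + k - min r k) - (W - min r k)"
    using d 4 by (simp_all add: v4_def exchange_min v3)
  have "w4 z = v4 z"
  proof (cases "z \<in> {H, p, q, A, K, Y}")
    case True
    then consider "z = H" | "z = p" | "z = q" | "z = A" | "z = K" | "z = Y" by auto
    then show ?thesis
      using w4 v4 by cases simp_all
  next
    case False
    then show ?thesis
      by (simp add: w4_def w3_def w2_def w1_def v4_def v3_def v2_def v1_def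
          exchange_outside slots_def)
  qed
  then show "exchanges [(H, p, A), (H, q, Y), (A, K, Y), (p, K, q)] w z =
         exchanges [(p, K, q), (A, K, Y), (H, q, Y), (H, p, A)] w z"
    by (simp add: w4_def w3_def w2_def w1_def v4_def v3_def v2_def v1_def)
qed


section \<open>Words of exchanges that sweep lines through a window\<close>

lemma exchanges_swap:
  assumes "slots_of xs \<inter> slots_of ys = {}"
  shows "exchanges (as @ xs @ ys @ bs) = exchanges (as @ ys @ xs @ bs)"
  by (intro ext) (simp add: exchanges_commute[OF assms])

lemma exchanges_subst:
  assumes "exchanges xs = exchanges ys"
  shows "exchanges (as @ xs @ bs) = exchanges (as @ ys @ bs)"
  using assms by simp

text \<open>Slots are storage places that the moves overwrite. \<open>Hor \<rho> k\<close> carries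
  the current horizontal increment of the line \<rho> in column k, \<open>Ver \<rho> t\<close> its
  vertical increment in row t, and \<open>Cell k t\<close> a weight. \<open>Diag \<rho>\<close> is
  the carry between the lines \<kappa> and \<rho>.\<close>

datatype slot = Hor real nat | Ver real nat | Diag real | Cell nat nat

text \<open>One customer of a queue: \<open>Hor \<rho> k\<close> holds the inter-arrival time and
  becomes the inter-departure time, \<open>Hor \<kappa> k\<close> holds the service time and becomes
  the dual service time, and \<open>Diag \<rho>\<close> passes the sojourn time on to the next
  customer.\<close>

definition corner :: "real \<Rightarrow> real \<Rightarrow> nat \<Rightarrow> slot \<times> slot \<times> slot" where
  "corner \<kappa> \<rho> k = (Hor \<rho> k, Diag \<rho>, Hor \<kappa> k)"

definition side :: "real \<Rightarrow> real \<Rightarrow> nat \<Rightarrow> (slot \<times> slot \<times> slot) list" where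
  "side \<kappa> \<rho> n = map (\<lambda>t. (Diag \<rho>, Ver \<kappa> t, Ver \<rho> t)) [0..<n]"

definition cell_column :: "real \<Rightarrow> nat \<Rightarrow> nat \<Rightarrow> (slot \<times> slot \<times> slot) list" where
  "cell_column \<rho> n k = map (\<lambda>t. (Hor \<rho> k, Ver \<rho> t, Cell k t)) [0..<n]"

definition sweep :: "real \<Rightarrow> nat \<Rightarrow> nat \<Rightarrow> (slot \<times> slot \<times> slot) list" where
  "sweep \<rho> m n = concat (map (cell_column \<rho> n) [0..<m])"

definition bottom :: "real \<Rightarrow> real \<Rightarrow> nat \<Rightarrow> (slot \<times> slot \<times> slot) list" where
  "bottom \<kappa> \<rho> m = map (corner \<kappa> \<rho>) [0..<m]"

text \<open>Each corner comes after the cells of its column, hence on the upper boundary of the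
  window, whereas \<open>bottom\<close> performs the corners before any cell is visited.\<close>

definition top_sweep :: "real \<Rightarrow> real \<Rightarrow> nat \<Rightarrow> nat \<Rightarrow> (slot \<times> slot \<times> slot) list" where
  "top_sweep \<kappa> \<rho> m n = concat (map (\<lambda>k. cell_column \<rho> n k @ [corner \<kappa> \<rho> k]) [0..<m])"

lemmas move_defs = corner_def side_def cell_column_def sweep_def bottom_def top_sweep_def slots_def

text \<open>One tetrahedron per row. The corner of the column moves from below the cells to above
  them, while the side moves from the right of the column to its left. In the induction step the
  moves of the new row slide past moves on disjoint slots until the four moves of the tetrahedron
  are adjacent.\<close>

lemma cell_column_commute:
  assumes "\<kappa> \<noteq> \<rho>"
  shows "exchanges (corner \<kappa> \<rho> k # cell_column \<rho> n k @ cell_column \<kappa> n k @ side \<kappa> \<rho> n) =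
         exchanges (side \<kappa> \<rho> n @ cell_column \<kappa> n k @ cell_column \<rho> n k @ [corner \<kappa> \<rho> k])"
proof (induction n)
  case 0
  show ?case by (simp add: cell_column_def side_def)
next
  case (Suc n)
  define h b a s where moves: "h = corner \<kappa> \<rho> k" "b = (Hor \<rho> k, Ver \<rho> n, Cell k n)"
    "a = (Hor \<kappa> k, Ver \<kappa> n, Cell k n)" "s = (Diag \<rho>, Ver \<kappa> n, Ver \<rho> n)"
  note mvs = moves[unfolded corner_def]
  define bs as ss where lists: "bs = cell_column \<rho> n k" "as = cell_column \<kappa> n k" "ss = side \<kappa> \<rho> n"
  note disjoint = assms assms[symmetric] mvs lists move_defs
  have col: "cell_column \<rho> (Suc n) k = bs @ [b]" "cell_column \<kappa> (Suc n) k = as @ [a]"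
    "side \<kappa> \<rho> (Suc n) = ss @ [s]"
    by (simp_all add: cell_column_def side_def moves lists)
  have "exchanges (h # (bs @ [b]) @ (as @ [a]) @ (ss @ [s])) =
    exchanges ((h # bs) @ [b] @ as @ ([a] @ ss @ [s]))"
    by simp
  also have "\<dots> = exchanges ((h # bs) @ as @ [b] @ ([a] @ ss @ [s]))"
    by (rule exchanges_swap) (auto simp: disjoint)
  also have "\<dots> = exchanges ((h # bs @ as) @ [b, a] @ ss @ [s])"
    by simp
  also have "\<dots> = exchanges ((h # bs @ as) @ ss @ [b, a] @ [s])"
    by (rule exchanges_swap) (auto simp: disjoint)
  also have "\<dots> = exchanges ([] @ (h # bs @ as @ ss) @ [b, a, s])"
    by simp
  also have "\<dots> = exchanges ([] @ (ss @ as @ bs @ [h]) @ [b, a, s])"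
    using Suc.IH unfolding moves lists by (rule exchanges_subst)
  also have "\<dots> = exchanges ((ss @ as @ bs) @ [h, b, a, s] @ [])"
    by simp
  \<comment> \<open>The tetrahedron with H = \<open>Hor \<rho> k\<close>, p =
    \<open>Diag \<rho>\<close>, q = \<open>Ver \<rho> n\<close>, A = \<open>Hor \<kappa> k\<close>,
    K = \<open>Ver \<kappa> n\<close> and Y = \<open>Cell k n\<close>.\<close>
  also have "\<dots> = exchanges ((ss @ as @ bs) @ [s, a, b, h] @ [])"
  proof (rule exchanges_subst)
    show "exchanges [h, b, a, s] = exchanges [s, a, b, h]"
      unfolding mvs using assms by (intro ext tetrahedron) auto
  qed
  also have "\<dots> = exchanges (ss @ (as @ bs) @ [s] @ [a, b, h])"
    by simp
  also have "\<dots> = exchanges (ss @ [s] @ (as @ bs) @ [a, b, h])"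
    by (rule exchanges_swap) (auto simp: disjoint)
  also have "\<dots> = exchanges ((ss @ [s] @ as) @ bs @ [a] @ [b, h])"
    by simp
  also have "\<dots> = exchanges ((ss @ [s] @ as) @ [a] @ bs @ [b, h])"
    by (rule exchanges_swap) (auto simp: disjoint)
  also have "\<dots> = exchanges ((ss @ [s]) @ (as @ [a]) @ (bs @ [b]) @ [h])"
    by simp
  finally show ?case
    unfolding col moves(1) .
qed

text \<open>The side travels through the columns one by one, from the last to the first. Different
  columns share only vertical slots and the carry, and the lines \<kappa> and \<rho> have different
  vertical slots. So the column-wise words may be regrouped into whole sweeps.\<close>

lemma window_commute:
  assumes "\<kappa> \<noteq> \<rho>"
  shows "exchanges (bottom \<kappa> \<rho> m @ sweep \<rho> m n @ sweep \<kappa> m n @ side \<kappa> \<rho> n) =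
         exchanges (side \<kappa> \<rho> n @ sweep \<kappa> m n @ top_sweep \<kappa> \<rho> m n)"
proof -
  let ?L = "\<lambda>k. corner \<kappa> \<rho> k # cell_column \<rho> n k @ cell_column \<kappa> n k"
  let ?R = "\<lambda>k. cell_column \<kappa> n k @ cell_column \<rho> n k @ [corner \<kappa> \<rho> k]"
  have 1: "exchanges (concat (map ?L [0..<m])) =
    exchanges (bottom \<kappa> \<rho> m @ sweep \<rho> m n @ sweep \<kappa> m n)"
  proof (induction m)
    case (Suc m)
    let ?h = "[corner \<kappa> \<rho> m]" and ?b = "cell_column \<rho> n m" and ?a = "cell_column \<kappa> n m"
    have "exchanges (concat (map ?L [0..<Suc m])) =
      exchanges ([] @ concat (map ?L [0..<m]) @ (?h @ ?b @ ?a))"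
      by simp
    also have "\<dots> = exchanges ([] @ (bottom \<kappa> \<rho> m @ sweep \<rho> m n @ sweep \<kappa> m n) @ (?h @ ?b @ ?a))"
      by (intro exchanges_subst Suc)
    also have "\<dots> = exchanges (bottom \<kappa> \<rho> m @ (sweep \<rho> m n @ sweep \<kappa> m n) @ ?h @ (?b @ ?a))"
      by simp
    also have "\<dots> = exchanges (bottom \<kappa> \<rho> m @ ?h @ (sweep \<rho> m n @ sweep \<kappa> m n) @ (?b @ ?a))"
      by (rule exchanges_swap) (use assms in \<open>auto simp: move_defs\<close>)
    also have "\<dots> = exchanges ((bottom \<kappa> \<rho> m @ ?h @ sweep \<rho> m n) @ sweep \<kappa> m n @ ?b @ ?a)"
      by simp
    also have "\<dots> = exchanges ((bottom \<kappa> \<rho> m @ ?h @ sweep \<rho> m n) @ ?b @ sweep \<kappa> m n @ ?a)"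
      by (rule exchanges_swap) (use assms in \<open>auto simp: move_defs\<close>)
    finally show ?case
      by (simp add: bottom_def sweep_def)
  qed (simp add: bottom_def sweep_def)
  have 2: "exchanges (concat (map ?R [0..<m])) = exchanges (sweep \<kappa> m n @ top_sweep \<kappa> \<rho> m n)"
  proof (induction m)
    case (Suc m)
    let ?h = "[corner \<kappa> \<rho> m]" and ?b = "cell_column \<rho> n m" and ?a = "cell_column \<kappa> n m"
    have "exchanges (concat (map ?R [0..<Suc m])) =
      exchanges ([] @ concat (map ?R [0..<m]) @ (?a @ ?b @ ?h))"
      by simp
    also have "\<dots> = exchanges ([] @ (sweep \<kappa> m n @ top_sweep \<kappa> \<rho> m n) @ (?a @ ?b @ ?h))"
      by (intro exchanges_subst Suc)
    also have "\<dots> = exchanges (sweep \<kappa> m n @ top_sweep \<kappa> \<rho> m n @ ?a @ (?b @ ?h))"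
      by simp
    also have "\<dots> = exchanges (sweep \<kappa> m n @ ?a @ top_sweep \<kappa> \<rho> m n @ (?b @ ?h))"
      by (rule exchanges_swap) (use assms in \<open>auto simp: move_defs\<close>)
    finally show ?case
      by (simp add: top_sweep_def sweep_def)
  qed (simp add: top_sweep_def sweep_def)
  have 3: "exchanges (concat (map ?L [0..<m]) @ side \<kappa> \<rho> n) =
    exchanges (side \<kappa> \<rho> n @ concat (map ?R [0..<m]))"
  proof (induction m)
    case (Suc m)
    have "exchanges (concat (map ?L [0..<Suc m]) @ side \<kappa> \<rho> n) =
      exchanges (concat (map ?L [0..<m]) @ (?L m @ side \<kappa> \<rho> n) @ [])"
      by simp
    also have "\<dots> = exchanges (concat (map ?L [0..<m]) @ (side \<kappa> \<rho> n @ ?R m) @ [])"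
      using cell_column_commute[OF assms] by (intro exchanges_subst) simp
    also have "\<dots> = exchanges ([] @ (concat (map ?L [0..<m]) @ side \<kappa> \<rho> n) @ ?R m)"
      by simp
    also have "\<dots> = exchanges ([] @ (side \<kappa> \<rho> n @ concat (map ?R [0..<m])) @ ?R m)"
      by (intro exchanges_subst Suc)
    finally show ?case by simp
  qed simp
  show ?thesis
    using 1 2 3 by (simp add: comp_assoc)
qed

text \<open>In \<open>window_commute\<close> the moves that follow the sweep of \<rho> do not touch
  \<open>Hor \<rho> m\<close>, and the leading side is undone by its reversal. Thus the line \<rho>,
  computed on the left from what the line \<kappa> leaves behind, is on the right a line swept
  through the original cells: the moves before that sweep act on boundary slots only.\<close>

lemma window_identity:
  assumes "\<kappa> \<noteq> \<rho>"
  shows "exchanges (top_sweep \<kappa> \<rho> (Suc m) n) (exchanges (sweep \<kappa> (Suc m) n) v) (Hor \<rho> m) =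
         exchanges (sweep \<rho> (Suc m) n)
           (exchanges (bottom \<kappa> \<rho> (Suc m)) (exchanges (rev (side \<kappa> \<rho> n)) v)) (Hor \<rho> m)"
proof -
  let ?u = "exchanges (rev (side \<kappa> \<rho> n)) v"
  have "exchanges (side \<kappa> \<rho> n) ?u = v"
    using assms by (intro exchanges_rev) (auto simp: side_def)
  then have "exchanges (top_sweep \<kappa> \<rho> (Suc m) n) (exchanges (sweep \<kappa> (Suc m) n) v) =
    exchanges (sweep \<kappa> (Suc m) n @ side \<kappa> \<rho> n)
      (exchanges (sweep \<rho> (Suc m) n) (exchanges (bottom \<kappa> \<rho> (Suc m)) ?u))"
    using fun_cong[OF window_commute[OF assms, of "Suc m" n], of ?u] by simp
  moreover have "Hor \<rho> m \<notin> slots_of (sweep \<kappa> (Suc m) n @ side \<kappa> \<rho> n)"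
    using assms by (auto simp: move_defs)
  ultimately show ?thesis
    by (metis exchanges_outside)
qed

text \<open>The last exchange is the only one that reads the slot \<open>Hor \<kappa> m\<close>.\<close>

lemma top_sweep_increment:
  assumes "\<kappa> \<noteq> \<rho>"
  shows "exchanges (top_sweep \<kappa> \<rho> (Suc m) n) (v(Hor \<kappa> m := y)) (Hor \<rho> m) - y =
         exchanges (top_sweep \<kappa> \<rho> (Suc m) n) v (Hor \<rho> m) - v (Hor \<kappa> m)"
proof -
  define ms where "ms = top_sweep \<kappa> \<rho> m n @ cell_column \<rho> n m"
  define D where "D v = max 0 (exchanges ms v (Hor \<rho> m) - exchanges ms v (Diag \<rho>))" for v
  have S: "slots_of ms \<subseteq> UNIV - {Hor \<kappa> m}"
    using assms by (auto simp: ms_def move_defs)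
  have "top_sweep \<kappa> \<rho> (Suc m) n = ms @ [corner \<kappa> \<rho> m]"
    by (simp add: ms_def top_sweep_def)
  moreover have "exchanges ms v (Hor \<kappa> m) = v (Hor \<kappa> m)" for v
    using S by (intro exchanges_outside) auto
  ultimately have "exchanges (top_sweep \<kappa> \<rho> (Suc m) n) v (Hor \<rho> m) - v (Hor \<kappa> m) = D v" for v
    using assms by (simp add: corner_def exchange_def D_def)
  moreover have "exchanges ms (v(Hor \<kappa> m := y)) z = exchanges ms v z" if "z \<noteq> Hor \<kappa> m" for z
    using S that by (intro exchanges_cong[of ms "UNIV - {Hor \<kappa> m}"]) auto
  then have "D (v(Hor \<kappa> m := y)) = D v"
    using assms by (simp add: D_def)
  ultimately show ?thesis
    by (metis fun_upd_same)
qed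


section \<open>Exponential product laws\<close>


abbreviation exp_law :: "real \<Rightarrow> real measure" where
  "exp_law r \<equiv> density lborel (\<lambda>x. ennreal (exponential_density r x))"

text \<open>Coordinates adapted to the exchange: the absolute difference d of the two variables and
  the smaller of them, on either side of the diagonal.\<close>

lemma nn_integral_lborel_split_diagonal:
  fixes f :: "real \<Rightarrow> real \<Rightarrow> ennreal"
  assumes [measurable]: "case_prod f \<in> borel_measurable (borel \<Otimes>\<^sub>M borel)"
  shows "(\<integral>\<^sup>+x. \<integral>\<^sup>+y. f x y \<partial>lborel \<partial>lborel) =
    (\<integral>\<^sup>+d. \<integral>\<^sup>+y. f (y + d) y * indicator {0..} d \<partial>lborel \<partial>lborel) +
    (\<integral>\<^sup>+d. \<integral>\<^sup>+x. f x (x + d) * indicator {0<..} d \<partial>lborel \<partial>lborel)"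
proof -
  have shift: "(\<integral>\<^sup>+x. h x \<partial>lborel) = (\<integral>\<^sup>+x. h (t + x) \<partial>lborel)"
    if "h \<in> borel_measurable borel" for h :: "real \<Rightarrow> ennreal" and t
    using nn_integral_real_affine[OF that, of 1 t] by simp
  have shift1: "(\<integral>\<^sup>+x. f x y * indicator {0..} (x - y) \<partial>lborel) =
      (\<integral>\<^sup>+d. f (y + d) y * indicator {0..} d \<partial>lborel)" for y
    by (subst shift[where t = y]) auto
  have shift2: "(\<integral>\<^sup>+y. f x y * indicator {0<..} (y - x) \<partial>lborel) =
      (\<integral>\<^sup>+d. f x (x + d) * indicator {0<..} d \<partial>lborel)" for x
    by (subst shift[where t = x]) auto
  have "(\<integral>\<^sup>+x. \<integral>\<^sup>+y. f x y \<partial>lborel \<partial>lborel) =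
    (\<integral>\<^sup>+x. \<integral>\<^sup>+y. f x y * indicator {0..} (x - y) + f x y * indicator {0<..} (y - x) \<partial>lborel \<partial>lborel)"
    by (intro nn_integral_cong) (auto simp: indicator_def)
  also have "\<dots> = (\<integral>\<^sup>+x. \<integral>\<^sup>+y. f x y * indicator {0..} (x - y) \<partial>lborel \<partial>lborel) +
    (\<integral>\<^sup>+x. \<integral>\<^sup>+y. f x y * indicator {0<..} (y - x) \<partial>lborel \<partial>lborel)"
    by (simp add: nn_integral_add)
  also have "(\<integral>\<^sup>+x. \<integral>\<^sup>+y. f x y * indicator {0..} (x - y) \<partial>lborel \<partial>lborel) =
      (\<integral>\<^sup>+y. \<integral>\<^sup>+x. f x y * indicator {0..} (x - y) \<partial>lborel \<partial>lborel)"
    by (rule lborel_pair.Fubini'[symmetric]) measurable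
  also have "\<dots> = (\<integral>\<^sup>+y. \<integral>\<^sup>+d. f (y + d) y * indicator {0..} d \<partial>lborel \<partial>lborel)"
    by (simp only: shift1)
  also have "\<dots> = (\<integral>\<^sup>+d. \<integral>\<^sup>+y. f (y + d) y * indicator {0..} d \<partial>lborel \<partial>lborel)"
    by (rule lborel_pair.Fubini') measurable
  also have "(\<integral>\<^sup>+x. \<integral>\<^sup>+y. f x y * indicator {0<..} (y - x) \<partial>lborel \<partial>lborel) =
      (\<integral>\<^sup>+x. \<integral>\<^sup>+d. f x (x + d) * indicator {0<..} d \<partial>lborel \<partial>lborel)"
    by (simp only: shift2)
  also have "\<dots> = (\<integral>\<^sup>+d. \<integral>\<^sup>+x. f x (x + d) * indicator {0<..} d \<partial>lborel \<partial>lborel)"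
    by (rule lborel_pair.Fubini') measurable
  finally show ?thesis .
qed

lemma measurable_curry3:
  assumes "(\<lambda>(x, y, z). h x y z) \<in> measurable (A \<Otimes>\<^sub>M B \<Otimes>\<^sub>M C) N"
    and "f \<in> measurable M A" "g \<in> measurable M B" "k \<in> measurable M C"
  shows "(\<lambda>w. h (f w) (g w) (k w)) \<in> measurable M N"
  using measurable_compose[OF measurable_Pair[OF assms(2) measurable_Pair[OF assms(3,4)]] assms(1)]
  by simp

text \<open>In the coordinates d = |x - y|, min x y and z the exchange swaps the last two and
  preserves which of x and y is larger. The joint density is proportional to exp(- \<alpha> d -
  (\<alpha> + \<gamma>) (min x y + z)) for x \<ge> y, and to the same expression with \<gamma> d in
  place of \<alpha> d otherwise. It is symmetric under the swap because z has rate \<alpha> +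
  \<gamma>.\<close>

lemma nn_integral_exp_law_exchange:
  fixes g :: "real \<Rightarrow> real \<Rightarrow> real \<Rightarrow> ennreal"
  assumes g: "(\<lambda>(x, y, z). g x y z) \<in> borel_measurable (borel \<Otimes>\<^sub>M borel \<Otimes>\<^sub>M borel)"
    and pos: "\<alpha> > 0" "\<gamma> > 0"
  shows "(\<integral>\<^sup>+x. \<integral>\<^sup>+y. \<integral>\<^sup>+z. g (z + max 0 (x - y)) (z + max 0 (y - x)) (min x y)
      \<partial>exp_law (\<alpha> + \<gamma>) \<partial>exp_law \<gamma> \<partial>exp_law \<alpha>) =
    (\<integral>\<^sup>+x. \<integral>\<^sup>+y. \<integral>\<^sup>+z. g x y z \<partial>exp_law (\<alpha> + \<gamma>) \<partial>exp_law \<gamma> \<partial>exp_law \<alpha>)"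
proof -
  define F where "F x y z = ennreal (exponential_density \<alpha> x) *
    (ennreal (exponential_density \<gamma> y) * ennreal (exponential_density (\<alpha> + \<gamma>) z))" for x y z
  note measurable_curry3[OF g, measurable (raw)]
  have F: "(\<lambda>(x, y, z). F x y z) \<in> borel_measurable (borel \<Otimes>\<^sub>M borel \<Otimes>\<^sub>M borel)"
    unfolding F_def by measurable
  note measurable_curry3[OF F, measurable (raw)]
  have density: "(\<integral>\<^sup>+x. \<integral>\<^sup>+y. \<integral>\<^sup>+z. h x y z \<partial>exp_law (\<alpha> + \<gamma>) \<partial>exp_law \<gamma> \<partial>exp_law \<alpha>) =
      (\<integral>\<^sup>+x. \<integral>\<^sup>+y. \<integral>\<^sup>+z. F x y z * h x y z \<partial>lborel \<partial>lborel \<partial>lborel)"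
    if h: "(\<lambda>(x, y, z). h x y z) \<in> borel_measurable (borel \<Otimes>\<^sub>M borel \<Otimes>\<^sub>M borel)"
    for h :: "real \<Rightarrow> real \<Rightarrow> real \<Rightarrow> ennreal"
  proof -
    note measurable_curry3[OF h, measurable (raw)]
    have "(\<integral>\<^sup>+x. \<integral>\<^sup>+y. \<integral>\<^sup>+z. h x y z \<partial>exp_law (\<alpha> + \<gamma>) \<partial>exp_law \<gamma> \<partial>exp_law \<alpha>) =
      (\<integral>\<^sup>+x. \<integral>\<^sup>+y. exponential_density \<gamma> y * (\<integral>\<^sup>+z. exponential_density (\<alpha> + \<gamma>) z * h x y z
        \<partial>lborel) \<partial>lborel \<partial>exp_law \<alpha>)"
      by (simp add: nn_integral_density)
    also have "\<dots> = (\<integral>\<^sup>+x. exponential_density \<alpha> x * (\<integral>\<^sup>+y. exponential_density \<gamma> y *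
        (\<integral>\<^sup>+z. exponential_density (\<alpha> + \<gamma>) z * h x y z \<partial>lborel) \<partial>lborel) \<partial>lborel)"
      by (subst nn_integral_density) measurable
    also have "\<dots> = (\<integral>\<^sup>+x. \<integral>\<^sup>+y. \<integral>\<^sup>+z. F x y z * h x y z \<partial>lborel \<partial>lborel \<partial>lborel)"
      by (simp add: F_def nn_integral_cmult[symmetric] mult.assoc)
    finally show ?thesis .
  qed
  have split: "(\<integral>\<^sup>+x. \<integral>\<^sup>+y. \<integral>\<^sup>+z. h x y z \<partial>lborel \<partial>lborel \<partial>lborel) =
      (\<integral>\<^sup>+d. \<integral>\<^sup>+y. \<integral>\<^sup>+z. h (y + d) y z * indicator {0..} d \<partial>lborel \<partial>lborel \<partial>lborel) +
      (\<integral>\<^sup>+d. \<integral>\<^sup>+x. \<integral>\<^sup>+z. h x (x + d) z * indicator {0<..} d \<partial>lborel \<partial>lborel \<partial>lborel)"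
    if h: "(\<lambda>(x, y, z). h x y z) \<in> borel_measurable (borel \<Otimes>\<^sub>M borel \<Otimes>\<^sub>M borel)"
    for h :: "real \<Rightarrow> real \<Rightarrow> real \<Rightarrow> ennreal"
  proof -
    note measurable_curry3[OF h, measurable (raw)]
    show ?thesis
      by (subst nn_integral_lborel_split_diagonal) (auto simp: nn_integral_multc)
  qed
  let ?g = "\<lambda>x y z. g (z + max 0 (x - y)) (z + max 0 (y - x)) (min x y)"
  have g': "(\<lambda>(x, y, z). ?g x y z) \<in> borel_measurable (borel \<Otimes>\<^sub>M borel \<Otimes>\<^sub>M borel)"
    by measurable
  have Fg: "(\<lambda>(x, y, z). F x y z * g x y z) \<in> borel_measurable (borel \<Otimes>\<^sub>M borel \<Otimes>\<^sub>M borel)"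
    and Fg': "(\<lambda>(x, y, z). F x y z * ?g x y z) \<in> borel_measurable (borel \<Otimes>\<^sub>M borel \<Otimes>\<^sub>M borel)"
    by measurable
  have sym: "F (y + d) y z * indicator {0..} d = F (z + d) z y * indicator {0..} d"
    "F y (y + d) z * indicator {0<..} d = F z (z + d) y * indicator {0<..} d" for y z d
    using pos by (auto simp: F_def exponential_density_def indicator_def ennreal_mult[symmetric]
        exp_add[symmetric] algebra_simps)
  have 1: "F (y + d) y z * ?g (y + d) y z * indicator {0..} d =
      F (z + d) z y * g (z + d) z y * indicator {0..} d" for y z d
    using sym(1)[of y d z] by (auto simp: indicator_def)
  have 2: "F y (y + d) z * ?g y (y + d) z * indicator {0<..} d =
      F z (z + d) y * g z (z + d) y * indicator {0<..} d" for y z d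
    using sym(2)[of y d z] by (auto simp: indicator_def)
  have swap1: "(\<integral>\<^sup>+y. \<integral>\<^sup>+z. F (z + d) z y * g (z + d) z y * indicator {0..} d \<partial>lborel \<partial>lborel) =
      (\<integral>\<^sup>+z. \<integral>\<^sup>+y. F (z + d) z y * g (z + d) z y * indicator {0..} d \<partial>lborel \<partial>lborel)" for d
    by (rule lborel_pair.Fubini') measurable
  have swap2: "(\<integral>\<^sup>+y. \<integral>\<^sup>+z. F z (z + d) y * g z (z + d) y * indicator {0<..} d \<partial>lborel \<partial>lborel) =
      (\<integral>\<^sup>+z. \<integral>\<^sup>+y. F z (z + d) y * g z (z + d) y * indicator {0<..} d \<partial>lborel \<partial>lborel)" for d
    by (rule lborel_pair.Fubini') measurable
  have "(\<integral>\<^sup>+x. \<integral>\<^sup>+y. \<integral>\<^sup>+z. ?g x y z \<partial>exp_law (\<alpha> + \<gamma>) \<partial>exp_law \<gamma> \<partial>exp_law \<alpha>) =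
      (\<integral>\<^sup>+d. \<integral>\<^sup>+y. \<integral>\<^sup>+z. F (z + d) z y * g (z + d) z y * indicator {0..} d \<partial>lborel \<partial>lborel \<partial>lborel) +
      (\<integral>\<^sup>+d. \<integral>\<^sup>+y. \<integral>\<^sup>+z. F z (z + d) y * g z (z + d) y * indicator {0<..} d \<partial>lborel \<partial>lborel \<partial>lborel)"
    by (simp only: density[OF g'] split[OF Fg'] 1 2)
  also have "\<dots> =
      (\<integral>\<^sup>+d. \<integral>\<^sup>+z. \<integral>\<^sup>+y. F (z + d) z y * g (z + d) z y * indicator {0..} d \<partial>lborel \<partial>lborel \<partial>lborel) +
      (\<integral>\<^sup>+d. \<integral>\<^sup>+z. \<integral>\<^sup>+y. F z (z + d) y * g z (z + d) y * indicator {0<..} d \<partial>lborel \<partial>lborel \<partial>lborel)"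
    by (intro arg_cong2[where f = "(+)"] nn_integral_cong swap1 swap2)
  also have "\<dots> = (\<integral>\<^sup>+x. \<integral>\<^sup>+y. \<integral>\<^sup>+z. g x y z \<partial>exp_law (\<alpha> + \<gamma>) \<partial>exp_law \<gamma> \<partial>exp_law \<alpha>)"
    by (simp only: density[OF g] split[OF Fg])
  finally show ?thesis .
qed

lemma product_prob_space_exp_law:
  assumes "\<And>i. r i > 0"
  shows "product_prob_space (\<lambda>i. exp_law (r i))"
  by (intro product_prob_spaceI prob_space_exponential_density assms)

lemma exchange_measurable [measurable]:
  assumes "slots m \<subseteq> K"
  shows "exchange m \<in> measurable (PiM K (\<lambda>_. borel)) (PiM K (\<lambda>_. borel))"
proof -
  obtain a b c where m: "m = (a, b, c)" by (cases m)
  have "exchange m = (\<lambda>w. w(a := w c + max 0 (w a - w b),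
      b := w c + max 0 (w b - w a), c := min (w a) (w b)))"
    by (simp add: exchange_def m)
  moreover have "a \<in> K" "b \<in> K" "c \<in> K"
    using assms by (auto simp: m slots_def)
  ultimately show ?thesis
    by (auto simp del: fun_upd_apply simp: insert_absorb intro!: measurable_fun_upd[where J = K])
qed

lemma exchanges_measurable:
  assumes "slots_of ms \<subseteq> K"
  shows "exchanges ms \<in> measurable (PiM K (\<lambda>_. borel)) (PiM K (\<lambda>_. borel))"
  using assms
proof (induction ms)
  case (Cons m ms)
  then show ?case
    using measurable_comp[OF exchange_measurable[of m K]] by simp
qed simp

text \<open>The other coordinates are held fixed in an outer integral, which leaves the identity in
  three variables.\<close>

lemma distr_exchange_PiM_exp_law:
  assumes "finite K" and r: "\<And>i. r i > 0" and "slots (a, b, c) \<subseteq> K" "distinct [a, b, c]"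
    and sum: "r c = r a + r b"
  shows "distr (PiM K (\<lambda>i. exp_law (r i))) (PiM K (\<lambda>_. borel)) (exchange (a, b, c)) =
    PiM K (\<lambda>i. exp_law (r i))"
proof (rule measure_eqI)
  interpret product_prob_space "\<lambda>i. exp_law (r i)" by (intro product_prob_space_exp_law r)
  let ?P = "\<lambda>K. PiM K (\<lambda>i. exp_law (r i))"
  have sets_P[measurable_cong]: "sets (?P J) = sets (PiM J (\<lambda>_. borel))" for J
    by (intro sets_PiM_cong) auto
  note exchange_measurable[OF assms(3), measurable]
  show "sets (distr (?P K) (PiM K (\<lambda>_. borel)) (exchange (a, b, c))) = sets (?P K)"
    by (simp add: sets_P)
  fix A assume "A \<in> sets (distr (?P K) (PiM K (\<lambda>_. borel)) (exchange (a, b, c)))"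
  then have [measurable]: "A \<in> sets (PiM K (\<lambda>_. borel))" by simp
  define I where "I = K - {a, b, c}"
  have K: "K = insert c (insert b (insert a I))" and fin: "finite I"
    and nI: "a \<notin> I" "b \<notin> insert a I" "c \<notin> insert b (insert a I)"
    using assms(1,3,4) by (auto simp: I_def slots_def)
  have expand: "(\<integral>\<^sup>+w. f w \<partial>?P K) =
      (\<integral>\<^sup>+v. \<integral>\<^sup>+x. \<integral>\<^sup>+y. \<integral>\<^sup>+z. f (v(a := x, b := y, c := z)) \<partial>exp_law (r c) \<partial>exp_law (r b) \<partial>exp_law (r a) \<partial>?P I)"
    if [measurable]: "f \<in> borel_measurable (PiM K (\<lambda>_. borel))" for f
  proof -
    let ?Q = "\<lambda>J. PiM J (\<lambda>_. borel)"
    have [measurable]: "f \<in> borel_measurable (?Q (insert c (insert b (insert a I))))"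
      using that K by simp
    have "(\<integral>\<^sup>+w. f w \<partial>?P K) = (\<integral>\<^sup>+v. \<integral>\<^sup>+z. f (v(c := z)) \<partial>exp_law (r c) \<partial>?P (insert b (insert a I)))"
      unfolding K using fin nI by (intro product_nn_integral_insert) measurable
    also have "\<dots> = (\<integral>\<^sup>+v. \<integral>\<^sup>+y. \<integral>\<^sup>+z. f (v(b := y, c := z)) \<partial>exp_law (r c) \<partial>exp_law (r b) \<partial>?P (insert a I))"
      using fin nI by (intro product_nn_integral_insert) measurable
    also have "\<dots> = (\<integral>\<^sup>+v. \<integral>\<^sup>+x. \<integral>\<^sup>+y. \<integral>\<^sup>+z. f (v(a := x, b := y, c := z))
        \<partial>exp_law (r c) \<partial>exp_law (r b) \<partial>exp_law (r a) \<partial>?P I)"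
      using fin nI by (intro product_nn_integral_insert) measurable
    finally show ?thesis .
  qed
  show "emeasure (distr (?P K) (PiM K (\<lambda>_. borel)) (exchange (a, b, c))) A = emeasure (?P K) A"
  proof -
    have "emeasure (distr (?P K) (PiM K (\<lambda>_. borel)) (exchange (a, b, c))) A =
      (\<integral>\<^sup>+w. indicator A (exchange (a, b, c) w) \<partial>?P K)"
      using nn_integral_distr[of "exchange (a, b, c)" "?P K" "PiM K (\<lambda>_. borel)" "indicator A"]
      by simp
    also have "\<dots> = (\<integral>\<^sup>+v. \<integral>\<^sup>+x. \<integral>\<^sup>+y. \<integral>\<^sup>+z. indicator A (v(a := z + max 0 (x - y),
        b := z + max 0 (y - x), c := min x y)) \<partial>exp_law (r c) \<partial>exp_law (r b) \<partial>exp_law (r a) \<partial>?P I)"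
    proof -
      have "exchange (a, b, c) (v(a := x, b := y, c := z)) =
          v(a := z + max 0 (x - y), b := z + max 0 (y - x), c := min x y)" for v x y z
        using assms(4) by (simp add: exchange_def fun_upd_twist)
      then show ?thesis
        by (subst expand) simp_all
    qed
    also have "\<dots> = (\<integral>\<^sup>+v. \<integral>\<^sup>+x. \<integral>\<^sup>+y. \<integral>\<^sup>+z. indicator A (v(a := x, b := y, c := z))
        \<partial>exp_law (r c) \<partial>exp_law (r b) \<partial>exp_law (r a) \<partial>?P I)"
    proof (rule nn_integral_cong)
      fix v assume "v \<in> space (?P I)"
      then have v: "v \<in> space (PiM I (\<lambda>_. borel))"
        using sets_eq_imp_space_eq[OF sets_P] by simp
      have "(\<lambda>(x, y, z). v(a := x, b := y, c := z))
          \<in> measurable (borel \<Otimes>\<^sub>M borel \<Otimes>\<^sub>M borel) (PiM K (\<lambda>_. borel :: real measure))"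
        unfolding case_prod_beta' using v
        by (intro measurable_fun_upd[of K "insert b (insert a I)" c]
            measurable_fun_upd[of "insert b (insert a I)" "insert a I" b]
            measurable_fun_upd[of "insert a I" I a]) (auto simp: K)
      from measurable_compose[OF this borel_measurable_indicator[of A "PiM K (\<lambda>_. borel)"]]
      have "(\<lambda>(x, y, z). indicator A (v(a := x, b := y, c := z)) :: ennreal)
          \<in> borel_measurable (borel \<Otimes>\<^sub>M borel \<Otimes>\<^sub>M borel)"
        by (simp add: case_prod_beta')
      from nn_integral_exp_law_exchange[OF this r r, of a b]
      show "(\<integral>\<^sup>+x. \<integral>\<^sup>+y. \<integral>\<^sup>+z. indicator A (v(a := z + max 0 (x - y),
        b := z + max 0 (y - x), c := min x y)) \<partial>exp_law (r c) \<partial>exp_law (r b) \<partial>exp_law (r a)) =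
        (\<integral>\<^sup>+x. \<integral>\<^sup>+y. \<integral>\<^sup>+z. indicator A (v(a := x, b := y, c := z))
          \<partial>exp_law (r c) \<partial>exp_law (r b) \<partial>exp_law (r a))"
        unfolding sum .
    qed
    also have "\<dots> = emeasure (?P K) A"
      by (subst expand[symmetric]) auto
    finally show ?thesis .
  qed
qed

lemma distr_exchanges_PiM_exp_law:
  assumes "finite K" "\<And>i. r i > 0" "slots_of ms \<subseteq> K"
    and "\<And>a b c. (a, b, c) \<in> set ms \<Longrightarrow> distinct [a, b, c] \<and> r c = r a + r b"
  shows "distr (PiM K (\<lambda>i. exp_law (r i))) (PiM K (\<lambda>_. borel)) (exchanges ms) =
    PiM K (\<lambda>i. exp_law (r i))"
  using assms(3,4)
proof (induction ms)
  case Nil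
  have "distr (PiM K (\<lambda>i. exp_law (r i))) (PiM K (\<lambda>_. borel)) (\<lambda>x. x) = PiM K (\<lambda>i. exp_law (r i))"
    by (intro distr_id2 sets_PiM_cong) auto
  then show ?case by (simp add: id_def)
next
  case (Cons m ms)
  let ?P = "PiM K (\<lambda>i. exp_law (r i))" and ?Q = "PiM K (\<lambda>_. borel :: real measure)"
  have sets_P: "sets ?P = sets ?Q"
    by (intro sets_PiM_cong) auto
  obtain a b c where m: "m = (a, b, c)" by (cases m)
  have "distinct [a, b, c] \<and> r c = r a + r b"
    using Cons.prems(2)[of a b c] m by simp
  then have 1: "distr ?P ?Q (exchange m) = ?P"
    unfolding m using assms(1,2) Cons.prems(1) m by (intro distr_exchange_PiM_exp_law) auto
  have IH: "distr ?P ?Q (exchanges ms) = ?P"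
    using Cons.prems by (intro Cons.IH) auto
  have "distr (distr ?P ?Q (exchange m)) ?Q (exchanges ms) = distr ?P ?Q (exchanges ms \<circ> exchange m)"
    using Cons.prems exchange_measurable[of m K] exchanges_measurable[of ms K]
    by (intro distr_distr) (auto simp: measurable_cong_sets[OF sets_P refl])
  with 1 IH show ?case by (simp add: comp_def)
qed


section \<open>The window\<close>


definition line_slots :: "real \<Rightarrow> nat \<Rightarrow> nat \<Rightarrow> slot set" where
  "line_slots \<rho> m n = Hor \<rho> ` {..<m} \<union> Ver \<rho> ` {..<n} \<union> (\<Union>k<m. Cell k ` {..<n})"

definition cell_slots :: "nat \<Rightarrow> nat \<Rightarrow> slot set" where
  "cell_slots m n = (\<Union>k<m. Cell k ` {..<n})"

definition window_slots :: "real \<Rightarrow> real set \<Rightarrow> nat \<Rightarrow> nat \<Rightarrow> slot set" where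
  "window_slots \<kappa> R m n = (\<Union>\<rho>\<in>insert \<kappa> R. line_slots \<rho> m n) \<union> Diag ` R"

text \<open>Outside of the range of parameters that matters the rates are set to 1, so that all slots carry
  a probability measure.\<close>

primrec slot_rate :: "real \<Rightarrow> slot \<Rightarrow> real" where
  "slot_rate \<kappa> (Hor \<rho> k) = (if \<rho> > 1 then 1 / \<rho> else 1)"
| "slot_rate \<kappa> (Ver \<rho> t) = (if \<rho> > 1 then 1 - 1 / \<rho> else 1)"
| "slot_rate \<kappa> (Diag \<rho>) = (if \<rho> > \<kappa> then 1 / \<kappa> - 1 / \<rho> else 1)"
| "slot_rate \<kappa> (Cell k t) = 1"

abbreviation slot_law :: "real \<Rightarrow> slot set \<Rightarrow> (slot \<Rightarrow> real) measure" where
  "slot_law \<kappa> K \<equiv> PiM K (\<lambda>s. exp_law (slot_rate \<kappa> s))"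

abbreviation slot_algebra :: "slot set \<Rightarrow> (slot \<Rightarrow> real) measure" where
  "slot_algebra K \<equiv> PiM K (\<lambda>_. borel)"

text \<open>The top sweeps of different \<rho> are alternatives and are never composed: each starts
  from the configuration v left by the sweep of \<kappa>. So all increments over the line \<kappa>
  are functions of one v. The window has \<open>Suc m\<close> columns, and m is the last of
  them.\<close>

definition window_value :: "real \<Rightarrow> nat \<Rightarrow> nat \<Rightarrow> real \<Rightarrow> (slot \<Rightarrow> real) \<Rightarrow> real" where
  "window_value \<kappa> m n \<rho> w =
     (let v = exchanges (sweep \<kappa> (Suc m) n) w
      in if \<rho> = \<kappa> then v (Hor \<kappa> m)
         else exchanges (top_sweep \<kappa> \<rho> (Suc m) n) v (Hor \<rho> m))"

lemma line_slots_simps [simp]: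
  "Hor \<sigma> k \<in> line_slots \<rho> m n \<longleftrightarrow> \<sigma> = \<rho> \<and> k < m"
  "Ver \<sigma> t \<in> line_slots \<rho> m n \<longleftrightarrow> \<sigma> = \<rho> \<and> t < n"
  "Diag \<sigma> \<notin> line_slots \<rho> m n"
  "Cell k t \<in> line_slots \<rho> m n \<longleftrightarrow> k < m \<and> t < n"
  by (auto simp: line_slots_def)

lemma slot_rate_pos: "\<kappa> > 1 \<Longrightarrow> slot_rate \<kappa> s > 0"
  by (cases s) (auto simp: field_simps)

lemma prob_space_slot_law: "\<kappa> > 1 \<Longrightarrow> prob_space (slot_law \<kappa> K)"
  by (intro prob_space_PiM prob_space_exponential_density slot_rate_pos)

lemma sets_slot_law [measurable_cong]: "sets (slot_law \<kappa> K) = sets (slot_algebra K)"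
  by (intro sets_PiM_cong) auto

lemma finite_window_slots: "finite R \<Longrightarrow> finite (window_slots \<kappa> R m n)"
  by (auto simp: window_slots_def line_slots_def)

lemma slots_of_sweep: "slots_of (sweep \<rho> m n) \<subseteq> line_slots \<rho> m n"
  by (auto simp: move_defs)

lemma slots_of_window:
  assumes "\<rho> \<in> R"
  shows "slots_of (top_sweep \<kappa> \<rho> m n) \<subseteq> window_slots \<kappa> R m n"
    and "slots_of (bottom \<kappa> \<rho> m) \<subseteq> window_slots \<kappa> R m n"
    and "slots_of (side \<kappa> \<rho> n) \<subseteq> window_slots \<kappa> R m n"
proof -
  have "slots_of (top_sweep \<kappa> \<rho> m n) \<subseteq> line_slots \<kappa> m n \<union> line_slots \<rho> m n \<union> {Diag \<rho>}"
    by (auto simp: move_defs split: if_splits)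
  moreover have "slots_of (bottom \<kappa> \<rho> m) \<subseteq> line_slots \<kappa> m n \<union> line_slots \<rho> m n \<union> {Diag \<rho>}"
    by (auto simp: move_defs)
  moreover have "slots_of (side \<kappa> \<rho> n) \<subseteq> line_slots \<kappa> m n \<union> line_slots \<rho> m n \<union> {Diag \<rho>}"
    by (auto simp: move_defs)
  moreover have "line_slots \<kappa> m n \<union> line_slots \<rho> m n \<union> {Diag \<rho>} \<subseteq> window_slots \<kappa> R m n"
    using assms by (auto simp: window_slots_def)
  ultimately show "slots_of (top_sweep \<kappa> \<rho> m n) \<subseteq> window_slots \<kappa> R m n"
    "slots_of (bottom \<kappa> \<rho> m) \<subseteq> window_slots \<kappa> R m n"
    "slots_of (side \<kappa> \<rho> n) \<subseteq> window_slots \<kappa> R m n"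
    by (meson subset_trans)+
qed

lemma line_slots_window: "\<rho> \<in> insert \<kappa> R \<Longrightarrow> line_slots \<rho> m n \<subseteq> window_slots \<kappa> R m n"
  by (auto simp: window_slots_def)

lemma distr_exchanges_slot_law:
  assumes "\<kappa> > 1" "finite K" "slots_of ms \<subseteq> K"
    and "\<And>a b c. (a, b, c) \<in> set ms \<Longrightarrow>
      distinct [a, b, c] \<and> slot_rate \<kappa> c = slot_rate \<kappa> a + slot_rate \<kappa> b"
  shows "distr (slot_law \<kappa> K) (slot_algebra K) (exchanges ms) = slot_law \<kappa> K"
  using assms by (intro distr_exchanges_PiM_exp_law slot_rate_pos)

lemma distr_sweep:
  assumes "\<kappa> > 1" "\<rho> > 1" "finite K" "line_slots \<rho> m n \<subseteq> K"
  shows "distr (slot_law \<kappa> K) (slot_algebra K) (exchanges (sweep \<rho> m n)) = slot_law \<kappa> K"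
proof (rule distr_exchanges_slot_law)
  show "slots_of (sweep \<rho> m n) \<subseteq> K"
    using slots_of_sweep assms(4) by (rule subset_trans)
qed (use assms in \<open>auto simp: move_defs\<close>)

text \<open>Independence of one coordinate from a function of the others. That g ignores the
  coordinate is expressed by invariance under \<open>fun_upd\<close>, the form in which
  \<open>top_sweep_increment\<close> provides it.\<close>

lemma (in product_prob_space) expectation_coordinate_mult:
  fixes f :: "'a \<Rightarrow> complex"
  assumes "finite K" "i \<in> K" and f[measurable]: "f \<in> borel_measurable (M i)"
    and g[measurable]: "g \<in> borel_measurable (PiM K M)"
    and bound: "\<And>x. norm (f x) \<le> 1" "\<And>v. norm (g v) \<le> 1"
    and g_upd: "\<And>v y. g (v(i := y)) = g v"
  shows "(\<integral>v. f (v i) * g v \<partial>PiM K M) = (\<integral>v. f (v i) \<partial>PiM K M) * (\<integral>v. g v \<partial>PiM K M)"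
proof -
  interpret K: prob_space "PiM K M" by (intro prob_space_PiM M.prob_space_axioms)
  define I where "I = K - {i}"
  have K: "K = insert i I" and I: "finite I" "i \<notin> I"
    using assms(1,2) by (auto simp: I_def)
  interpret I: prob_space "PiM I M" by (intro prob_space_PiM M.prob_space_axioms)
  have [measurable]: "(\<lambda>v. v i) \<in> measurable (PiM K M) (M i)"
    using assms(2) by measurable
  have fg: "integrable (PiM K M) (\<lambda>v. f (v i) * g v)"
    using mult_mono[OF bound(1) bound(2)]
    by (intro K.integrable_const_bound[where B = 1]) (auto simp: norm_mult)
  have f': "integrable (PiM K M) (\<lambda>v. f (v i))" and g': "integrable (PiM K M) g"
    using bound by (auto intro!: K.integrable_const_bound[where B = 1])
  note insert = product_integral_insert[OF I, folded K]
  have "(\<integral>v. f (v i) * g v \<partial>PiM K M) = (\<integral>y. f y \<partial>M i) * (\<integral>v. g v \<partial>PiM I M)"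
    using insert[OF fg] by (simp add: g_upd)
  moreover have "(\<integral>v. f (v i) \<partial>PiM K M) = (\<integral>y. f y \<partial>M i)"
    using insert[OF f'] by (simp add: I.prob_space)
  moreover have "(\<integral>v. g v \<partial>PiM K M) = (\<integral>v. g v \<partial>PiM I M)"
    using insert[OF g'] by (simp add: g_upd M.prob_space)
  ultimately show ?thesis by simp
qed

lemma window_value_measurable:
  assumes "\<rho> \<in> insert \<kappa> R"
  shows "window_value \<kappa> m n \<rho> \<in> borel_measurable (slot_algebra (window_slots \<kappa> R (Suc m) n))"
proof -
  let ?K = "window_slots \<kappa> R (Suc m) n"
  have K: "line_slots \<kappa> (Suc m) n \<subseteq> ?K" "line_slots \<rho> (Suc m) n \<subseteq> ?K"
    using assms by (auto simp: window_slots_def)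
  then have "Hor \<kappa> m \<in> ?K" "Hor \<rho> m \<in> ?K" by auto
  then have [measurable]: "(\<lambda>v. v (Hor \<kappa> m)) \<in> borel_measurable (slot_algebra ?K)"
    "(\<lambda>v. v (Hor \<rho> m)) \<in> borel_measurable (slot_algebra ?K)"
    by (auto intro!: measurable_component_singleton)
  have [measurable]: "exchanges (sweep \<kappa> (Suc m) n) \<in> measurable (slot_algebra ?K) (slot_algebra ?K)"
    using slots_of_sweep K by (intro exchanges_measurable) blast
  have "exchanges (top_sweep \<kappa> \<rho> (Suc m) n) \<in> measurable (slot_algebra ?K) (slot_algebra ?K)" if "\<rho> \<in> R"
    using that by (intro exchanges_measurable slots_of_window)
  with assms show ?thesis
    unfolding window_value_def Let_def by (cases "\<rho> = \<kappa>") auto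
qed

text \<open>The sweep of \<kappa> preserves the product law. After it the value of the line \<kappa>
  is the single coordinate \<open>Hor \<kappa> m\<close>, and by \<open>top_sweep_increment\<close>
  all increments over it are functions of the remaining coordinates.\<close>

lemma window_factor:
  fixes \<theta> :: "real \<Rightarrow> real" and m n :: nat
  assumes \<kappa>: "\<kappa> > 1" and R: "finite R" "\<And>\<rho>. \<rho> \<in> R \<Longrightarrow> \<rho> > \<kappa>"
  defines "W \<equiv> slot_law \<kappa> (window_slots \<kappa> R (Suc m) n)"
  shows "(CLINT w|W. iexp (s * window_value \<kappa> m n \<kappa> w +
        (\<Sum>\<rho>\<in>R. \<theta> \<rho> * (window_value \<kappa> m n \<rho> w - window_value \<kappa> m n \<kappa> w)))) =
    (CLINT w|W. iexp (s * window_value \<kappa> m n \<kappa> w)) *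
    (CLINT w|W. iexp (\<Sum>\<rho>\<in>R. \<theta> \<rho> * (window_value \<kappa> m n \<rho> w - window_value \<kappa> m n \<kappa> w)))"
proof -
  let ?K = "window_slots \<kappa> R (Suc m) n"
  let ?E = "exchanges (sweep \<kappa> (Suc m) n)"
  interpret product_prob_space "\<lambda>s. exp_law (slot_rate \<kappa> s)"
    by (intro product_prob_space_exp_law slot_rate_pos \<kappa>)
  have fin: "finite ?K" using R(1) by (rule finite_window_slots)
  have sub: "line_slots \<kappa> (Suc m) n \<subseteq> ?K" by (rule line_slots_window) simp
  define G where "G \<rho> v = exchanges (top_sweep \<kappa> \<rho> (Suc m) n) v (Hor \<rho> m) - v (Hor \<kappa> m)" for \<rho> v
  define g where "g v = iexp (\<Sum>\<rho>\<in>R. \<theta> \<rho> * G \<rho> v)" for v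
  have \<kappa>K: "Hor \<kappa> m \<in> ?K"
    using sub by auto
  then have [measurable]: "(\<lambda>v. v (Hor \<kappa> m)) \<in> borel_measurable (slot_algebra ?K)"
    by (auto intro!: measurable_component_singleton)
  have G[measurable]: "G \<rho> \<in> borel_measurable (slot_algebra ?K)" if "\<rho> \<in> R" for \<rho>
  proof -
    have [measurable]: "exchanges (top_sweep \<kappa> \<rho> (Suc m) n) \<in> measurable (slot_algebra ?K) (slot_algebra ?K)"
      using that by (intro exchanges_measurable slots_of_window)
    have [measurable]: "(\<lambda>v. v (Hor \<rho> m)) \<in> borel_measurable (slot_algebra ?K)"
      using line_slots_window[of \<rho> \<kappa> R "Suc m" n] that
      by (intro measurable_component_singleton) auto
    show ?thesis unfolding G_def by measurable
  qed
  then have g[measurable]: "g \<in> borel_measurable (slot_algebra ?K)"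
    unfolding g_def by measurable
  have "G \<rho> (v(Hor \<kappa> m := y)) = G \<rho> v" if "\<rho> \<in> R" for \<rho> v y
    using top_sweep_increment[of \<kappa> \<rho> m n v y] R(2)[OF that] by (simp add: G_def)
  then have g_upd: "g (v(Hor \<kappa> m := y)) = g v" for v y
    by (simp add: g_def cong: sum.cong)
  have [measurable]: "?E \<in> measurable (slot_algebra ?K) (slot_algebra ?K)"
    using slots_of_sweep sub by (intro exchanges_measurable) blast
  have E: "(\<integral>w. h (?E w) \<partial>W) = (\<integral>w. h w \<partial>W)" if [measurable]: "h \<in> borel_measurable (slot_algebra ?K)"
    for h :: "_ \<Rightarrow> complex"
  proof -
    have "(\<integral>w. h w \<partial>distr W (slot_algebra ?K) ?E) = (\<integral>w. h (?E w) \<partial>W)"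
      unfolding W_def by (intro integral_distr) measurable
    then show ?thesis
      unfolding W_def using distr_sweep[OF \<kappa> \<kappa> fin sub] by simp
  qed
  have vals: "window_value \<kappa> m n \<kappa> w = ?E w (Hor \<kappa> m)"
    "\<rho> \<in> R \<Longrightarrow> window_value \<kappa> m n \<rho> w - window_value \<kappa> m n \<kappa> w = G \<rho> (?E w)" for \<rho> w
    using R(2)[of \<rho>] by (auto simp: window_value_def Let_def G_def)
  define h :: "_ \<Rightarrow> complex" where "h v = iexp (s * v (Hor \<kappa> m))" for v
  have h[measurable]: "h \<in> borel_measurable (slot_algebra ?K)"
    unfolding h_def by measurable
  have "(CLINT w|W. iexp (s * window_value \<kappa> m n \<kappa> w +
        (\<Sum>\<rho>\<in>R. \<theta> \<rho> * (window_value \<kappa> m n \<rho> w - window_value \<kappa> m n \<kappa> w)))) =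
      (\<integral>w. h (?E w) * g (?E w) \<partial>W)"
    by (intro Bochner_Integration.integral_cong refl)
      (simp only: h_def g_def vals(2) cong: sum.cong, simp only: vals(1) of_real_add distrib_left exp_add)
  also have "\<dots> = (\<integral>v. h v * g v \<partial>W)"
    by (rule E) measurable
  also have "\<dots> = (\<integral>v. h v \<partial>W) * (\<integral>v. g v \<partial>W)"
    unfolding W_def h_def using fin \<kappa>K
    by (intro expectation_coordinate_mult[where f = "\<lambda>y. iexp (s * y)"] g_upd) (auto simp: g_def)
  also have "(\<integral>v. h v \<partial>W) = (CLINT w|W. iexp (s * window_value \<kappa> m n \<kappa> w))"
    unfolding E[OF h, symmetric] by (simp only: h_def vals(1))
  also have "(\<integral>v. g v \<partial>W) =
      (CLINT w|W. iexp (\<Sum>\<rho>\<in>R. \<theta> \<rho> * (window_value \<kappa> m n \<rho> w - window_value \<kappa> m n \<kappa> w)))"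
    unfolding E[OF g, symmetric] by (simp only: g_def vals(2) cong: sum.cong)
  finally show ?thesis .
qed

text \<open>By \<open>window_identity\<close> each line separately is, after measure-preserving exchanges that leave
  the cells alone, a stationary line swept through the cells.\<close>

lemma window_value_line:
  fixes f :: "real \<Rightarrow> (slot \<Rightarrow> real) \<Rightarrow> 'b :: {banach, second_countable_topology}"
  assumes \<kappa>: "\<kappa> > 1" and R: "finite R" "\<And>\<rho>. \<rho> \<in> R \<Longrightarrow> \<rho> > \<kappa>" and \<rho>: "\<rho> \<in> insert \<kappa> R"
    and f: "case_prod f \<in> borel_measurable (borel \<Otimes>\<^sub>M slot_algebra (line_slots \<rho> (Suc m) n))"
    and cells: "\<And>y v v'. (\<And>k t. k < Suc m \<Longrightarrow> t < n \<Longrightarrow> v (Cell k t) = v' (Cell k t)) \<Longrightarrow> f y v = f y v'"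
  shows "(\<integral>w. f (window_value \<kappa> m n \<rho> w) w \<partial>slot_law \<kappa> (window_slots \<kappa> R (Suc m) n)) =
    (\<integral>v. f (exchanges (sweep \<rho> (Suc m) n) v (Hor \<rho> m)) v \<partial>slot_law \<kappa> (line_slots \<rho> (Suc m) n))"
proof -
  let ?K = "window_slots \<kappa> R (Suc m) n" and ?L = "line_slots \<rho> (Suc m) n"
  \<comment> \<open>The line \<kappa> is swept before all others, so its value is already a sweep
    through the original cells.\<close>
  let ?ms = "if \<rho> = \<kappa> then [] else rev (side \<kappa> \<rho> n) @ bottom \<kappa> \<rho> (Suc m)"
  let ?E = "exchanges (sweep \<rho> (Suc m) n)"
  interpret product_prob_space "\<lambda>s. exp_law (slot_rate \<kappa> s)"
    by (intro product_prob_space_exp_law slot_rate_pos \<kappa>)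
  have fin: "finite ?K" using R(1) by (rule finite_window_slots)
  have sub: "?L \<subseteq> ?K" using \<rho> by (rule line_slots_window)
  have \<rho>': "\<rho> \<in> R" "\<kappa> < \<rho>" if "\<rho> \<noteq> \<kappa>"
    using that \<rho> R(2)[of \<rho>] by auto
  have ms: "slots_of ?ms \<subseteq> ?K"
    using slots_of_window(2,3)[OF \<rho>'(1)] by auto
  have law: "distr (slot_law \<kappa> ?K) (slot_algebra ?K) (exchanges ?ms) = slot_law \<kappa> ?K"
    using fin ms \<rho>' \<kappa> by (intro distr_exchanges_slot_law) (auto simp: move_defs split: if_splits)
  have [measurable]: "exchanges ?ms \<in> measurable (slot_algebra ?K) (slot_algebra ?K)"
    using ms by (rule exchanges_measurable)
  have E[measurable]: "?E \<in> measurable (slot_algebra ?L) (slot_algebra ?L)"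
    using slots_of_sweep by (intro exchanges_measurable)
  have [measurable]: "(\<lambda>v. v (Hor \<rho> m)) \<in> borel_measurable (slot_algebra ?L)"
    by (intro measurable_component_singleton) simp
  define F where "F v = f (?E v (Hor \<rho> m)) v" for v
  have F[measurable]: "F \<in> borel_measurable (slot_algebra ?L)"
    using measurable_compose[OF _ f, of "\<lambda>v. (?E v (Hor \<rho> m), v)"] unfolding F_def by simp
  \<comment> \<open>Reading only the slots of one line, F can be integrated against the marginal of
    the window law on these slots.\<close>
  have F_restrict: "F (restrict v ?L) = F v" for v
  proof -
    have "?E (restrict v ?L) (Hor \<rho> m) = ?E v (Hor \<rho> m)"
      using slots_of_sweep by (intro exchanges_cong[of _ ?L]) auto
    then show ?thesis
      unfolding F_def by (auto intro!: cells)
  qed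
  have [measurable]: "F \<in> borel_measurable (slot_algebra ?K)"
    using measurable_compose[OF measurable_restrict_subset[OF sub] F] by (simp add: F_restrict)
  have "f (window_value \<kappa> m n \<rho> w) w = F (exchanges ?ms w)" for w
  proof -
    have "window_value \<kappa> m n \<rho> w = ?E (exchanges ?ms w) (Hor \<rho> m)"
      using window_identity[of \<kappa> \<rho> m n w] by (simp add: window_value_def Let_def)
    moreover have "exchanges ?ms w (Cell k t) = w (Cell k t)" for k t
      by (intro exchanges_outside) (auto simp: move_defs)
    ultimately show ?thesis
      unfolding F_def by (auto intro!: cells)
  qed
  then have "(\<integral>w. f (window_value \<kappa> m n \<rho> w) w \<partial>slot_law \<kappa> ?K) =
      (\<integral>w. F (exchanges ?ms w) \<partial>slot_law \<kappa> ?K)"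
    by simp
  also have "\<dots> = (\<integral>v. F v \<partial>distr (slot_law \<kappa> ?K) (slot_algebra ?K) (exchanges ?ms))"
    by (rule integral_distr[symmetric]) measurable
  also have "\<dots> = (\<integral>v. F v \<partial>slot_law \<kappa> ?K)"
    by (simp only: law)
  also have "\<dots> = (\<integral>v. F v \<partial>distr (slot_law \<kappa> ?K) (slot_law \<kappa> ?L) (\<lambda>v. restrict v ?L))"
    using sub by (subst integral_distr) (auto intro!: measurable_restrict_subset simp: F_restrict)
  also have "\<dots> = (\<integral>v. F v \<partial>slot_law \<kappa> ?L)"
    using distr_restrict[OF sub fin] by simp
  finally show ?thesis
    unfolding F_def .
qed


section \<open>Comparison of functions of the weights with the window values\<close>

lemma cell_slots_simps [simp]: "Cell k t \<in> cell_slots m n \<longleftrightarrow> k < m \<and> t < n"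
  by (auto simp: cell_slots_def)

text \<open>The truncation at 2 makes the error bounded, so that almost sure convergence of the
  approximations suffices to make its mean vanish.\<close>

lemma norm_iexp_diff_le: "norm (iexp a - iexp b) \<le> min 2 \<bar>a - b\<bar>"
proof -
  have "iexp a - iexp b = iexp b * (iexp (a - b) - 1)"
    by (simp add: exp_add[symmetric] algebra_simps)
  then have "norm (iexp a - iexp b) = norm (iexp (a - b) - 1)"
    by (simp add: norm_mult)
  also have "\<dots> \<le> \<bar>a - b\<bar>"
    using iexp_approx1[of "a - b" 0] by simp
  finally show ?thesis
    using norm_triangle_ineq4[of "iexp a" "iexp b"] by simp
qed

lemma min_2_abs_sum_le: "min 2 \<bar>\<Sum>i\<in>A. x i :: real\<bar> \<le> (\<Sum>i\<in>A. min 2 \<bar>x i\<bar>)"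
proof (induction A rule: infinite_finite_induct)
  case (insert i A)
  have "min 2 \<bar>x i + sum x A\<bar> \<le> min 2 \<bar>x i\<bar> + min 2 \<bar>sum x A\<bar>"
    by linarith
  also have "\<dots> \<le> min 2 \<bar>x i\<bar> + (\<Sum>i\<in>A. min 2 \<bar>x i\<bar>)"
    using insert.IH by (rule add_left_mono)
  finally show ?case
    by (simp only: sum.insert[OF insert.hyps])
qed auto

text \<open>As functions of the cells alone, the g \<rho> have the same joint law under M and in the
  window. Replacing them by the window values costs a sum of truncated errors. Each error involves
  the cells and one line, so its mean can be moved back to M by \<open>window_value_line\<close> and
  the law of that line. The joint law of the lines \<eta> \<rho> never enters; they share only the
  weights c.\<close>

lemma window_estimate:
  fixes g :: "real \<Rightarrow> (slot \<Rightarrow> real) \<Rightarrow> real" and \<theta> :: "real \<Rightarrow> real"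
  assumes "prob_space M" and \<kappa>: "\<kappa> > 1" and R: "finite R" "\<And>\<rho>. \<rho> \<in> R \<Longrightarrow> \<rho> > \<kappa>"
    and \<eta>: "\<And>\<rho>. \<rho> \<in> insert \<kappa> R \<Longrightarrow> \<eta> \<rho> \<in> measurable M (slot_algebra (line_slots \<rho> (Suc m) n))"
    and law: "\<And>\<rho>. \<rho> \<in> insert \<kappa> R \<Longrightarrow>
      distr M (slot_algebra (line_slots \<rho> (Suc m) n)) (\<eta> \<rho>) = slot_law \<kappa> (line_slots \<rho> (Suc m) n)"
    and cells: "\<And>\<rho> \<omega> k t. \<rho> \<in> insert \<kappa> R \<Longrightarrow> k \<le> m \<Longrightarrow> t < n \<Longrightarrow> \<eta> \<rho> \<omega> (Cell k t) = c \<omega> (Cell k t)"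
    and I: "\<And>\<rho>. \<rho> \<in> insert \<kappa> R \<Longrightarrow>
      AE \<omega> in M. I \<rho> \<omega> = exchanges (sweep \<rho> (Suc m) n) (\<eta> \<rho> \<omega>) (Hor \<rho> m)"
    and I_measurable: "\<And>\<rho>. \<rho> \<in> insert \<kappa> R \<Longrightarrow> I \<rho> \<in> borel_measurable M"
    and g: "\<And>\<rho>. \<rho> \<in> insert \<kappa> R \<Longrightarrow> g \<rho> \<in> borel_measurable (slot_algebra (cell_slots (Suc m) n))"
    and g_cells: "\<And>\<rho> v v'. \<rho> \<in> insert \<kappa> R \<Longrightarrow>
      (\<And>k t. k \<le> m \<Longrightarrow> t < n \<Longrightarrow> v (Cell k t) = v' (Cell k t)) \<Longrightarrow> g \<rho> v = g \<rho> v'"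
  shows "norm ((CLINT \<omega>|M. iexp (\<Sum>\<rho>\<in>insert \<kappa> R. \<theta> \<rho> * g \<rho> (c \<omega>))) -
      (CLINT w|slot_law \<kappa> (window_slots \<kappa> R (Suc m) n).
        iexp (\<Sum>\<rho>\<in>insert \<kappa> R. \<theta> \<rho> * window_value \<kappa> m n \<rho> w)))
    \<le> (\<Sum>\<rho>\<in>insert \<kappa> R. \<integral>\<omega>. min 2 \<bar>\<theta> \<rho> * (g \<rho> (c \<omega>) - I \<rho> \<omega>)\<bar> \<partial>M)"
proof -
  interpret prob_space M by fact
  let ?K = "window_slots \<kappa> R (Suc m) n" and ?L = "\<lambda>\<rho>. line_slots \<rho> (Suc m) n"
  let ?C = "cell_slots (Suc m) n"
  define W where "W = slot_law \<kappa> ?K"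
  interpret W: prob_space W
    unfolding W_def using \<kappa> by (rule prob_space_slot_law)
  have sub: "?C \<subseteq> ?L \<rho>" for \<rho>
    by (auto simp: cell_slots_def)
  then have sub': "?C \<subseteq> ?K"
    using line_slots_window[of \<kappa> \<kappa> R "Suc m" n] by blast
  have g_restrict: "g \<rho> (restrict v ?C) = g \<rho> v" if "\<rho> \<in> insert \<kappa> R" for \<rho> v
    using that by (intro g_cells) auto
  have gJ: "g \<rho> \<in> borel_measurable (slot_algebra J)" if "\<rho> \<in> insert \<kappa> R" "?C \<subseteq> J" for \<rho> J
    using measurable_compose[OF measurable_restrict_subset[OF that(2)] g[OF that(1)]] that(1)
    by (simp add: g_restrict)
  have gc: "g \<rho> (\<eta> \<sigma> \<omega>) = g \<rho> (c \<omega>)" if "\<rho> \<in> insert \<kappa> R" "\<sigma> \<in> insert \<kappa> R" for \<rho> \<sigma> \<omega>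
    using that by (intro g_cells) (auto simp: cells)
  have value_W: "window_value \<kappa> m n \<rho> \<in> borel_measurable W" if "\<rho> \<in> insert \<kappa> R" for \<rho>
    using window_value_measurable[OF that] by (simp add: W_def measurable_cong_sets[OF sets_slot_law refl])
  have g_W: "g \<rho> \<in> borel_measurable W" if "\<rho> \<in> insert \<kappa> R" for \<rho>
    using gJ[OF that sub'] by (simp add: W_def measurable_cong_sets[OF sets_slot_law refl])
  have g_M: "(\<lambda>\<omega>. g \<rho> (c \<omega>)) \<in> borel_measurable M" if "\<rho> \<in> insert \<kappa> R" for \<rho>
    using measurable_compose[OF \<eta>[OF that] gJ[OF that sub]] that by (simp add: gc)
  note [measurable] = value_W g_W g_M I_measurable
  \<comment> \<open>The cells have the same law in every line, and the line \<kappa> serves to read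
    it off.\<close>
  have "(CLINT \<omega>|M. iexp (\<Sum>\<rho>\<in>insert \<kappa> R. \<theta> \<rho> * g \<rho> (c \<omega>))) =
      (CLINT v|slot_law \<kappa> (?L \<kappa>). iexp (\<Sum>\<rho>\<in>insert \<kappa> R. \<theta> \<rho> * g \<rho> v))"
  proof -
    have [measurable]: "g \<rho> \<in> borel_measurable (slot_algebra (?L \<kappa>))" if "\<rho> \<in> insert \<kappa> R" for \<rho>
      using that sub by (rule gJ)
    have "(CLINT v|distr M (slot_algebra (?L \<kappa>)) (\<eta> \<kappa>). iexp (\<Sum>\<rho>\<in>insert \<kappa> R. \<theta> \<rho> * g \<rho> v)) =
        (CLINT \<omega>|M. iexp (\<Sum>\<rho>\<in>insert \<kappa> R. \<theta> \<rho> * g \<rho> (\<eta> \<kappa> \<omega>)))"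
      using \<eta>[of \<kappa>] by (intro integral_distr) auto
    moreover have "(\<Sum>\<rho>\<in>insert \<kappa> R. \<theta> \<rho> * g \<rho> (\<eta> \<kappa> \<omega>)) = (\<Sum>\<rho>\<in>insert \<kappa> R. \<theta> \<rho> * g \<rho> (c \<omega>))" for \<omega>
      by (intro sum.cong refl arg_cong2[where f = "(*)"] gc) auto
    ultimately show ?thesis
      by (simp only: law[OF insertI1])
  qed
  also have "\<dots> = (CLINT w|W. iexp (\<Sum>\<rho>\<in>insert \<kappa> R. \<theta> \<rho> * g \<rho> w))"
  proof -
    have [measurable]: "g \<rho> \<in> borel_measurable (slot_algebra (?L \<kappa>))" if "\<rho> \<in> insert \<kappa> R" for \<rho>
      using that sub by (rule gJ)
    show ?thesis
      unfolding W_def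
    proof (rule window_value_line[OF \<kappa> R, where f = "\<lambda>_ v. iexp (\<Sum>\<rho>\<in>insert \<kappa> R. \<theta> \<rho> * g \<rho> v)", symmetric])
      fix v v' :: "slot \<Rightarrow> real"
      assume "\<And>k t. k < Suc m \<Longrightarrow> t < n \<Longrightarrow> v (Cell k t) = v' (Cell k t)"
      then have "(\<Sum>\<rho>\<in>insert \<kappa> R. \<theta> \<rho> * g \<rho> v) = (\<Sum>\<rho>\<in>insert \<kappa> R. \<theta> \<rho> * g \<rho> v')"
        by (intro sum.cong refl arg_cong2[where f = "(*)"] g_cells) auto
      then show "iexp (\<Sum>\<rho>\<in>insert \<kappa> R. \<theta> \<rho> * g \<rho> v) = iexp (\<Sum>\<rho>\<in>insert \<kappa> R. \<theta> \<rho> * g \<rho> v')"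
        by (simp only:)
    qed auto
  qed
  finally have 1: "(CLINT \<omega>|M. iexp (\<Sum>\<rho>\<in>insert \<kappa> R. \<theta> \<rho> * g \<rho> (c \<omega>))) =
      (CLINT w|W. iexp (\<Sum>\<rho>\<in>insert \<kappa> R. \<theta> \<rho> * g \<rho> w))" .
  have 2: "(\<integral>w. min 2 \<bar>\<theta> \<rho> * (g \<rho> w - window_value \<kappa> m n \<rho> w)\<bar> \<partial>W) =
      (\<integral>\<omega>. min 2 \<bar>\<theta> \<rho> * (g \<rho> (c \<omega>) - I \<rho> \<omega>)\<bar> \<partial>M)" if \<rho>: "\<rho> \<in> insert \<kappa> R" for \<rho>
  proof -
    let ?E = "exchanges (sweep \<rho> (Suc m) n)"
    have [measurable]: "g \<rho> \<in> borel_measurable (slot_algebra (?L \<rho>))"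
      using \<rho> sub by (rule gJ)
    have E: "?E \<in> measurable (slot_algebra (?L \<rho>)) (slot_algebra (?L \<rho>))"
      using slots_of_sweep by (rule exchanges_measurable)
    have [measurable]: "(\<lambda>v. ?E v (Hor \<rho> m)) \<in> borel_measurable (slot_algebra (?L \<rho>))"
      by (rule measurable_compose[OF E measurable_component_singleton]) simp
    have "(\<integral>w. min 2 \<bar>\<theta> \<rho> * (g \<rho> w - window_value \<kappa> m n \<rho> w)\<bar> \<partial>W) =
        (\<integral>v. min 2 \<bar>\<theta> \<rho> * (g \<rho> v - ?E v (Hor \<rho> m))\<bar> \<partial>slot_law \<kappa> (?L \<rho>))"
      unfolding W_def
    proof (rule window_value_line[OF \<kappa> R \<rho>, where f = "\<lambda>y v. min 2 \<bar>\<theta> \<rho> * (g \<rho> v - y)\<bar>"])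
      show "min 2 \<bar>\<theta> \<rho> * (g \<rho> v - y)\<bar> = min 2 \<bar>\<theta> \<rho> * (g \<rho> v' - y)\<bar>"
        if "\<And>k t. k < Suc m \<Longrightarrow> t < n \<Longrightarrow> v (Cell k t) = v' (Cell k t)" for y v v'
        using g_cells[OF \<rho>, of v v'] that by simp
    qed auto
    also have "\<dots> = (\<integral>\<omega>. min 2 \<bar>\<theta> \<rho> * (g \<rho> (\<eta> \<rho> \<omega>) - ?E (\<eta> \<rho> \<omega>) (Hor \<rho> m))\<bar> \<partial>M)"
      unfolding law[OF \<rho>, symmetric] using \<eta>[OF \<rho>] by (intro integral_distr) auto
    also have "\<dots> = (\<integral>\<omega>. min 2 \<bar>\<theta> \<rho> * (g \<rho> (c \<omega>) - I \<rho> \<omega>)\<bar> \<partial>M)"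
    proof (rule integral_cong_AE)
      have "(\<lambda>\<omega>. ?E (\<eta> \<rho> \<omega>) (Hor \<rho> m)) \<in> borel_measurable M"
        using \<eta>[OF \<rho>] by (rule measurable_compose) measurable
      then show "(\<lambda>\<omega>. min 2 \<bar>\<theta> \<rho> * (g \<rho> (\<eta> \<rho> \<omega>) - ?E (\<eta> \<rho> \<omega>) (Hor \<rho> m))\<bar>) \<in> borel_measurable M"
        unfolding gc[OF \<rho> \<rho>] using \<rho> by measurable
      show "AE \<omega> in M. min 2 \<bar>\<theta> \<rho> * (g \<rho> (\<eta> \<rho> \<omega>) - ?E (\<eta> \<rho> \<omega>) (Hor \<rho> m))\<bar> =
          min 2 \<bar>\<theta> \<rho> * (g \<rho> (c \<omega>) - I \<rho> \<omega>)\<bar>"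
        using I[OF \<rho>] by eventually_elim (simp only: gc[OF \<rho> \<rho>])
    qed (use \<rho> in measurable)
    finally show ?thesis .
  qed
  let ?A = "\<lambda>w. \<Sum>\<rho>\<in>insert \<kappa> R. \<theta> \<rho> * g \<rho> w"
  let ?B = "\<lambda>w. \<Sum>\<rho>\<in>insert \<kappa> R. \<theta> \<rho> * window_value \<kappa> m n \<rho> w"
  let ?D = "\<lambda>\<rho> w. min 2 \<bar>\<theta> \<rho> * (g \<rho> w - window_value \<kappa> m n \<rho> w)\<bar>"
  have int: "integrable W (?D \<rho>)" if "\<rho> \<in> insert \<kappa> R" for \<rho>
    using that by (intro W.integrable_const_bound[where B = 2]) auto
  have intA: "integrable W (\<lambda>w. iexp (?A w))" and intB: "integrable W (\<lambda>w. iexp (?B w))"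
    by (auto intro!: W.integrable_const_bound[where B = 1])
  have "norm ((CLINT w|W. iexp (?A w)) - (CLINT w|W. iexp (?B w))) =
      norm (CLINT w|W. iexp (?A w) - iexp (?B w))"
    using intA intB by simp
  also have "\<dots> \<le> (\<integral>w. norm (iexp (?A w) - iexp (?B w)) \<partial>W)"
    by (rule integral_norm_bound)
  also have "\<dots> \<le> (\<integral>w. (\<Sum>\<rho>\<in>insert \<kappa> R. ?D \<rho> w) \<partial>W)"
  proof (rule integral_mono)
    show "integrable W (\<lambda>w. \<Sum>\<rho>\<in>insert \<kappa> R. ?D \<rho> w)"
      using int by (intro Bochner_Integration.integrable_sum)
    fix w
    have "norm (iexp (?A w) - iexp (?B w)) \<le> min 2 \<bar>?A w - ?B w\<bar>"
      by (rule norm_iexp_diff_le)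
    also have "?A w - ?B w = (\<Sum>\<rho>\<in>insert \<kappa> R. \<theta> \<rho> * (g \<rho> w - window_value \<kappa> m n \<rho> w))"
      by (simp only: sum_subtractf right_diff_distrib)
    also have "min 2 \<bar>\<dots>\<bar> \<le> (\<Sum>\<rho>\<in>insert \<kappa> R. ?D \<rho> w)"
      by (rule min_2_abs_sum_le)
    finally show "norm (iexp (?A w) - iexp (?B w)) \<le> (\<Sum>\<rho>\<in>insert \<kappa> R. ?D \<rho> w)" .
  qed (use intA intB in auto)
  also have "\<dots> = (\<Sum>\<rho>\<in>insert \<kappa> R. \<integral>w. ?D \<rho> w \<partial>W)"
    using int by (rule Bochner_Integration.integral_sum)
  also have "\<dots> = (\<Sum>\<rho>\<in>insert \<kappa> R. \<integral>\<omega>. min 2 \<bar>\<theta> \<rho> * (g \<rho> (c \<omega>) - I \<rho> \<omega>)\<bar> \<partial>M)"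
    using 2 by (rule sum.cong[OF refl])
  finally show ?thesis
    unfolding 1 W_def .
qed


section \<open>Busemann functions as limits of last-passage values\<close>


text \<open>Every step raises the coordinate sum by 1 and decreases no coordinate. So a path stays
  in the rectangle of its endpoints and has a length fixed by them: there are finitely many paths,
  and the maximum over them is a local and measurable function of the weights.\<close>

lemma up_right_path_props:
  assumes "successively (\<lambda>a b. b = a + e1 \<or> b = a + e2) p" "p \<noteq> []"
  shows "(\<forall>z\<in>set p. fst (hd p) \<le> fst z \<and> snd (hd p) \<le> snd z \<and>
      fst z \<le> fst (last p) \<and> snd z \<le> snd (last p)) \<and>
    int (length p) = fst (last p) + snd (last p) - fst (hd p) - snd (hd p) + 1"
  using assms
proof (induction p)
  case (Cons a p)
  show ?case
  proof (cases "p = []")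
    case False
    have step: "hd p = a + e1 \<or> hd p = a + e2"
      and IH: "\<forall>z\<in>set p. fst (hd p) \<le> fst z \<and> snd (hd p) \<le> snd z \<and>
        fst z \<le> fst (last p) \<and> snd z \<le> snd (last p)"
      "int (length p) = fst (last p) + snd (last p) - fst (hd p) - snd (hd p) + 1"
      using Cons False by (auto simp: successively_Cons)
    have a: "fst a \<le> fst (hd p)" "snd a \<le> snd (hd p)"
      using step by (auto simp: e1_def e2_def)
    have "fst (hd p) \<le> fst (last p)" "snd (hd p) \<le> snd (last p)"
      using IH(1) False by auto
    with a have "fst a \<le> fst (last p)" "snd a \<le> snd (last p)"
      by auto
    moreover have "\<forall>z\<in>set p. fst a \<le> fst z \<and> snd a \<le> snd z"
      using a IH(1) by (meson order_trans)
    moreover have "fst (hd p) + snd (hd p) = fst a + snd a + 1"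
      using step by (auto simp: e1_def e2_def)
    ultimately show ?thesis
      using IH False by simp
  qed simp
qed simp

lemma up_right_paths_bounds:
  assumes "p \<in> up_right_paths u v" "z \<in> set p"
  shows "fst u \<le> fst z" "snd u \<le> snd z" "fst z \<le> fst v" "snd z \<le> snd v"
  using assms up_right_path_props[of p] by (auto simp: up_right_paths_def)

lemma finite_up_right_paths: "finite (up_right_paths u v)"
proof (rule finite_subset)
  show "up_right_paths u v \<subseteq> {p. set p \<subseteq> {fst u..fst v} \<times> {snd u..snd v} \<and>
      length p = nat (fst v + snd v - fst u - snd u + 1)}"
  proof
    fix p assume p: "p \<in> up_right_paths u v"
    then have "int (length p) = fst v + snd v - fst u - snd u + 1"
      using up_right_path_props[of p] by (auto simp: up_right_paths_def)
    with up_right_paths_bounds[OF p] show "p \<in> {p. set p \<subseteq> {fst u..fst v} \<times> {snd u..snd v} \<and>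
      length p = nat (fst v + snd v - fst u - snd u + 1)}"
      by (auto simp: mem_Times_iff)
  qed
qed (auto intro!: finite_lists_length_eq)

lemma last_passage_cong:
  assumes "\<And>z. fst u \<le> fst z \<Longrightarrow> snd u \<le> snd z \<Longrightarrow> fst z \<le> fst v \<Longrightarrow> snd z \<le> snd v \<Longrightarrow> w z = w' z"
  shows "last_passage w u v = last_passage w' u v"
proof -
  have "sum_list (map w p) = sum_list (map w' p)" if "p \<in> up_right_paths u v" for p
    using up_right_paths_bounds[OF that] assms by (intro arg_cong[where f = sum_list] map_cong) auto
  then show ?thesis
    unfolding last_passage_def by (intro arg_cong[where f = Max] image_cong) auto
qed

lemma last_passage_measurable:
  assumes "\<And>z. fst u \<le> fst z \<Longrightarrow> snd u \<le> snd z \<Longrightarrow> fst z \<le> fst v \<Longrightarrow> snd z \<le> snd v \<Longrightarrow>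
      (\<lambda>\<omega>. h \<omega> z) \<in> borel_measurable N"
  shows "(\<lambda>\<omega>. last_passage (h \<omega>) u v) \<in> borel_measurable N"
proof -
  have "(\<lambda>\<omega>. \<Sum>z\<leftarrow>p. h \<omega> z) \<in> borel_measurable N" if "p \<in> up_right_paths u v" for p
  proof -
    have "\<forall>z\<in>set p. (\<lambda>\<omega>. h \<omega> z) \<in> borel_measurable N"
      using up_right_paths_bounds[OF that] assms by auto
    then show ?thesis
      by (induction p) auto
  qed
  then have "(\<lambda>\<omega>. Max ((\<lambda>p. \<Sum>z\<leftarrow>p. h \<omega> z) ` up_right_paths u v)) \<in> borel_measurable N"
    using finite_up_right_paths by (intro borel_measurable_Max) auto
  then show ?thesis
    by (simp add: last_passage_def)
qed

text \<open>The concrete lattice sequence along which the Busemann limits are taken. Being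
  deterministic, it gives approximations that are functions of finitely many weights.\<close>

definition direction_seq :: "real \<Rightarrow> nat \<Rightarrow> site" where
  "direction_seq \<rho> n =
     (\<lfloor>real n * fst (direction \<rho>)\<rfloor>, \<lfloor>real n * snd (direction \<rho>)\<rfloor>)"

lemma floor_mult_div_tendsto: "(\<lambda>n. of_int \<lfloor>real n * a\<rfloor> / real n) \<longlonglongrightarrow> a"
proof (rule tendsto_sandwich)
  show "\<forall>\<^sub>F n in sequentially. a - 1 / real n \<le> of_int \<lfloor>real n * a\<rfloor> / real n"
    using eventually_gt_at_top[of 0]
  proof eventually_elim
    case (elim n)
    have "a - 1 / real n = (real n * a - 1) / real n"
      using elim by (simp add: field_simps)
    also have "\<dots> \<le> of_int \<lfloor>real n * a\<rfloor> / real n"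
      by (intro divide_right_mono) linarith+
    finally show ?case .
  qed
  show "\<forall>\<^sub>F n in sequentially. of_int \<lfloor>real n * a\<rfloor> / real n \<le> a"
    using eventually_gt_at_top[of 0]
  proof eventually_elim
    case (elim n)
    have "of_int \<lfloor>real n * a\<rfloor> / real n \<le> real n * a / real n"
      by (intro divide_right_mono) linarith+
    with elim show ?case by simp
  qed
  show "(\<lambda>n. a - 1 / real n) \<longlonglongrightarrow> a"
    using tendsto_diff[OF tendsto_const lim_const_over_n[of 1], of a] by simp
qed simp

lemma has_direction_direction_seq: "has_direction (direction_seq \<rho>) (direction \<rho>)"
proof -
  let ?a = "fst (direction \<rho>)"
  \<comment> \<open>The first coordinate alone then drives the norm of the sequence to
    infinity.\<close>
  have a: "?a < 0"
    by (auto simp: direction_def intro!: divide_pos_pos add_pos_nonneg)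
  have "filterlim (\<lambda>n. \<bar>\<lfloor>real n * ?a\<rfloor>\<bar>) at_top sequentially"
    unfolding filterlim_at_top
  proof
    fix z :: int
    have "eventually (\<lambda>n. real n \<ge> real_of_int z / - ?a) sequentially"
      by (rule eventually_sequentiallyI[of "nat \<lceil>real_of_int z / - ?a\<rceil>"]) linarith
    then show "eventually (\<lambda>n. z \<le> \<bar>\<lfloor>real n * ?a\<rfloor>\<bar>) sequentially"
    proof eventually_elim
      case (elim n)
      then have "real_of_int z \<le> - (real n * ?a)"
        using a by (simp add: field_simps)
      then show ?case by linarith
    qed
  qed
  then have "filterlim (\<lambda>n. \<bar>fst (direction_seq \<rho> n)\<bar> + \<bar>snd (direction_seq \<rho> n)\<bar>) at_top sequentially"
    by (rule filterlim_at_top_mono) (simp add: direction_seq_def)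
  moreover have "(\<lambda>n. (of_int (fst (direction_seq \<rho> n)) / real n, of_int (snd (direction_seq \<rho> n)) / real n))
      \<longlonglongrightarrow> (fst (direction \<rho>), snd (direction \<rho>))"
    unfolding direction_seq_def fst_conv snd_conv
    by (intro tendsto_Pair floor_mult_div_tendsto)
  ultimately show ?thesis
    by (simp add: has_direction_def)
qed

definition busemann_approx :: "real \<Rightarrow> nat \<Rightarrow> site \<Rightarrow> site \<Rightarrow> (site \<Rightarrow> real) \<Rightarrow> real" where
  "busemann_approx \<rho> n x y w =
     last_passage w (direction_seq \<rho> n) y - last_passage w (direction_seq \<rho> n) x"

text \<open>The slots carry the recursion: after l cells of column k, \<open>Hor \<rho> k\<close>
  holds I k l, while \<open>Ver \<rho> t\<close> holds J (Suc k) t in the rows t < l already visited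
  and J k t in the others.\<close>

lemma sweep_recursion:
  fixes I J Yc :: "nat \<Rightarrow> nat \<Rightarrow> real"
  assumes I: "\<And>k t. k \<le> m \<Longrightarrow> t < n \<Longrightarrow> I k (Suc t) = Yc k t + max 0 (I k t - J k t)"
    and J: "\<And>k t. k \<le> m \<Longrightarrow> t < n \<Longrightarrow> J (Suc k) t = Yc k t + max 0 (J k t - I k t)"
    and w: "\<And>k. k \<le> m \<Longrightarrow> w (Hor \<rho> k) = I k 0" "\<And>t. t < n \<Longrightarrow> w (Ver \<rho> t) = J 0 t"
      "\<And>k t. k \<le> m \<Longrightarrow> t < n \<Longrightarrow> w (Cell k t) = Yc k t"
  shows "exchanges (sweep \<rho> (Suc m) n) w (Hor \<rho> m) = I m n"
proof -
  have column: "exchanges (cell_column \<rho> l k) v (Hor \<rho> k) = I k l \<and>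
      (\<forall>t<n. exchanges (cell_column \<rho> l k) v (Ver \<rho> t) = J (if t < l then Suc k else k) t)"
    if "l \<le> n" "k \<le> m" "v (Hor \<rho> k) = I k 0" "\<And>t. t < n \<Longrightarrow> v (Ver \<rho> t) = J k t"
      "\<And>t. t < n \<Longrightarrow> v (Cell k t) = Yc k t" for l k v
    using that(1)
  proof (induction l)
    case 0
    then show ?case using that by (simp add: cell_column_def)
  next
    case (Suc l)
    let ?u = "exchanges (cell_column \<rho> l k) v"
    have u: "?u (Hor \<rho> k) = I k l" "\<And>t. t < n \<Longrightarrow> ?u (Ver \<rho> t) = J (if t < l then Suc k else k) t"
      using Suc by auto
    have "?u (Cell k l) = v (Cell k l)"
      by (intro exchanges_outside) (auto simp: move_defs)
    then have uC: "?u (Cell k l) = Yc k l"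
      using that(5) Suc.prems by simp
    have "exchanges (cell_column \<rho> (Suc l) k) v = exchange (Hor \<rho> k, Ver \<rho> l, Cell k l) ?u"
      by (simp add: cell_column_def)
    then show ?case
      using u uC Suc.prems I[OF that(2), of l] J[OF that(2), of l]
      by (auto simp: exchange_def less_Suc_eq)
  qed
  have "exchanges (sweep \<rho> l n) w (Ver \<rho> t) = J l t" if "l \<le> Suc m" "t < n" for l t
    using that
  proof (induction l arbitrary: t)
    case 0
    then show ?case using w by (simp add: sweep_def)
  next
    case (Suc l)
    let ?u = "exchanges (sweep \<rho> l n) w"
    have "?u (Hor \<rho> l) = w (Hor \<rho> l)" "?u (Cell l s) = w (Cell l s)" for s
      by (intro exchanges_outside; auto simp: move_defs)+
    with Suc w have "\<forall>t<n. exchanges (cell_column \<rho> n l) ?u (Ver \<rho> t) = J (Suc l) t"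
      using column[of n l ?u] by auto
    then show ?case
      using Suc.prems by (simp add: sweep_def)
  qed
  note ver = this
  let ?u = "exchanges (sweep \<rho> m n) w"
  have "?u (Hor \<rho> m) = w (Hor \<rho> m)" "?u (Cell m s) = w (Cell m s)" for s
    by (intro exchanges_outside; auto simp: move_defs)+
  then have "exchanges (cell_column \<rho> n m) ?u (Hor \<rho> m) = I m n"
    using column[of n m ?u] ver[of m] w by auto
  then show ?thesis
    by (simp add: sweep_def)
qed


section \<open>Product laws from probabilities of rectangles\<close>

context prob_space
begin

lemma prob_rectangle_indep_vars:
  assumes "indep_vars (\<lambda>_. N) X I" "finite J" "J \<subseteq> I" "\<And>i. i \<in> J \<Longrightarrow> A i \<in> sets N"
  shows "prob {\<omega> \<in> space M. \<forall>i\<in>J. X i \<omega> \<in> A i} = (\<Prod>i\<in>J. prob {\<omega> \<in> space M. X i \<omega> \<in> A i})"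
proof (cases "J = {}")
  case False
  have 1: "X i -` A i \<inter> space M = {\<omega> \<in> space M. X i \<omega> \<in> A i}" for i
    by auto
  have 2: "(\<Inter>i\<in>J. {\<omega> \<in> space M. X i \<omega> \<in> A i}) = {\<omega> \<in> space M. \<forall>i\<in>J. X i \<omega> \<in> A i}"
    using False by auto
  show ?thesis
    using indep_varsD[OF assms(1) False assms(2,3), of A] assms(4) unfolding 1 2 by simp
qed (simp add: prob_space)

lemma distr_restrict_eq_PiM:
  assumes "finite L" and X: "\<And>s. s \<in> L \<Longrightarrow> X s \<in> borel_measurable M"
    and \<mu>: "\<And>s. prob_space (\<mu> s)" "\<And>s. sets (\<mu> s) = sets borel"
    and eq: "\<And>A. (\<And>s. s \<in> L \<Longrightarrow> A s \<in> sets borel) \<Longrightarrow>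
      prob {\<omega> \<in> space M. \<forall>s\<in>L. X s \<omega> \<in> A s} = (\<Prod>s\<in>L. measure (\<mu> s) (A s))"
  shows "distr M (PiM L (\<lambda>_. borel)) (\<lambda>\<omega>. restrict (\<lambda>s. X s \<omega>) L) = PiM L \<mu>"
proof -
  note emeasure_M = emeasure_eq_measure
  interpret product_prob_space \<mu>
    by (intro product_prob_spaceI \<mu>)
  have sets: "sets (PiM L \<mu>) = sets (PiM L (\<lambda>_. borel))"
    by (intro sets_PiM_cong \<mu> refl)
  show ?thesis
  proof (rule PiM_eqI)
    fix A assume "\<And>s. s \<in> L \<Longrightarrow> A s \<in> sets (\<mu> s)"
    then have A: "A s \<in> sets borel" if "s \<in> L" for s
      using that \<mu>(2) by auto
    have "(\<lambda>\<omega>. restrict (\<lambda>s. X s \<omega>) L) -` Pi\<^sub>E L A \<inter> space M =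
        {\<omega> \<in> space M. \<forall>s\<in>L. X s \<omega> \<in> A s}"
      by auto
    then have "emeasure (distr M (PiM L (\<lambda>_. borel)) (\<lambda>\<omega>. restrict (\<lambda>s. X s \<omega>) L)) (Pi\<^sub>E L A) =
        emeasure M {\<omega> \<in> space M. \<forall>s\<in>L. X s \<omega> \<in> A s}"
      using X A assms(1) by (subst emeasure_distr) (auto intro!: measurable_restrict sets_PiM_I_finite)
    also have "\<dots> = (\<Prod>s\<in>L. emeasure (\<mu> s) (A s))"
      using eq[of A] A by (simp add: emeasure_M M.emeasure_eq_measure prod_ennreal)
    finally show "emeasure (distr M (PiM L (\<lambda>_. borel)) (\<lambda>\<omega>. restrict (\<lambda>s. X s \<omega>) L)) (Pi\<^sub>E L A) =
        (\<Prod>s\<in>L. emeasure (\<mu> s) (A s))" .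
  qed (use assms(1) sets in auto)
qed

end

text \<open>The sites that a last-passage value ending at x can read, wherever its paths
  start.\<close>

definition below :: "site \<Rightarrow> site set" where
  "below x = {z. fst z \<le> fst x \<and> snd z \<le> snd x}"

lemma busemann_approx_measurable:
  assumes "\<And>z. z \<in> below x \<union> below y \<Longrightarrow> (\<lambda>\<omega>. h \<omega> z) \<in> borel_measurable N"
  shows "(\<lambda>\<omega>. busemann_approx \<rho> n x y (h \<omega>)) \<in> borel_measurable N"
  unfolding busemann_approx_def
  by (intro borel_measurable_diff last_passage_measurable assms) (auto simp: below_def)

lemma busemann_approx_cong:
  assumes "\<And>z. z \<in> below x \<union> below y \<Longrightarrow> fst (direction_seq \<rho> n) \<le> fst z \<Longrightarrow>
      snd (direction_seq \<rho> n) \<le> snd z \<Longrightarrow> w z = w' z"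
  shows "busemann_approx \<rho> n x y w = busemann_approx \<rho> n x y w'"
  unfolding busemann_approx_def
  by (intro arg_cong2[where f = "(-)"] last_passage_cong assms) (auto simp: below_def)

text \<open>There are m + 1 columns but n rows. The row \<open>snd x - int n\<close> under the
  window and the column \<open>fst x - int m - 1\<close> to its left are left out; they carry the
  boundary increments.\<close>

definition window_sites :: "site \<Rightarrow> nat \<Rightarrow> nat \<Rightarrow> site set" where
  "window_sites x m n = {fst x - int m..fst x} \<times> {snd x - int n + 1..snd x}"

definition cell_of :: "site \<Rightarrow> nat \<Rightarrow> nat \<Rightarrow> site \<Rightarrow> slot" where
  "cell_of x m n z = Cell (nat (fst z - fst x + int m)) (nat (snd z - snd x + int n - 1))"

lemma bij_betw_cell_of: "bij_betw (cell_of x m n) (window_sites x m n) (cell_slots (Suc m) n)"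
proof (rule bij_betwI')
  fix y z assume "y \<in> window_sites x m n" "z \<in> window_sites x m n"
  then show "(cell_of x m n y = cell_of x m n z) = (y = z)"
    by (auto simp: cell_of_def window_sites_def prod_eq_iff)
next
  fix z assume "z \<in> window_sites x m n"
  then show "cell_of x m n z \<in> cell_slots (Suc m) n"
    by (auto simp: cell_of_def window_sites_def)
next
  fix s assume "s \<in> cell_slots (Suc m) n"
  then obtain k t where s: "s = Cell k t" "k \<le> m" "t < n"
    by (auto simp: cell_slots_def)
  show "\<exists>z\<in>window_sites x m n. s = cell_of x m n z"
    by (rule bexI[of _ "(fst x - int m + int k, snd x - int n + 1 + int t)"])
      (use s in \<open>auto simp: cell_of_def window_sites_def\<close>)
qed

text \<open>The stationary line of parameter \<open>\<rho>\<close> on the window whose upper right corner is \<open>x\<close>: the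
  horizontal and vertical slots carry the Busemann increments on the lower and left boundary.\<close>

primrec window_config :: "(site \<Rightarrow> 'a \<Rightarrow> real) \<Rightarrow> (real \<Rightarrow> site \<Rightarrow> site \<Rightarrow> 'a \<Rightarrow> real) \<Rightarrow>
    site \<Rightarrow> nat \<Rightarrow> nat \<Rightarrow> 'a \<Rightarrow> slot \<Rightarrow> real" where
  "window_config Y B x m n \<omega> (Hor \<rho> k) = (let z = (fst x - int m + int k, snd x - int n) in B \<rho> (z - e1) z \<omega>)"
| "window_config Y B x m n \<omega> (Ver \<rho> t) =
    (let z = (fst x - int m - 1, snd x - int n + 1 + int t) in B \<rho> (z - e2) z \<omega>)"
| "window_config Y B x m n \<omega> (Diag \<rho>) = 0"
| "window_config Y B x m n \<omega> (Cell k t) = Y (fst x - int m + int k, snd x - int n + 1 + int t) \<omega>"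

lemma window_config_cell_of:
  "z \<in> window_sites x m n \<Longrightarrow> window_config Y B x m n \<omega> (cell_of x m n z) = Y z \<omega>"
  by (cases z) (auto simp: window_sites_def cell_of_def)

section \<open>Busemann increments on the boundary of a window\<close>

context busemann_process
begin

lemma Y_measurable [measurable]: "Y x \<in> borel_measurable M"
  using distributed_measurable[OF Y_exponential] by simp

lemma B_measurable: "\<rho> > 1 \<Longrightarrow> B \<rho> x y \<in> borel_measurable M"
proof -
  assume \<rho>: "\<rho> > 1"
  from borel_function_of_Y obtain \<Phi> where
    \<Phi>: "\<forall>\<rho>>1. \<forall>x y. \<Phi> \<rho> x y \<in> borel_measurable (\<Pi>\<^sub>M z\<in>UNIV. borel) \<and>
         (\<forall>\<omega>\<in>space M. B \<rho> x y \<omega> = \<Phi> \<rho> x y (\<lambda>z. Y z \<omega>))" ..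
  with \<rho> have \<Phi>: "\<Phi> \<rho> x y \<in> borel_measurable (\<Pi>\<^sub>M z\<in>UNIV. borel)"
    "\<And>\<omega>. \<omega> \<in> space M \<Longrightarrow> B \<rho> x y \<omega> = \<Phi> \<rho> x y (\<lambda>z. Y z \<omega>)"
    by blast+
  have "(\<lambda>\<omega> z. Y z \<omega>) \<in> measurable M (\<Pi>\<^sub>M z\<in>UNIV. borel)"
    by (rule measurable_PiM_single') auto
  from measurable_compose[OF this \<Phi>(1)] show ?thesis
    using \<Phi>(2) by (subst measurable_cong) auto
qed

lemma AE_busemann_approx_tendsto:
  assumes "\<rho> > 1"
  shows "AE \<omega> in M. \<forall>x y. (\<lambda>n. busemann_approx \<rho> n x y (\<lambda>z. Y z \<omega>)) \<longlonglongrightarrow> B \<rho> x y \<omega>"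
  using busemann_limit[OF assms] has_direction_direction_seq
  unfolding busemann_approx_def by (auto elim!: eventually_mono)

text \<open>Paths that end at x or y stay below these sites, so the increment is almost surely a
  function of the weights in V. This is the source of the independence between increments and the
  weights beyond them.\<close>

lemma AE_B_eq_lim:
  assumes "\<rho> > 1" "below x \<union> below y \<subseteq> V"
  shows "AE \<omega> in M. B \<rho> x y \<omega> = lim (\<lambda>n. busemann_approx \<rho> n x y (restrict (\<lambda>z. Y z \<omega>) V))"
  using AE_busemann_approx_tendsto[OF assms(1)]
proof eventually_elim
  case (elim \<omega>)
  have "busemann_approx \<rho> n x y (restrict (\<lambda>z. Y z \<omega>) V) = busemann_approx \<rho> n x y (\<lambda>z. Y z \<omega>)" for n
    using assms(2) by (intro busemann_approx_cong) auto
  moreover have "(\<lambda>n. busemann_approx \<rho> n x y (\<lambda>z. Y z \<omega>)) \<longlonglongrightarrow> B \<rho> x y \<omega>"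
    using elim by blast
  ultimately show ?case
    by (simp add: limI)
qed

lemma lim_busemann_approx_measurable:
  assumes "below x \<union> below y \<subseteq> V"
  shows "(\<lambda>w. lim (\<lambda>n. busemann_approx \<rho> n x y w)) \<in> borel_measurable (\<Pi>\<^sub>M z\<in>V. borel)"
  using assms by (intro borel_measurable_lim_metric busemann_approx_measurable) auto

text \<open>Let I, J, I', J' be the increments over the lower, left, upper and right edge of a unit
  square. Additivity gives I + J' = J + I', and together with Y = min I' J' this determines I' and
  J'. The update is exactly an exchange of I, J and Y.\<close>

lemma AE_B_recursion:
  "AE \<omega> in M. \<forall>x. \<forall>\<rho>>1.
     B \<rho> (x - e1) x \<omega> = Y x \<omega> + max 0 (B \<rho> (x - e2 - e1) (x - e2) \<omega> - B \<rho> (x - e1 - e2) (x - e1) \<omega>) \<and>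
     B \<rho> (x - e2) x \<omega> = Y x \<omega> + max 0 (B \<rho> (x - e1 - e2) (x - e1) \<omega> - B \<rho> (x - e2 - e1) (x - e2) \<omega>)"
  using single_event
proof eventually_elim
  case (elim \<omega>)
  show ?case
  proof (intro allI impI)
    fix x :: site and \<rho> :: real assume \<rho>: "\<rho> > 1"
    have comm: "x - e1 - e2 = x - e2 - e1" by (simp add: algebra_simps)
    have "B \<rho> (x - e2 - e1) (x - e2) \<omega> + B \<rho> (x - e2) x \<omega> = B \<rho> (x - e2 - e1) x \<omega>"
      "B \<rho> (x - e1 - e2) (x - e1) \<omega> + B \<rho> (x - e1) x \<omega> = B \<rho> (x - e1 - e2) x \<omega>"
      using elim \<rho> by blast+
    moreover have "Y x \<omega> = min (B \<rho> (x - e1) x \<omega>) (B \<rho> (x - e2) x \<omega>)"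
      using elim \<rho> by blast
    ultimately show "B \<rho> (x - e1) x \<omega> = Y x \<omega> + max 0 (B \<rho> (x - e2 - e1) (x - e2) \<omega> - B \<rho> (x - e1 - e2) (x - e1) \<omega>) \<and>
     B \<rho> (x - e2) x \<omega> = Y x \<omega> + max 0 (B \<rho> (x - e1 - e2) (x - e1) \<omega> - B \<rho> (x - e2 - e1) (x - e2) \<omega>)"
      unfolding comm by linarith
  qed
qed

lemma AE_sweep_window_config:
  assumes "\<rho> > 1"
  shows "AE \<omega> in M. B \<rho> (x - e1) x \<omega> =
    exchanges (sweep \<rho> (Suc m) n) (restrict (window_config Y B x m n \<omega>) (line_slots \<rho> (Suc m) n)) (Hor \<rho> m)"
  using AE_B_recursion
proof eventually_elim
  case (elim \<omega>)
  \<comment> \<open>Row 0 is the boundary row under the window, so \<open>Cell k t\<close> belongs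
    to the site \<open>?z k (Suc t)\<close>.\<close>
  let ?z = "\<lambda>k t. (fst x - int m + int k, snd x - int n + int t) :: site"
  have "exchanges (sweep \<rho> (Suc m) n) (restrict (window_config Y B x m n \<omega>) (line_slots \<rho> (Suc m) n)) (Hor \<rho> m) =
      B \<rho> (?z m n - e1) (?z m n) \<omega>"
  proof (rule sweep_recursion[where I = "\<lambda>k t. B \<rho> (?z k t - e1) (?z k t) \<omega>"
        and J = "\<lambda>k t. B \<rho> (?z k (Suc t) - e1 - e2) (?z k (Suc t) - e1) \<omega>" and Yc = "\<lambda>k t. Y (?z k (Suc t)) \<omega>"])
    fix k t
    have z: "?z k (Suc t) - e2 = ?z k t" "?z (Suc k) (Suc t) - e1 = ?z k (Suc t)"
      "?z k (Suc t) - e1 - e2 = ?z k t - e1"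
      by (auto simp: e1_def e2_def)
    from elim assms have rec: "B \<rho> (?z k (Suc t) - e1) (?z k (Suc t)) \<omega> = Y (?z k (Suc t)) \<omega> +
        max 0 (B \<rho> (?z k (Suc t) - e2 - e1) (?z k (Suc t) - e2) \<omega> - B \<rho> (?z k (Suc t) - e1 - e2) (?z k (Suc t) - e1) \<omega>)"
      "B \<rho> (?z k (Suc t) - e2) (?z k (Suc t)) \<omega> = Y (?z k (Suc t)) \<omega> +
        max 0 (B \<rho> (?z k (Suc t) - e1 - e2) (?z k (Suc t) - e1) \<omega> - B \<rho> (?z k (Suc t) - e2 - e1) (?z k (Suc t) - e2) \<omega>)"
      by blast+
    from rec show "B \<rho> (?z k (Suc t) - e1) (?z k (Suc t)) \<omega> = Y (?z k (Suc t)) \<omega> +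
        max 0 (B \<rho> (?z k t - e1) (?z k t) \<omega> - B \<rho> (?z k (Suc t) - e1 - e2) (?z k (Suc t) - e1) \<omega>)"
      and "B \<rho> (?z (Suc k) (Suc t) - e1 - e2) (?z (Suc k) (Suc t) - e1) \<omega> = Y (?z k (Suc t)) \<omega> +
        max 0 (B \<rho> (?z k (Suc t) - e1 - e2) (?z k (Suc t) - e1) \<omega> - B \<rho> (?z k t - e1) (?z k t) \<omega>)"
      by (simp_all only: z)
  qed (auto simp: Let_def e1_def e2_def algebra_simps)
  moreover have "?z m n = x" by (simp add: prod_eq_iff)
  ultimately show ?case by simp
qed

end


lemma sets_Collect_finite_rectangle:
  assumes "finite H" "\<And>s. s \<in> H \<Longrightarrow> f s \<in> measurable N K" "\<And>s. s \<in> H \<Longrightarrow> A s \<in> sets K"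
  shows "{v \<in> space N. \<forall>s\<in>H. f s v \<in> A s} \<in> sets N"
proof (intro sets.sets_Collect_finite_All assms(1))
  fix s assume "s \<in> H"
  then have "f s -` A s \<inter> space N \<in> sets N"
    using assms by (intro measurable_sets) auto
  also have "f s -` A s \<inter> space N = {v \<in> space N. f s v \<in> A s}" by auto
  finally show "{v \<in> space N. f s v \<in> A s} \<in> sets N" .
qed

context busemann_process
begin

lemma window_config_measurable:
  assumes "\<rho> > 1" "s \<in> line_slots \<rho> m n"
  shows "(\<lambda>\<omega>. window_config Y B x l n \<omega> s) \<in> borel_measurable M"
  using assms B_measurable by (cases s) (auto simp: Let_def)

lemma prob_window_config:
  assumes "\<rho> > 1" "s \<in> line_slots \<rho> (Suc m) n" and [measurable]: "A \<in> sets borel"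
  shows "prob {\<omega> \<in> space M. window_config Y B x m n \<omega> s \<in> A} = measure (exp_law (slot_rate \<kappa> s)) A"
proof -
  have dist: "prob {\<omega> \<in> space M. X \<omega> \<in> A} = measure (exp_law r) A"
    if "distributed M lborel X (exponential_density r)" for X r
  proof -
    have [measurable]: "X \<in> borel_measurable M"
      using distributed_measurable[OF that] by simp
    have "prob {\<omega> \<in> space M. X \<omega> \<in> A} = measure (distr M lborel X) A"
      by (subst measure_distr) (auto intro!: arg_cong[where f = prob])
    also have "distr M lborel X = exp_law r"
      using distributed_distr_eq_density[OF that] .
    finally show ?thesis .
  qed
  show ?thesis
    using assms(1,2) dist[OF horizontal_exponential[OF assms(1)]]
      dist[OF vertical_exponential[OF assms(1)]] dist[OF Y_exponential]
    by (cases s) (auto simp: Let_def)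
qed

text \<open>The left and the lower boundary form one down-right path, along which the increments are
  independent. Vertical edges are traversed downwards, and X restores their sign.\<close>

lemma prob_boundary_config:
  fixes \<rho> :: real and m n :: nat
  assumes \<rho>: "\<rho> > 1"
  defines "H \<equiv> Hor \<rho> ` {..m} \<union> Ver \<rho> ` {..<n}"
  assumes A: "\<And>s. s \<in> H \<Longrightarrow> A s \<in> sets borel"
  shows "prob {\<omega> \<in> space M. \<forall>s\<in>H. window_config Y B x m n \<omega> s \<in> A s} =
    (\<Prod>s\<in>H. prob {\<omega> \<in> space M. window_config Y B x m n \<omega> s \<in> A s})"
proof -
  note [measurable] = B_measurable[OF \<rho>]
  \<comment> \<open>Index 0 is the lower left corner. The path comes down the left boundary at
    negative indices and follows the lower boundary afterwards.\<close>
  define y :: "int \<Rightarrow> site" where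
    "y k = (fst x - int m - 1 + max k 0, snd x - int n + max (- k) 0)" for k
  \<comment> \<open>The step from \<open>y (- t - 1)\<close> to \<open>y (- t)\<close> descends from
    height t + 1 to height t over the corner, which is the edge of
    \<open>Ver \<rho> t\<close>.\<close>
  define D where "D i = (if i \<ge> 0 then Hor \<rho> (nat i) else Ver \<rho> (nat (- i - 1)))" for i :: int
  define X where "X i \<omega> = (if i \<ge> 0 then 1 else - 1) * B \<rho> (y i) (y (i + 1)) \<omega>" for i \<omega>
  define J where "J = {- int n..int m}"
  have "y (k + 1) - y k \<in> {e1, - e2}" for k
    by (cases "k \<ge> 0") (auto simp: y_def e1_def e2_def max_def)
  then have "indep_vars (\<lambda>_. borel) (\<lambda>k. B \<rho> (y k) (y (k + 1))) UNIV"
    using \<rho> by (intro down_right_indep)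
  then have X_indep: "indep_vars (\<lambda>_. borel) X UNIV"
    unfolding X_def by (intro indep_vars_compose2[where N = "\<lambda>_. borel"]) auto
  have X_measurable [measurable]: "X i \<in> borel_measurable M" for i
    unfolding X_def by measurable
  have AE_eq: "AE \<omega> in M. \<forall>i. X i \<omega> = window_config Y B x m n \<omega> (D i)"
    using single_event
  proof eventually_elim
    case (elim \<omega>)
    have add: "B \<rho> a b \<omega> + B \<rho> b c \<omega> = B \<rho> a c \<omega>" for a b c
      using elim \<rho> by blast
    have anti: "- B \<rho> a b \<omega> = B \<rho> b a \<omega>" for a b
      using add[of a b a] add[of a a a] by linarith
    show ?case
    proof
      fix i
      show "X i \<omega> = window_config Y B x m n \<omega> (D i)"
      proof (cases "i \<ge> 0")
        case True
        then show ?thesis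
          by (simp add: X_def D_def Let_def y_def e1_def algebra_simps)
      next
        case False
        then have "y (i + 1) = (fst x - int m - 1, snd x - int n + 1 + int (nat (- i - 1))) - e2"
          "y i = (fst x - int m - 1, snd x - int n + 1 + int (nat (- i - 1)))"
          by (auto simp: y_def e2_def)
        with False show ?thesis
          by (simp only: X_def D_def Let_def window_config.simps if_False anti mult_minus1)
      qed
    qed
  qed
  have D: "bij_betw D J H"
  proof (rule bij_betwI')
    fix s assume "s \<in> H"
    then consider k where "s = Hor \<rho> k" "k \<le> m" | t where "s = Ver \<rho> t" "t < n"
      by (auto simp: H_def)
    then show "\<exists>i\<in>J. s = D i"
    proof cases
      case 1
      then show ?thesis by (intro bexI[of _ "int k"]) (auto simp: D_def J_def)
    next
      case 2
      then show ?thesis by (intro bexI[of _ "- int t - 1"]) (auto simp: D_def J_def)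
    qed
  qed (auto simp: D_def J_def H_def split: if_splits)
  have [measurable]: "(\<lambda>\<omega>. window_config Y B x m n \<omega> s) \<in> borel_measurable M" if "s \<in> H" for s
    using that by (auto simp: H_def Let_def)
  have DH: "D i \<in> H" if "i \<in> J" for i
    using D that by (rule bij_betwE[THEN bspec])
  have fin: "finite J" "finite H" by (auto simp: J_def H_def)
  have AD: "A (D i) \<in> sets borel" if "i \<in> J" for i
    using A DH that by blast
  have "prob {\<omega> \<in> space M. \<forall>s\<in>H. window_config Y B x m n \<omega> s \<in> A s} =
      prob {\<omega> \<in> space M. \<forall>i\<in>J. window_config Y B x m n \<omega> (D i) \<in> A (D i)}"
    unfolding bij_betw_imp_surj_on[OF D, symmetric] by simp
  also have "\<dots> = prob {\<omega> \<in> space M. \<forall>i\<in>J. X i \<omega> \<in> A (D i)}"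
    using AE_eq fin AD DH by (intro prob_eq_AE) (auto elim!: eventually_mono)
  also have "\<dots> = (\<Prod>i\<in>J. prob {\<omega> \<in> space M. X i \<omega> \<in> A (D i)})"
    using X_indep fin AD by (intro prob_rectangle_indep_vars) auto
  also have "\<dots> = (\<Prod>i\<in>J. prob {\<omega> \<in> space M. window_config Y B x m n \<omega> (D i) \<in> A (D i)})"
    using AE_eq AD DH by (intro prod.cong refl prob_eq_AE) (auto elim!: eventually_mono)
  also have "\<dots> = (\<Prod>s\<in>H. prob {\<omega> \<in> space M. window_config Y B x m n \<omega> s \<in> A s})"
    by (rule prod.reindex_bij_betw[OF D])
  finally show ?thesis .
qed

text \<open>No site of the window lies below an endpoint of a boundary edge. So the boundary
  increments are functions of the weights outside the window and independent of its cells, while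
  within each of the two families independence is known. The parameter \<kappa> affects
  \<open>slot_rate\<close> on diagonal slots only, and a line contains none.\<close>

lemma distr_window_config:
  fixes \<rho> :: real and m n :: nat
  assumes \<rho>: "\<rho> > 1" and \<kappa>: "\<kappa> > 1"
  defines "L \<equiv> line_slots \<rho> (Suc m) n"
  shows "distr M (slot_algebra L) (\<lambda>\<omega>. restrict (window_config Y B x m n \<omega>) L) = slot_law \<kappa> L"
proof (rule distr_restrict_eq_PiM)
  let ?w = "window_config Y B x m n"
  define H where "H = Hor \<rho> ` {..m} \<union> Ver \<rho> ` {..<n}"
  define C where "C = cell_slots (Suc m) n"
  define V where "V = - window_sites x m n"
  have L: "L = H \<union> C" "H \<inter> C = {}" and fin: "finite H" "finite C"
    by (auto simp: L_def line_slots_def H_def C_def cell_slots_def)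
  then show "finite L" by simp
  show meas: "(\<lambda>\<omega>. ?w \<omega> s) \<in> borel_measurable M" if "s \<in> L" for s
    using \<rho> that unfolding L_def by (rule window_config_measurable)
  fix A :: "slot \<Rightarrow> real set" assume A: "\<And>s. s \<in> L \<Longrightarrow> A s \<in> sets borel"
  have boundary: "\<exists>f \<in> borel_measurable (\<Pi>\<^sub>M z\<in>V. borel). AE \<omega> in M. ?w \<omega> s = f (restrict (\<lambda>z. Y z \<omega>) V)"
    if "s \<in> H" for s
  proof -
    have *: "\<exists>f \<in> borel_measurable (\<Pi>\<^sub>M z\<in>V. borel). AE \<omega> in M. B \<rho> u v \<omega> = f (restrict (\<lambda>z. Y z \<omega>) V)"
      if "below u \<union> below v \<subseteq> V" for u v
      using lim_busemann_approx_measurable[OF that, of \<rho>] AE_B_eq_lim[OF \<rho> that]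
      by (intro bexI[of _ "\<lambda>w. lim (\<lambda>n. busemann_approx \<rho> n u v w)"])
    from that consider k where "s = Hor \<rho> k" | t where "s = Ver \<rho> t"
      by (auto simp: H_def)
    then show ?thesis
    proof cases
      case 1
      show ?thesis
        unfolding 1 window_config.simps Let_def
        by (rule *) (auto simp: below_def V_def window_sites_def e1_def)
    next
      case 2
      show ?thesis
        unfolding 2 window_config.simps Let_def
        by (rule *) (auto simp: below_def V_def window_sites_def e2_def)
    qed
  qed
  then have "\<forall>s\<in>H. \<exists>f. f \<in> borel_measurable (\<Pi>\<^sub>M z\<in>V. borel) \<and>
      (AE \<omega> in M. ?w \<omega> s = f (restrict (\<lambda>z. Y z \<omega>) V))"
    by blast
  from bchoice[OF this] obtain f where f: "\<And>s. s \<in> H \<Longrightarrow> f s \<in> borel_measurable (\<Pi>\<^sub>M z\<in>V. borel)"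
      "\<And>s. s \<in> H \<Longrightarrow> AE \<omega> in M. ?w \<omega> s = f s (restrict (\<lambda>z. Y z \<omega>) V)"
    by blast
  let ?E = "{\<omega> \<in> space M. \<forall>s\<in>H. ?w \<omega> s \<in> A s}"
  let ?F = "{\<omega> \<in> space M. \<forall>s\<in>C. ?w \<omega> s \<in> A s}"
  let ?S = "{v \<in> space (\<Pi>\<^sub>M z\<in>V. borel). \<forall>s\<in>H. f s v \<in> A s}"
  let ?T = "{v \<in> space (\<Pi>\<^sub>M z\<in>window_sites x m n. borel). \<forall>z\<in>window_sites x m n. v z \<in> A (cell_of x m n z)}"
  let ?YV = "\<lambda>\<omega>. restrict (\<lambda>z. Y z \<omega>) V" and ?YW = "\<lambda>\<omega>. restrict (\<lambda>z. Y z \<omega>) (window_sites x m n)"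
  have cell: "cell_of x m n z \<in> C" if "z \<in> window_sites x m n" for z
    using bij_betwE[OF bij_betw_cell_of] that unfolding C_def by blast
  have fW: "finite (window_sites x m n)" by (simp add: window_sites_def)
  have A': "A s \<in> sets borel" if "s \<in> H \<or> s \<in> C" for s
    using A L that by auto
  have meas': "(\<lambda>\<omega>. ?w \<omega> s) \<in> borel_measurable M" if "s \<in> H \<or> s \<in> C" for s
    using meas L that by auto
  have S: "?S \<in> sets (\<Pi>\<^sub>M z\<in>V. borel)"
    using fin(1) f(1) A'[OF disjI1] by (rule sets_Collect_finite_rectangle)
  have T: "?T \<in> sets (\<Pi>\<^sub>M z\<in>window_sites x m n. borel)"
    using fW measurable_component_singleton A'[OF disjI2[OF cell]] by (rule sets_Collect_finite_rectangle)
  have Y_window: "?w \<omega> (cell_of x m n z) = Y z \<omega>" if "z \<in> window_sites x m n" for z \<omega>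
    using that by (rule window_config_cell_of)
  have F: "?F = ?YW -` ?T \<inter> space M"
  proof -
    have "(\<forall>s\<in>C. ?w \<omega> s \<in> A s) \<longleftrightarrow> (\<forall>z\<in>window_sites x m n. Y z \<omega> \<in> A (cell_of x m n z))" for \<omega>
      unfolding C_def bij_betw_imp_surj_on[OF bij_betw_cell_of[of x m n], symmetric] by (simp add: Y_window)
    then show ?thesis
      by (auto simp: space_PiM)
  qed
  have "indep_var (\<Pi>\<^sub>M z\<in>V. borel) ?YV (\<Pi>\<^sub>M z\<in>window_sites x m n. borel) ?YW"
    using Y_indep by (rule indep_var_restrict) (auto simp: V_def)
  moreover have "(\<lambda>\<omega>. (a \<omega>, b \<omega>)) -` (S \<times> T) \<inter> space M = a -` S \<inter> space M \<inter> (b -` T \<inter> space M)"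
    for a :: "'a \<Rightarrow> site \<Rightarrow> real" and b :: "'a \<Rightarrow> site \<Rightarrow> real" and S T
    by auto
  ultimately have "prob (?YV -` ?S \<inter> space M \<inter> (?YW -` ?T \<inter> space M)) =
      prob (?YV -` ?S \<inter> space M) * prob (?YW -` ?T \<inter> space M)"
    using indep_varD[OF _ S T, of ?YV ?YW] by (simp only:)
  moreover have AE_E: "AE \<omega> in M. \<omega> \<in> ?E \<longleftrightarrow> \<omega> \<in> ?YV -` ?S \<inter> space M"
  proof -
    have "AE \<omega> in M. \<forall>s\<in>H. ?w \<omega> s = f s (?YV \<omega>)"
      using fin f(2) by (intro AE_finite_allI) auto
    then show ?thesis
      using AE_space by eventually_elim (auto simp: space_PiM)
  qed
  moreover have YV: "?YV -` ?S \<inter> space M \<in> sets M"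
    by (rule measurable_sets[OF _ S]) (auto intro!: measurable_restrict)
  moreover have E: "?E \<in> sets M" and F': "?F \<in> sets M"
    using sets_Collect_finite_rectangle[OF fin(1) meas'[OF disjI1] A'[OF disjI1]]
      sets_Collect_finite_rectangle[OF fin(2) meas'[OF disjI2] A'[OF disjI2]] by auto
  moreover have "prob (?YV -` ?S \<inter> space M) = prob ?E"
    using AE_E YV E by (intro measure_eq_AE) auto
  moreover have "prob (?YV -` ?S \<inter> space M \<inter> (?YW -` ?T \<inter> space M)) = prob (?E \<inter> ?F)"
    unfolding F[symmetric] using AE_E YV E F' by (intro measure_eq_AE) auto
  ultimately have EF: "prob (?E \<inter> ?F) = prob ?E * prob ?F"
    by (simp only: F)
  have "prob ?E = (\<Prod>s\<in>H. prob {\<omega> \<in> space M. ?w \<omega> s \<in> A s})"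
    unfolding H_def using \<rho> A' by (intro prob_boundary_config) (auto simp: H_def)
  moreover have "prob ?F = (\<Prod>s\<in>C. prob {\<omega> \<in> space M. ?w \<omega> s \<in> A s})"
  proof -
    have "?F = {\<omega> \<in> space M. \<forall>z\<in>window_sites x m n. Y z \<omega> \<in> A (cell_of x m n z)}"
      unfolding C_def bij_betw_imp_surj_on[OF bij_betw_cell_of[of x m n], symmetric] by (simp add: Y_window)
    then have "prob ?F = (\<Prod>z\<in>window_sites x m n. prob {\<omega> \<in> space M. Y z \<omega> \<in> A (cell_of x m n z)})"
      using Y_indep fW A' cell by (subst prob_rectangle_indep_vars[symmetric]) auto
    also have "\<dots> = (\<Prod>z\<in>window_sites x m n. prob {\<omega> \<in> space M. ?w \<omega> (cell_of x m n z) \<in> A (cell_of x m n z)})"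
      by (simp add: Y_window)
    also have "\<dots> = (\<Prod>s\<in>C. prob {\<omega> \<in> space M. ?w \<omega> s \<in> A s})"
      unfolding C_def by (rule prod.reindex_bij_betw[OF bij_betw_cell_of])
    finally show ?thesis .
  qed
  moreover have "{\<omega> \<in> space M. \<forall>s\<in>L. ?w \<omega> s \<in> A s} = ?E \<inter> ?F"
    unfolding L by auto
  ultimately have "prob {\<omega> \<in> space M. \<forall>s\<in>L. ?w \<omega> s \<in> A s} =
      (\<Prod>s\<in>L. prob {\<omega> \<in> space M. ?w \<omega> s \<in> A s})"
    using EF L fin by (simp add: prod.union_disjoint)
  also have "\<dots> = (\<Prod>s\<in>L. measure (exp_law (slot_rate \<kappa> s)) (A s))"
    using \<rho> A by (intro prod.cong refl prob_window_config) (auto simp: L_def)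
  finally show "prob {\<omega> \<in> space M. \<forall>s\<in>L. ?w \<omega> s \<in> A s} =
      (\<Prod>s\<in>L. measure (exp_law (slot_rate \<kappa> s)) (A s))" .
qed (use \<kappa> in \<open>auto intro!: prob_space_exponential_density slot_rate_pos\<close>)

end


section \<open>Characteristic functions of a Busemann edge\<close>


text \<open>Rewrites a form in the value at \<kappa> and the increments over it as a form in the
  values themselves, the shape in which limits of characteristic functions are taken.\<close>

lemma sum_insert_split_coeff:
  fixes f \<theta> :: "'i \<Rightarrow> real"
  assumes "finite R" "\<kappa> \<notin> R"
  shows "(\<Sum>\<rho>\<in>insert \<kappa> R. (\<theta>(\<kappa> := s - (\<Sum>\<rho>\<in>R. \<theta> \<rho>))) \<rho> * f \<rho>) =
    s * f \<kappa> + (\<Sum>\<rho>\<in>R. \<theta> \<rho> * (f \<rho> - f \<kappa>))"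
proof -
  have "(\<Sum>\<rho>\<in>R. (\<theta>(\<kappa> := s - (\<Sum>\<rho>\<in>R. \<theta> \<rho>))) \<rho> * f \<rho>) = (\<Sum>\<rho>\<in>R. \<theta> \<rho> * f \<rho>)"
    using assms(2) by (intro sum.cong) auto
  then show ?thesis
    using assms by (simp add: right_diff_distrib sum_subtractf sum_distrib_right left_diff_distrib)
qed

context busemann_process
begin

text \<open>The factorisation holds exactly in every window and passes to the limit: by
  \<open>window_estimate\<close> the characteristic functions of the window values differ from those
  of the last-passage approximations by truncated errors, which vanish by dominated
  convergence.\<close>

lemma busemann_factor:
  fixes \<theta> :: "real \<Rightarrow> real" and x :: site
  assumes \<kappa>: "\<kappa> > 1" and R: "finite R" "\<And>\<rho>. \<rho> \<in> R \<Longrightarrow> \<rho> > \<kappa>"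
  defines "I \<equiv> \<lambda>\<rho>. B \<rho> (x - e1) x"
  shows "(CLINT \<omega>|M. iexp (s * I \<kappa> \<omega> + (\<Sum>\<rho>\<in>R. \<theta> \<rho> * (I \<rho> \<omega> - I \<kappa> \<omega>)))) =
    (CLINT \<omega>|M. iexp (s * I \<kappa> \<omega>)) * (CLINT \<omega>|M. iexp (\<Sum>\<rho>\<in>R. \<theta> \<rho> * (I \<rho> \<omega> - I \<kappa> \<omega>)))"
proof -
  let ?P = "insert \<kappa> R"
  have P: "\<rho> > 1" if "\<rho> \<in> ?P" for \<rho>
    using that \<kappa> R(2) by fastforce
  have \<kappa>R: "\<kappa> \<notin> R" using R(2) by blast
  have I_measurable [measurable]: "I \<rho> \<in> borel_measurable M" if "\<rho> \<in> ?P" for \<rho>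
    unfolding I_def using P[OF that] by (rule B_measurable)
  define g where "g j \<rho> \<omega> = busemann_approx \<rho> j (x - e1) x (\<lambda>z. Y z \<omega>)" for j \<rho> \<omega>
  have g_measurable [measurable]: "g j \<rho> \<in> borel_measurable M" for j \<rho>
    unfolding g_def by (intro busemann_approx_measurable) simp
  have g_lim: "AE \<omega> in M. (\<lambda>j. g j \<rho> \<omega>) \<longlonglongrightarrow> I \<rho> \<omega>" if "\<rho> \<in> ?P" for \<rho>
    using AE_busemann_approx_tendsto[OF P[OF that]] unfolding g_def I_def by eventually_elim blast
  \<comment> \<open>The j-th window contains all sites read by the j-th approximations, for all
    parameters simultaneously. The bound has to be strict since the lowest row of the window is
    \<open>snd x - int (N j) + 1\<close>.\<close>
  define N where "N j = nat (Max ((\<lambda>\<rho>. \<bar>fst x - fst (direction_seq \<rho> j)\<bar> +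
    \<bar>snd x - snd (direction_seq \<rho> j)\<bar>) ` ?P)) + 1" for j
  have N: "\<bar>fst x - fst (direction_seq \<rho> j)\<bar> + \<bar>snd x - snd (direction_seq \<rho> j)\<bar> < int (N j)"
    if "\<rho> \<in> ?P" for \<rho> j
  proof -
    have "\<bar>fst x - fst (direction_seq \<rho> j)\<bar> + \<bar>snd x - snd (direction_seq \<rho> j)\<bar> \<le>
        Max ((\<lambda>\<rho>. \<bar>fst x - fst (direction_seq \<rho> j)\<bar> + \<bar>snd x - snd (direction_seq \<rho> j)\<bar>) ` ?P)"
      using R(1) that by (intro Max_ge) auto
    then show ?thesis unfolding N_def by linarith
  qed
  \<comment> \<open>The approximation as a function of the cells. By the choice of N the default 0
    is never read along the relevant paths.\<close>
  define G where "G j \<rho> v = busemann_approx \<rho> j (x - e1) x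
    (\<lambda>z. if z \<in> window_sites x (N j) (N j) then v (cell_of x (N j) (N j) z) else 0)" for j \<rho> v
  have cell_in: "cell_of x m n z \<in> cell_slots (Suc m) n" if "z \<in> window_sites x m n" for z m n
    using bij_betwE[OF bij_betw_cell_of] that by blast
  define c where "c j = window_config Y B x (N j) (N j)" for j
  have G_c: "G j \<rho> (c j \<omega>) = g j \<rho> \<omega>" if "\<rho> \<in> ?P" for j \<rho> \<omega>
    unfolding G_def g_def c_def
  proof (rule busemann_approx_cong)
    fix z assume z: "z \<in> below (x - e1) \<union> below x" "fst (direction_seq \<rho> j) \<le> fst z"
      "snd (direction_seq \<rho> j) \<le> snd z"
    then have "z \<in> window_sites x (N j) (N j)"
      using N[OF that, of j] by (cases z) (auto simp: window_sites_def below_def e1_def)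
    then show "(if z \<in> window_sites x (N j) (N j)
        then window_config Y B x (N j) (N j) \<omega> (cell_of x (N j) (N j) z) else 0) = Y z \<omega>"
      by (simp add: window_config_cell_of)
  qed
  define W where "W j = slot_law \<kappa> (window_slots \<kappa> R (Suc (N j)) (N j))" for j
  define val where "val j = window_value \<kappa> (N j) (N j)" for j
  have estimate: "norm ((CLINT \<omega>|M. iexp (\<Sum>\<rho>\<in>?P. \<theta> \<rho> * g j \<rho> \<omega>)) -
      (CLINT w|W j. iexp (\<Sum>\<rho>\<in>?P. \<theta> \<rho> * val j \<rho> w)))
    \<le> (\<Sum>\<rho>\<in>?P. \<integral>\<omega>. min 2 \<bar>\<theta> \<rho> * (g j \<rho> \<omega> - I \<rho> \<omega>)\<bar> \<partial>M)" for \<theta> :: "real \<Rightarrow> real" and j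
  proof -
    have "norm ((CLINT \<omega>|M. iexp (\<Sum>\<rho>\<in>?P. \<theta> \<rho> * G j \<rho> (c j \<omega>))) -
        (CLINT w|W j. iexp (\<Sum>\<rho>\<in>?P. \<theta> \<rho> * val j \<rho> w)))
      \<le> (\<Sum>\<rho>\<in>?P. \<integral>\<omega>. min 2 \<bar>\<theta> \<rho> * (G j \<rho> (c j \<omega>) - I \<rho> \<omega>)\<bar> \<partial>M)"
      unfolding W_def val_def
    proof (rule window_estimate[where \<eta> = "\<lambda>\<rho> \<omega>. restrict (c j \<omega>) (line_slots \<rho> (Suc (N j)) (N j))"])
      fix \<rho> assume \<rho>: "\<rho> \<in> ?P"
      show "(\<lambda>\<omega>. restrict (c j \<omega>) (line_slots \<rho> (Suc (N j)) (N j)))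
          \<in> measurable M (slot_algebra (line_slots \<rho> (Suc (N j)) (N j)))"
        unfolding c_def using P[OF \<rho>] by (intro measurable_restrict window_config_measurable)
      show "distr M (slot_algebra (line_slots \<rho> (Suc (N j)) (N j)))
          (\<lambda>\<omega>. restrict (c j \<omega>) (line_slots \<rho> (Suc (N j)) (N j))) =
          slot_law \<kappa> (line_slots \<rho> (Suc (N j)) (N j))"
        unfolding c_def using P[OF \<rho>] \<kappa> by (rule distr_window_config)
      show "AE \<omega> in M. I \<rho> \<omega> = exchanges (sweep \<rho> (Suc (N j)) (N j))
          (restrict (c j \<omega>) (line_slots \<rho> (Suc (N j)) (N j))) (Hor \<rho> (N j))"
        unfolding c_def I_def using P[OF \<rho>] by (rule AE_sweep_window_config)
      show "G j \<rho> \<in> borel_measurable (slot_algebra (cell_slots (Suc (N j)) (N j)))"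
      proof -
        have "(\<lambda>v. if z \<in> window_sites x (N j) (N j) then v (cell_of x (N j) (N j) z) else 0)
            \<in> borel_measurable (slot_algebra (cell_slots (Suc (N j)) (N j)))" for z
          using cell_in[of z] by (cases "z \<in> window_sites x (N j) (N j)") simp_all
        then show ?thesis
          unfolding G_def by (rule busemann_approx_measurable)
      qed
      fix v v' :: "slot \<Rightarrow> real"
      assume eq: "\<And>k t. k \<le> N j \<Longrightarrow> t < N j \<Longrightarrow> v (Cell k t) = v' (Cell k t)"
      have "v s = v' s" if "s \<in> cell_slots (Suc (N j)) (N j)" for s
        using that eq by (auto simp: cell_slots_def)
      then have "(\<lambda>z. if z \<in> window_sites x (N j) (N j) then v (cell_of x (N j) (N j) z) else 0) =
          (\<lambda>z. if z \<in> window_sites x (N j) (N j) then v' (cell_of x (N j) (N j) z) else 0)"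
        using cell_in by auto
      then show "G j \<rho> v = G j \<rho> v'"
        unfolding G_def by (rule arg_cong)
    qed (use \<kappa> R I_measurable prob_space_axioms in auto)
    moreover have "(\<Sum>\<rho>\<in>?P. \<theta> \<rho> * G j \<rho> (c j \<omega>)) = (\<Sum>\<rho>\<in>?P. \<theta> \<rho> * g j \<rho> \<omega>)" for \<omega>
      using G_c by (intro sum.cong) auto
    moreover have "(\<Sum>\<rho>\<in>?P. \<integral>\<omega>. min 2 \<bar>\<theta> \<rho> * (G j \<rho> (c j \<omega>) - I \<rho> \<omega>)\<bar> \<partial>M) =
        (\<Sum>\<rho>\<in>?P. \<integral>\<omega>. min 2 \<bar>\<theta> \<rho> * (g j \<rho> \<omega> - I \<rho> \<omega>)\<bar> \<partial>M)"
      using G_c by (intro sum.cong) auto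
    ultimately show ?thesis by (simp only:)
  qed
  have lim: "(\<lambda>j. CLINT w|W j. iexp (\<Sum>\<rho>\<in>?P. \<theta> \<rho> * val j \<rho> w)) \<longlonglongrightarrow>
      (CLINT \<omega>|M. iexp (\<Sum>\<rho>\<in>?P. \<theta> \<rho> * I \<rho> \<omega>))" for \<theta> :: "real \<Rightarrow> real"
  proof -
    have "(\<lambda>j. \<integral>\<omega>. min 2 \<bar>\<theta> \<rho> * (g j \<rho> \<omega> - I \<rho> \<omega>)\<bar> \<partial>M) \<longlonglongrightarrow> (\<integral>\<omega>. 0 \<partial>M)" if \<rho>: "\<rho> \<in> ?P" for \<rho>
    proof (rule integral_dominated_convergence[where w = "\<lambda>_. 2"])
      show "AE \<omega> in M. (\<lambda>j. min 2 \<bar>\<theta> \<rho> * (g j \<rho> \<omega> - I \<rho> \<omega>)\<bar>) \<longlonglongrightarrow> 0"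
        using g_lim[OF \<rho>]
      proof eventually_elim
        case (elim \<omega>)
        have "(\<lambda>j. min 2 \<bar>\<theta> \<rho> * (g j \<rho> \<omega> - I \<rho> \<omega>)\<bar>) \<longlonglongrightarrow> min 2 \<bar>\<theta> \<rho> * (I \<rho> \<omega> - I \<rho> \<omega>)\<bar>"
          using elim by (intro tendsto_intros)
        then show ?case by simp
      qed
    qed (use \<rho> in auto)
    then have "(\<lambda>j. \<Sum>\<rho>\<in>?P. \<integral>\<omega>. min 2 \<bar>\<theta> \<rho> * (g j \<rho> \<omega> - I \<rho> \<omega>)\<bar> \<partial>M) \<longlonglongrightarrow> (\<Sum>\<rho>\<in>?P. \<integral>\<omega>. 0 \<partial>M)"
      by (intro tendsto_sum)
    then have "(\<lambda>j. \<Sum>\<rho>\<in>?P. \<integral>\<omega>. min 2 \<bar>\<theta> \<rho> * (g j \<rho> \<omega> - I \<rho> \<omega>)\<bar> \<partial>M) \<longlonglongrightarrow> 0"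
      by simp
    then have "(\<lambda>j. (CLINT \<omega>|M. iexp (\<Sum>\<rho>\<in>?P. \<theta> \<rho> * g j \<rho> \<omega>)) -
        (CLINT w|W j. iexp (\<Sum>\<rho>\<in>?P. \<theta> \<rho> * val j \<rho> w))) \<longlonglongrightarrow> 0"
      by (rule Lim_null_comparison[rotated]) (use estimate in \<open>auto intro!: always_eventually\<close>)
    moreover have "(\<lambda>j. CLINT \<omega>|M. iexp (\<Sum>\<rho>\<in>?P. \<theta> \<rho> * g j \<rho> \<omega>)) \<longlonglongrightarrow>
        (CLINT \<omega>|M. iexp (\<Sum>\<rho>\<in>?P. \<theta> \<rho> * I \<rho> \<omega>))"
    proof (rule integral_dominated_convergence[where w = "\<lambda>_. 1"])
      have "AE \<omega> in M. \<forall>\<rho>\<in>?P. (\<lambda>j. g j \<rho> \<omega>) \<longlonglongrightarrow> I \<rho> \<omega>"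
        using R(1) g_lim by (intro AE_finite_allI) auto
      then show "AE \<omega> in M. (\<lambda>j. iexp (\<Sum>\<rho>\<in>?P. \<theta> \<rho> * g j \<rho> \<omega>)) \<longlonglongrightarrow> iexp (\<Sum>\<rho>\<in>?P. \<theta> \<rho> * I \<rho> \<omega>)"
        by eventually_elim (intro tendsto_intros, auto)
    qed auto
    ultimately show ?thesis
      using tendsto_diff[of _ _ sequentially _ 0] by fastforce
  qed
  \<comment> \<open>Coefficients for the full form, for the value at \<kappa> alone (increments
    weighted 0) and for the increments alone (s = 0). The limit applies to each of them.\<close>
  define \<theta>1 \<theta>2 \<theta>3 where "\<theta>1 = \<theta>(\<kappa> := s - (\<Sum>\<rho>\<in>R. \<theta> \<rho>))"
    and "\<theta>2 = (\<lambda>_. 0)(\<kappa> := s - (\<Sum>\<rho>\<in>R. 0))" and "\<theta>3 = \<theta>(\<kappa> := 0 - (\<Sum>\<rho>\<in>R. \<theta> \<rho>))"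
  have coeff: "(\<Sum>\<rho>\<in>?P. \<theta>1 \<rho> * f \<rho>) = s * f \<kappa> + (\<Sum>\<rho>\<in>R. \<theta> \<rho> * (f \<rho> - f \<kappa>))"
    "(\<Sum>\<rho>\<in>?P. \<theta>2 \<rho> * f \<rho>) = s * f \<kappa>"
    "(\<Sum>\<rho>\<in>?P. \<theta>3 \<rho> * f \<rho>) = (\<Sum>\<rho>\<in>R. \<theta> \<rho> * (f \<rho> - f \<kappa>))" for f :: "real \<Rightarrow> real"
    unfolding \<theta>1_def \<theta>2_def \<theta>3_def sum_insert_split_coeff[OF R(1) \<kappa>R] by simp_all
  have "(CLINT w|W j. iexp (\<Sum>\<rho>\<in>?P. \<theta>1 \<rho> * val j \<rho> w)) =
      (CLINT w|W j. iexp (\<Sum>\<rho>\<in>?P. \<theta>2 \<rho> * val j \<rho> w)) * (CLINT w|W j. iexp (\<Sum>\<rho>\<in>?P. \<theta>3 \<rho> * val j \<rho> w))" for j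
    unfolding coeff W_def val_def using \<kappa> R by (rule window_factor)
  then have "(\<lambda>j. CLINT w|W j. iexp (\<Sum>\<rho>\<in>?P. \<theta>1 \<rho> * val j \<rho> w)) \<longlonglongrightarrow>
      (CLINT \<omega>|M. iexp (\<Sum>\<rho>\<in>?P. \<theta>2 \<rho> * I \<rho> \<omega>)) * (CLINT \<omega>|M. iexp (\<Sum>\<rho>\<in>?P. \<theta>3 \<rho> * I \<rho> \<omega>))"
    using tendsto_mult[OF lim lim] by (simp only:)
  from LIMSEQ_unique[OF lim this] show ?thesis
    unfolding coeff .
qed

end


section \<open>The exponential characteristic function\<close>

lemma iexp_exp_law_integral:
  assumes r: "r > 0"
  shows "(CLINT z|exp_law r. iexp (u * z)) = 1 / (1 - \<i> * of_real (u / r))"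
proof -
  interpret prob_space "exp_law r" by (rule prob_space_exponential_density) fact
  define a where "a = of_real r - \<i> * of_real u"
  have a: "a \<noteq> 0" using r by (auto simp: a_def complex_eq_iff)
  define f where "f z = of_real r * exp (- a * of_real z)" for z :: real
  \<comment> \<open>An antiderivative of f that vanishes at infinity, because a has real part r > 0.
    The integral is therefore r / a.\<close>
  define F where "F z = - (of_real r / a) * exp (- a * of_real z)" for z :: real
  have f_eq: "indicator {0..} z *\<^sub>R f z = exponential_density r z *\<^sub>R iexp (u * z)" for z
    by (auto simp: f_def a_def exponential_density_def indicator_def scaleR_conv_of_real
        exp_of_real[symmetric] exp_add[symmetric] algebra_simps simp del: exp_of_real)
  have "integrable (exp_law r) (\<lambda>z. iexp (u * z))"
    by (intro integrable_const_bound[where B = 1]) auto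
  then have int: "integrable lborel (\<lambda>z. indicator {0..} z *\<^sub>R f z)"
    using r by (subst (asm) integrable_density) (auto simp: f_eq exponential_density_nonneg)
  have int': "set_integrable lborel (einterval 0 \<infinity>) f"
    unfolding set_integrable_def
  proof (rule integrable_cong_AE[THEN iffD1, OF _ _ _ int])
    show "AE z in lborel. indicator {0..} z *\<^sub>R f z = indicator (einterval 0 \<infinity>) z *\<^sub>R f z"
      using AE_lborel_singleton[of 0] by eventually_elim (auto simp: indicator_def einterval_def zero_ereal_def)
  qed (auto simp: f_def)
  have "(LBINT z=0..\<infinity>. f z) = 0 - F 0"
  proof (rule interval_integral_FTC_integrable)
    show "(F has_vector_derivative f z) (at z)" for z
      unfolding F_def f_def using a
      by (auto intro!: derivative_eq_intros has_vector_derivative_real_field simp: field_simps)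
    show "isCont f z" for z
      unfolding f_def by (intro continuous_intros)
    show "((F \<circ> real_of_ereal) \<longlongrightarrow> F 0) (at_right 0)"
    proof -
      have "(F \<longlongrightarrow> F 0) (at_right 0)"
        unfolding F_def by (intro tendsto_intros)
      then show ?thesis
        by (simp add: zero_ereal_def ereal_tendsto_simps1)
    qed
    show "((F \<circ> real_of_ereal) \<longlongrightarrow> 0) (at_left \<infinity>)"
    proof -
      have "((\<lambda>z. norm (of_real r / a) * exp (- r * z)) \<longlongrightarrow> 0) at_top"
      proof -
        have "((\<lambda>z. exp (- r * z)) \<longlongrightarrow> 0) at_top"
          using r by real_asymp
        then show ?thesis
          by (rule tendsto_mult_right_zero)
      qed
      moreover have "norm (F z) = norm (of_real r / a) * exp (- r * z)" for z
      proof -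
        have "Re (- a * of_real z) = - r * z" by (simp add: a_def)
        then show ?thesis
          by (simp only: F_def norm_mult norm_minus_cancel norm_exp_eq_Re)
      qed
      ultimately have "(F \<longlongrightarrow> 0) at_top"
        by (intro Lim_null_comparison[where f = F]) auto
      then show ?thesis
        by (simp add: ereal_tendsto_simps1)
    qed
  qed (use int' in auto)
  also have "(LBINT z=0..\<infinity>. f z) = (\<integral>z. indicator (einterval 0 \<infinity>) z *\<^sub>R f z \<partial>lborel)"
    by (simp add: interval_lebesgue_integral_def set_lebesgue_integral_def)
  also have "\<dots> = (\<integral>z. indicator {0..} z *\<^sub>R f z \<partial>lborel)"
  proof (rule integral_cong_AE)
    show "AE z in lborel. indicator (einterval 0 \<infinity>) z *\<^sub>R f z = indicator {0..} z *\<^sub>R f z"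
      using AE_lborel_singleton[of 0] by eventually_elim (auto simp: indicator_def einterval_def zero_ereal_def)
  qed (auto simp: f_def)
  also have "\<dots> = (CLINT z|exp_law r. iexp (u * z))"
    using r by (subst integral_density) (auto simp: f_eq exponential_density_nonneg)
  finally have "(CLINT z|exp_law r. iexp (u * z)) = of_real r / a"
    by (simp add: F_def)
  also have "\<dots> = 1 / (1 - \<i> * of_real (u / r))"
    using r a by (simp add: a_def field_simps)
  finally show ?thesis .
qed

definition exp_cf :: "real \<Rightarrow> complex" where
  "exp_cf u = 1 / (1 - \<i> * of_real u)"

lemma exp_cf_denom: "1 - \<i> * of_real u \<noteq> 0"
  by (simp add: complex_eq_iff)

lemma exp_cf_nonzero: "exp_cf u \<noteq> 0"
  using exp_cf_denom by (simp add: exp_cf_def)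

lemma exp_cf_0 [simp]: "exp_cf 0 = 1"
  by (simp add: exp_cf_def)

lemma norm_exp_cf_le: "norm (exp_cf u) \<le> 1"
proof -
  have "\<bar>Re (1 - \<i> * of_real u)\<bar> \<le> norm (1 - \<i> * of_real u)"
    by (rule abs_Re_le_cmod)
  then show ?thesis
    by (simp add: exp_cf_def norm_divide divide_le_eq_1)
qed

section \<open>The recursion for the Busemann edge\<close>

context busemann_process
begin

lemma edge_measurable:
  assumes "\<rho> \<ge> 1"
  shows "busemann_edge Y B x \<rho> \<in> borel_measurable M"
  using assms B_measurable[of \<rho>] unfolding busemann_edge_def by (cases "\<rho> = 1") auto

lemma edge_cf:
  assumes "\<rho> \<ge> 1"
  shows "(CLINT \<omega>|M. iexp (s * busemann_edge Y B x \<rho> \<omega>)) = exp_cf (\<rho> * s)"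
proof -
  note [measurable] = edge_measurable[OF assms]
  have law: "distributed M lborel (busemann_edge Y B x \<rho>) (exponential_density (1 / \<rho>))"
    using assms Y_exponential horizontal_exponential[of \<rho>] by (cases "\<rho> = 1") (auto simp: busemann_edge_def[abs_def])
  have "(CLINT \<omega>|M. iexp (s * busemann_edge Y B x \<rho> \<omega>)) =
      (CLINT z|distr M lborel (busemann_edge Y B x \<rho>). iexp (s * z))"
    by (subst integral_distr) auto
  also have "\<dots> = exp_cf (\<rho> * s)"
    unfolding distributed_distr_eq_density[OF law] using assms
    by (subst iexp_exp_law_integral) (auto simp: exp_cf_def mult.commute)
  finally show ?thesis .
qed

text \<open>The counterpart of \<open>busemann_factor\<close> at the parameter 1. By the recursion,
  the increment over Y x is the positive part of a difference of two Busemann increments that end at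
  x - e2 and x - e1, and these read only weights other than the one at x.\<close>

lemma weight_factor:
  fixes \<theta> :: "real \<Rightarrow> real" and x :: site
  assumes R: "finite R" "\<And>\<rho>. \<rho> \<in> R \<Longrightarrow> \<rho> > 1"
  defines "I \<equiv> \<lambda>\<rho>. B \<rho> (x - e1) x"
  shows "(CLINT \<omega>|M. iexp (s * Y x \<omega> + (\<Sum>\<rho>\<in>R. \<theta> \<rho> * (I \<rho> \<omega> - Y x \<omega>)))) =
    (CLINT \<omega>|M. iexp (s * Y x \<omega>)) * (CLINT \<omega>|M. iexp (\<Sum>\<rho>\<in>R. \<theta> \<rho> * (I \<rho> \<omega> - Y x \<omega>)))"
proof -
  define V where "V = - {x}"
  let ?YV = "\<lambda>\<omega>. restrict (\<lambda>z. Y z \<omega>) V" and ?Yx = "\<lambda>\<omega>. restrict (\<lambda>z. Y z \<omega>) {x}"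
  define l where "l \<rho> u v w = lim (\<lambda>n. busemann_approx \<rho> n u v w)" for \<rho> u v w
  define D where "D \<rho> w = max 0 (l \<rho> (x - e2 - e1) (x - e2) w - l \<rho> (x - e1 - e2) (x - e1) w)" for \<rho> w
  have V: "below (x - e2 - e1) \<union> below (x - e2) \<subseteq> V" "below (x - e1 - e2) \<union> below (x - e1) \<subseteq> V"
    by (auto simp: V_def below_def e1_def e2_def)
  have [measurable]: "D \<rho> \<in> borel_measurable (\<Pi>\<^sub>M z\<in>V. borel)" for \<rho>
    unfolding D_def l_def using V by (intro borel_measurable_max borel_measurable_diff
        lim_busemann_approx_measurable borel_measurable_const)
  have [measurable]: "I \<rho> \<in> borel_measurable M" if "\<rho> \<in> R" for \<rho>
    unfolding I_def using R(2)[OF that] by (rule B_measurable)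
  have [measurable]: "?YV \<in> measurable M (\<Pi>\<^sub>M z\<in>V. borel)"
    by (intro measurable_restrict Y_measurable)
  have "AE \<omega> in M. I \<rho> \<omega> - Y x \<omega> = D \<rho> (?YV \<omega>)" if "\<rho> \<in> R" for \<rho>
    using AE_B_recursion AE_B_eq_lim[OF R(2)[OF that] V(1)] AE_B_eq_lim[OF R(2)[OF that] V(2)]
  proof eventually_elim
    case (elim \<omega>)
    have "B \<rho> (x - e1) x \<omega> = Y x \<omega> +
        max 0 (B \<rho> (x - e2 - e1) (x - e2) \<omega> - B \<rho> (x - e1 - e2) (x - e1) \<omega>)"
      using elim(1) R(2)[OF that] by blast
    with elim(2,3) show ?case
      by (simp add: I_def D_def l_def)
  qed
  then have "AE \<omega> in M. \<forall>\<rho>\<in>R. I \<rho> \<omega> - Y x \<omega> = D \<rho> (?YV \<omega>)"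
    using R(1) by (intro AE_finite_allI)
  then have AE_sum: "AE \<omega> in M. (\<Sum>\<rho>\<in>R. \<theta> \<rho> * (I \<rho> \<omega> - Y x \<omega>)) = (\<Sum>\<rho>\<in>R. \<theta> \<rho> * D \<rho> (?YV \<omega>))"
    by eventually_elim simp
  have "indep_var (\<Pi>\<^sub>M z\<in>{x}. borel) ?Yx (\<Pi>\<^sub>M z\<in>V. borel) ?YV"
    using Y_indep by (rule indep_var_restrict) (auto simp: V_def)
  then have "indep_var borel ((\<lambda>v. iexp (s * v x)) \<circ> ?Yx) borel ((\<lambda>w. iexp (\<Sum>\<rho>\<in>R. \<theta> \<rho> * D \<rho> w)) \<circ> ?YV)"
    by (rule indep_var_compose) measurable
  then have "(CLINT \<omega>|M. iexp (s * Y x \<omega>) * iexp (\<Sum>\<rho>\<in>R. \<theta> \<rho> * D \<rho> (?YV \<omega>))) =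
      (CLINT \<omega>|M. iexp (s * Y x \<omega>)) * (CLINT \<omega>|M. iexp (\<Sum>\<rho>\<in>R. \<theta> \<rho> * D \<rho> (?YV \<omega>)))"
    by (subst indep_var_lebesgue_integral[symmetric])
      (auto simp: comp_def intro!: integrable_const_bound[where B = 1])
  moreover have "(CLINT \<omega>|M. iexp (s * Y x \<omega>) * iexp (\<Sum>\<rho>\<in>R. \<theta> \<rho> * D \<rho> (?YV \<omega>))) =
      (CLINT \<omega>|M. iexp (s * Y x \<omega> + (\<Sum>\<rho>\<in>R. \<theta> \<rho> * (I \<rho> \<omega> - Y x \<omega>))))"
  proof (rule integral_cong_AE)
    show "AE \<omega> in M. iexp (s * Y x \<omega>) * iexp (\<Sum>\<rho>\<in>R. \<theta> \<rho> * D \<rho> (?YV \<omega>)) =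
        iexp (s * Y x \<omega> + (\<Sum>\<rho>\<in>R. \<theta> \<rho> * (I \<rho> \<omega> - Y x \<omega>)))"
      using AE_sum by eventually_elim (simp only: of_real_add distrib_left exp_add)
  qed measurable
  moreover have "(CLINT \<omega>|M. iexp (\<Sum>\<rho>\<in>R. \<theta> \<rho> * D \<rho> (?YV \<omega>))) =
      (CLINT \<omega>|M. iexp (\<Sum>\<rho>\<in>R. \<theta> \<rho> * (I \<rho> \<omega> - Y x \<omega>)))"
  proof (rule integral_cong_AE)
    show "AE \<omega> in M. iexp (\<Sum>\<rho>\<in>R. \<theta> \<rho> * D \<rho> (?YV \<omega>)) = iexp (\<Sum>\<rho>\<in>R. \<theta> \<rho> * (I \<rho> \<omega> - Y x \<omega>))"
      using AE_sum by eventually_elim (simp only:)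
  qed measurable
  ultimately show ?thesis by simp
qed

lemma edge_factor:
  fixes \<theta> :: "real \<Rightarrow> real" and x :: site
  assumes \<kappa>: "\<kappa> \<ge> 1" and R: "finite R" "\<And>\<rho>. \<rho> \<in> R \<Longrightarrow> \<rho> > \<kappa>"
  defines "I \<equiv> busemann_edge Y B x"
  shows "(CLINT \<omega>|M. iexp (s * I \<kappa> \<omega> + (\<Sum>\<rho>\<in>R. \<theta> \<rho> * (I \<rho> \<omega> - I \<kappa> \<omega>)))) =
    (CLINT \<omega>|M. iexp (s * I \<kappa> \<omega>)) * (CLINT \<omega>|M. iexp (\<Sum>\<rho>\<in>R. \<theta> \<rho> * (I \<rho> \<omega> - I \<kappa> \<omega>)))"
proof -
  have I: "I \<rho> = B \<rho> (x - e1) x" if "\<rho> \<in> R" for \<rho>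
    using R(2)[OF that] \<kappa> by (auto simp: I_def busemann_edge_def)
  have sum: "(\<Sum>\<rho>\<in>R. \<theta> \<rho> * (I \<rho> \<omega> - y)) = (\<Sum>\<rho>\<in>R. \<theta> \<rho> * (B \<rho> (x - e1) x \<omega> - y))" for y \<omega>
    using I by (intro sum.cong) auto
  show ?thesis
  proof (cases "\<kappa> = 1")
    case True
    then have "I \<kappa> = Y x" by (auto simp: I_def busemann_edge_def)
    then show ?thesis
      unfolding sum using True R by (simp only: weight_factor)
  next
    case False
    then have "I \<kappa> = B \<kappa> (x - e1) x" by (auto simp: I_def busemann_edge_def)
    moreover have "\<kappa> > 1" using False \<kappa> by simp
    from busemann_factor[OF this R] have "(CLINT \<omega>|M. iexp (s * B \<kappa> (x - e1) x \<omega> +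
          (\<Sum>\<rho>\<in>R. \<theta> \<rho> * (B \<rho> (x - e1) x \<omega> - B \<kappa> (x - e1) x \<omega>)))) =
        (CLINT \<omega>|M. iexp (s * B \<kappa> (x - e1) x \<omega>)) *
        (CLINT \<omega>|M. iexp (\<Sum>\<rho>\<in>R. \<theta> \<rho> * (B \<rho> (x - e1) x \<omega> - B \<kappa> (x - e1) x \<omega>)))" .
    ultimately show ?thesis
      unfolding sum by (simp only:)
  qed
qed

text \<open>Both characteristic functions have the form \<open>exp_cf (\<kappa> * s)\<close> times
  the same factor, the unknown characteristic function of the increments over \<kappa>; only s
  differs. Cross-multiplying removes the need to know or to divide by that factor.\<close>

lemma edge_cf_insert:
  fixes \<theta> :: "real \<Rightarrow> real" and x :: site
  assumes \<kappa>: "\<kappa> \<ge> 1" and R: "finite R" "\<And>\<rho>. \<rho> \<in> R \<Longrightarrow> \<rho> > \<kappa>"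
  defines "I \<equiv> busemann_edge Y B x"
  shows "(CLINT \<omega>|M. iexp (\<Sum>\<rho>\<in>insert \<kappa> R. \<theta> \<rho> * I \<rho> \<omega>)) * exp_cf (\<kappa> * sum \<theta> R) =
    exp_cf (\<kappa> * sum \<theta> (insert \<kappa> R)) * (CLINT \<omega>|M. iexp (\<Sum>\<rho>\<in>R. \<theta> \<rho> * I \<rho> \<omega>))"
proof -
  let ?K = "CLINT \<omega>|M. iexp (\<Sum>\<rho>\<in>R. \<theta> \<rho> * (I \<rho> \<omega> - I \<kappa> \<omega>))"
  have \<kappa>R: "\<kappa> \<notin> R" using R(2) by blast
  have 1: "(\<Sum>\<rho>\<in>insert \<kappa> R. \<theta> \<rho> * I \<rho> \<omega>) =
      sum \<theta> (insert \<kappa> R) * I \<kappa> \<omega> + (\<Sum>\<rho>\<in>R. \<theta> \<rho> * (I \<rho> \<omega> - I \<kappa> \<omega>))"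
    and 2: "(\<Sum>\<rho>\<in>R. \<theta> \<rho> * I \<rho> \<omega>) = sum \<theta> R * I \<kappa> \<omega> + (\<Sum>\<rho>\<in>R. \<theta> \<rho> * (I \<rho> \<omega> - I \<kappa> \<omega>))" for \<omega>
    using R(1) \<kappa>R by (simp_all add: right_diff_distrib sum_subtractf sum_distrib_right distrib_right)
  have cf: "(CLINT \<omega>|M. iexp (s * I \<kappa> \<omega> + (\<Sum>\<rho>\<in>R. \<theta> \<rho> * (I \<rho> \<omega> - I \<kappa> \<omega>)))) = exp_cf (\<kappa> * s) * ?K" for s
    unfolding I_def by (subst edge_factor[OF \<kappa> R]) (simp_all only: edge_cf[OF \<kappa>])
  show ?thesis
    unfolding 1 2 cf by (simp only: mult_ac)
qed

end


section \<open>Points and weights\<close>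


context
  fixes S :: "real set"
  assumes ge1: "S \<subseteq> {1..}" and fin: "\<And>r. finite (S \<inter> {1..r})"
begin

lemma finite_points_less: "finite (S \<inter> {..<t})"
  by (rule finite_subset[OF _ fin[of t]]) (use ge1 in auto)

lemma card_points_less_mono:
  assumes "s \<in> S" "s < t"
  shows "card (S \<inter> {..<s}) < card (S \<inter> {..<t})"
  using assms finite_points_less by (intro psubset_card_mono) auto

lemma nth_point_card:
  assumes "t \<in> S"
  shows "nth_point S (card (S \<inter> {..<t})) = t"
  unfolding nth_point_def
proof (rule the_equality)
  fix s assume "s \<in> S \<and> card (S \<inter> {..<s}) = card (S \<inter> {..<t})"
  then show "s = t"
    using assms card_points_less_mono[of s t] card_points_less_mono[of t s]
    by (cases s t rule: linorder_cases) auto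
qed (use assms in simp)

text \<open>The map that counts the points below t is injective with values under the total count,
  hence onto by cardinality, and \<open>nth_point\<close> is its inverse.\<close>

lemma bij_betw_nth_point:
  "bij_betw (nth_point S) {..<card (S \<inter> {1..r})} (S \<inter> {1..r})"
proof -
  let ?A = "S \<inter> {1..r}" and ?f = "\<lambda>t. card (S \<inter> {..<t})"
  have inj: "inj_on ?f ?A"
    by (rule inj_on_inverseI[of _ "nth_point S"]) (simp add: nth_point_card)
  have "?f t < card ?A" if "t \<in> ?A" for t
    using that ge1 fin by (intro psubset_card_mono) auto
  then have "?f ` ?A = {..<card ?A}"
    using inj by (intro card_seteq) (auto simp: card_image)
  then have "nth_point S ` {..<card ?A} = (\<lambda>t. nth_point S (?f t)) ` ?A"
    by (metis image_image)
  also have "\<dots> = (\<lambda>t. t) ` ?A"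
    by (intro image_cong) (simp_all add: nth_point_card)
  finally have "nth_point S ` {..<card ?A} = ?A" by simp
  then show ?thesis
    unfolding bij_betw_def using eq_card_imp_inj_on[of "{..<card ?A}" "nth_point S"] by simp
qed

text \<open>Expresses the position of a point through counts of intervals, which makes it measurable
  for the algebra generated by the counts. The bound r only certifies that there are more than i
  points.\<close>

lemma nth_point_le_iff:
  assumes "i < card (S \<inter> {1..r})"
  shows "nth_point S i \<le> a \<longleftrightarrow> i < card (S \<inter> {1..a})"
proof
  assume "i < card (S \<inter> {1..a})"
  then show "nth_point S i \<le> a"
    using bij_betwE[OF bij_betw_nth_point[of a]] by auto
next
  assume a: "nth_point S i \<le> a"
  show "i < card (S \<inter> {1..a})"
  proof (rule ccontr)
    assume "\<not> ?thesis"
    then have ia: "card (S \<inter> {1..a}) \<le> i" by simp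
    have "nth_point S i \<in> S \<inter> {1..a}"
      using bij_betwE[OF bij_betw_nth_point[of r]] assms a by auto
    then obtain j where j: "j < card (S \<inter> {1..a})" "nth_point S i = nth_point S j"
      using bij_betw_imp_surj_on[OF bij_betw_nth_point[of a]] by (metis imageE lessThan_iff)
    have "i = j"
      using bij_betw_imp_inj_on[OF bij_betw_nth_point[of r]] j(2)
      by (rule inj_onD) (use assms ia j(1) in auto)
    with ia j(1) show False by simp
  qed
qed

end

lemma emeasure_exp_law_scale:
  assumes "t > 0" "C \<in> sets borel"
  shows "emeasure (exp_law 1) {z. t * z \<in> C} = emeasure (exp_law (1 / t)) C"
proof -
  have [measurable]: "C \<in> sets borel" by fact
  have "{z. t * z \<in> C} = (\<lambda>z. t * z) -` C \<inter> space borel" by auto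
  also have "\<dots> \<in> sets borel" by (rule measurable_sets[of _ borel borel]) auto
  finally have [measurable]: "{z. t * z \<in> C} \<in> sets borel" .
  have "emeasure (exp_law (1 / t)) C = (\<integral>\<^sup>+z. ennreal (exponential_density (1 / t) z) * indicator C z \<partial>lborel)"
    by (simp add: emeasure_density)
  also have "\<dots> = ennreal t * (\<integral>\<^sup>+z. ennreal (exponential_density (1 / t) (0 + t * z)) * indicator C (0 + t * z) \<partial>lborel)"
    using assms(1) by (subst nn_integral_real_affine[where c = t and t = 0]) auto
  also have "\<dots> = (\<integral>\<^sup>+z. ennreal t * (ennreal (exponential_density (1 / t) (t * z)) * indicator C (t * z)) \<partial>lborel)"
    by (subst nn_integral_cmult) auto
  also have "\<dots> = (\<integral>\<^sup>+z. ennreal (exponential_density 1 z) * indicator {z. t * z \<in> C} z \<partial>lborel)"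
    using assms(1)
    by (intro nn_integral_cong)
      (auto simp: exponential_density_def indicator_def ennreal_mult[symmetric] zero_less_mult_iff mult_less_0_iff)
  also have "\<dots> = emeasure (exp_law 1) {z. t * z \<in> C}"
    by (simp add: emeasure_density)
  finally show ?thesis ..
qed

section \<open>Joint law of points and weights\<close>

context simple_point_process
begin

abbreviation "\<F> \<equiv> point_process_algebra M N"

lemma space_algebra [simp]: "space \<F> = space M"
  unfolding point_process_algebra_def by (intro space_measure_of) auto

lemma sets_algebra: "sets \<F> =
    sigma_sets (space M) {{\<omega> \<in> space M. card (N \<omega> \<inter> A) = k} | A k. A \<in> sets borel \<and> bounded A}"
  unfolding point_process_algebra_def by (intro sets_measure_of) auto

lemma count_measurable_algebra:
  assumes "A \<in> sets borel" "bounded A"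
  shows "(\<lambda>\<omega>. card (N \<omega> \<inter> A)) \<in> measurable \<F> (count_space UNIV)"
proof (subst measurable_count_space_eq2_countable, intro conjI ballI)
  fix k :: nat
  have "(\<lambda>\<omega>. card (N \<omega> \<inter> A)) -` {k} \<inter> space \<F> = {\<omega> \<in> space M. card (N \<omega> \<inter> A) = k}"
    by auto
  also have "\<dots> \<in> sets \<F>"
    unfolding sets_algebra using assms by (intro sigma_sets.Basic) blast
  finally show "(\<lambda>\<omega>. card (N \<omega> \<inter> A)) -` {k} \<inter> space \<F> \<in> sets \<F>" .
qed auto

lemma subalgebra_algebra: "subalgebra M \<F>"
  unfolding subalgebra_def
proof
  show "sets \<F> \<subseteq> sets M"
    unfolding sets_algebra
  proof (rule sets.sigma_sets_subset, safe)
    fix A :: "real set" and k assume "A \<in> sets borel" "bounded A"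
    then have [measurable]: "(\<lambda>\<omega>. card (N \<omega> \<inter> A)) \<in> measurable M (count_space UNIV)"
      by (rule counts_measurable)
    show "{\<omega> \<in> space M. card (N \<omega> \<inter> A) = k} \<in> sets M" by measurable
  qed
qed simp

text \<open>Off the event that \<open>[1, r]\<close> has exactly \<open>n\<close> points all coordinates are 0, so that the law of
  the points and weights can be compared without conditioning on this event.\<close>

definition point_at :: "real \<Rightarrow> nat \<Rightarrow> nat \<Rightarrow> 'a \<Rightarrow> real" where
  "point_at r n i \<omega> = (if card (N \<omega> \<inter> {1..r}) = n then nth_point (N \<omega>) i else 0)"

lemma point_at_measurable:
  assumes "i < n"
  shows "point_at r n i \<in> borel_measurable \<F>"
proof (rule borel_measurableI_le)
  fix a
  have [measurable]: "(\<lambda>\<omega>. card (N \<omega> \<inter> {1..u})) \<in> measurable \<F> (count_space UNIV)" for u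
    by (rule count_measurable_algebra) auto
  have "{\<omega> \<in> space \<F>. point_at r n i \<omega> \<le> a} =
      {\<omega> \<in> space \<F>. if card (N \<omega> \<inter> {1..r}) = n then i < card (N \<omega> \<inter> {1..a}) else 0 \<le> a}"
    using assms nth_point_le_iff[OF points_ge_1 locally_finite] by (auto simp: point_at_def)
  also have "\<dots> \<in> sets \<F>" by measurable
  finally show "{\<omega> \<in> space \<F>. point_at r n i \<omega> \<le> a} \<in> sets \<F>" .
qed

lemma point_at_ge_1:
  assumes "\<omega> \<in> space M" "card (N \<omega> \<inter> {1..r}) = n" "i < n"
  shows "point_at r n i \<omega> \<ge> 1"
proof -
  have "bij_betw (nth_point (N \<omega>)) {..<n} (N \<omega> \<inter> {1..r})"
    using bij_betw_nth_point[OF points_ge_1[OF assms(1)] locally_finite[OF assms(1)], of r] assms(2) by simp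
  from bij_betwE[OF this] show ?thesis
    using assms by (auto simp: point_at_def)
qed

end


context marked_point_process
begin

definition weight_at :: "real \<Rightarrow> nat \<Rightarrow> nat \<Rightarrow> 'a \<Rightarrow> real" where
  "weight_at r n i \<omega> = (if card (N \<omega> \<inter> {1..r}) = n then Z (nth_point (N \<omega>) i) \<omega> else 0)"

lemma count_measurable [measurable]:
  "(\<lambda>\<omega>. card (N \<omega> \<inter> {1..r})) \<in> measurable M (count_space UNIV)"
  by (rule counts_measurable) auto

lemma weight_at_measurable [measurable]: "weight_at r n i \<in> borel_measurable M"
  using weights_measurable unfolding weight_at_def by measurable

lemma point_at_measurable' [measurable]: "i < n \<Longrightarrow> point_at r n i \<in> borel_measurable M"
  using measurable_from_subalg[OF subalgebra_algebra point_at_measurable] .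

text \<open>Turns the conditional law into an unconditional one: in law the weights are the points
  times independent variables of mean 1. It is checked on rectangles. On the event of exactly n
  points the conditional probability on the left and the section probability on the right are the
  same product of exponential probabilities; off this event both sides sit at the zero
  vector.\<close>

lemma joint_law:
  fixes r :: real and n :: nat
  defines "I \<equiv> {..<n} <+> {..<n}" and "Q \<equiv> PiM {..<n} (\<lambda>_. exp_law 1)"
  shows "distr M (PiM I (\<lambda>_. borel))
      (\<lambda>\<omega>. restrict (case_sum (\<lambda>i. point_at r n i \<omega>) (\<lambda>i. weight_at r n i \<omega>)) I) =
    distr (M \<Otimes>\<^sub>M Q) (PiM I (\<lambda>_. borel))
      (\<lambda>(\<omega>, \<xi>). restrict (case_sum (\<lambda>i. point_at r n i \<omega>) (\<lambda>i. point_at r n i \<omega> * \<xi> i)) I)"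
    (is "distr M ?B ?X = distr _ _ ?X'")
proof -
  interpret QQ: product_prob_space "\<lambda>_ :: nat. exp_law 1" "{..<n}"
    by (intro product_prob_space_exp_law) simp
  interpret Q: prob_space Q
    unfolding Q_def by (intro prob_space_PiM QQ.M.prob_space_axioms)
  interpret F: finite_measure_subalgebra M "\<F>"
    by unfold_locales (rule subalgebra_algebra)
  have sets_Q[measurable_cong]: "sets Q = sets (PiM {..<n} (\<lambda>_. borel))"
    unfolding Q_def by (intro sets_PiM_cong) auto
  have X[measurable]: "?X \<in> measurable M ?B"
    by (intro measurable_restrict) (auto simp: I_def)
  have X'[measurable]: "?X' \<in> measurable (M \<Otimes>\<^sub>M Q) ?B"
    unfolding case_prod_beta' by (intro measurable_restrict) (auto simp: I_def)
  show ?thesis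
  proof (rule measure_eqI_PiM_finite[where A = "\<lambda>_. space ?B"])
    show "finite I" by (simp add: I_def)
    show "range (\<lambda>_. space ?B) \<subseteq> prod_algebra I (\<lambda>_. borel)"
      using space_in_prod_algebra[of I "\<lambda>_. borel :: real measure"] by (simp add: space_PiM)
    show "emeasure (distr M ?B ?X) (space ?B) \<noteq> \<infinity>"
      by (simp add: emeasure_distr emeasure_eq_measure)
    fix A :: "nat + nat \<Rightarrow> real set" assume A: "\<And>s. s \<in> I \<Longrightarrow> A s \<in> sets borel"
    define D C where "D i = A (Inl i)" and "C i = A (Inr i)" for i
    have D[measurable]: "D i \<in> sets borel" and C[measurable]: "C i \<in> sets borel" if "i < n" for i
      using A that by (auto simp: D_def C_def I_def)
    have rect_iff: "case_sum a b \<in> Pi I A \<longleftrightarrow> (\<forall>i<n. a i \<in> D i \<and> b i \<in> C i)" for a b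
      unfolding Pi_iff I_def D_def C_def Ball_def by auto
    \<comment> \<open>The rectangle is split according to whether there are exactly n points: G is
      the constraint on the positions if there are, and G0 asks that the zero vector lie in the
      rectangle if there are not.\<close>
    define G where "G = {\<omega> \<in> space M. card (N \<omega> \<inter> {1..r}) = n \<and> (\<forall>i<n. point_at r n i \<omega> \<in> D i)}"
    define G0 where "G0 = {\<omega> \<in> space M. card (N \<omega> \<inter> {1..r}) \<noteq> n \<and> (\<forall>i<n. 0 \<in> D i \<and> 0 \<in> C i)}"
    define W where "W = {\<omega> \<in> space M. \<forall>i<n. Z (nth_point (N \<omega>) i) \<omega> \<in> C i}"
    have [measurable]: "(\<lambda>\<omega>. card (N \<omega> \<inter> {1..r})) \<in> measurable \<F> (count_space UNIV)"
      by (rule count_measurable_algebra) auto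
    have GF: "G \<in> sets \<F>"
    proof -
      have "{\<omega> \<in> space \<F>. \<forall>i\<in>{..<n}. point_at r n i \<omega> \<in> D i} \<in> sets \<F>"
        by (rule sets_Collect_finite_rectangle) (auto intro: point_at_measurable)
      moreover have "{\<omega> \<in> space \<F>. card (N \<omega> \<inter> {1..r}) = n} \<in> sets \<F>"
        by measurable
      moreover have "G = {\<omega> \<in> space \<F>. card (N \<omega> \<inter> {1..r}) = n} \<inter>
          {\<omega> \<in> space \<F>. \<forall>i\<in>{..<n}. point_at r n i \<omega> \<in> D i}"
        by (auto simp: G_def)
      ultimately show ?thesis by auto
    qed
    then have [measurable]: "G \<in> sets M"
      using subalgebra_algebra by (auto simp: subalgebra_def)
    have [measurable]: "G0 \<in> sets M"
      unfolding G0_def by measurable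
    have [measurable]: "W \<in> sets M"
    proof -
      have "W = {\<omega> \<in> space M. \<forall>i\<in>{..<n}. Z (nth_point (N \<omega>) i) \<omega> \<in> C i}"
        by (auto simp: W_def)
      also have "\<dots> \<in> sets M"
        by (rule sets_Collect_finite_rectangle) (auto intro: weights_measurable)
      finally show ?thesis .
    qed
    define S where "S = ?X' -` Pi\<^sub>E I A \<inter> space (M \<Otimes>\<^sub>M Q)"
    have rect: "Pi\<^sub>E I A \<in> sets ?B"
      using A by (intro sets_PiM_I_finite) (auto simp: I_def)
    then have S[measurable]: "S \<in> sets (M \<Otimes>\<^sub>M Q)"
      unfolding S_def using X' by (rule measurable_sets[rotated])
    have space_Q: "space Q = (\<Pi>\<^sub>E i\<in>{..<n}. UNIV)"
      by (simp add: Q_def space_PiM)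
    \<comment> \<open>The section of the right-hand side at \<omega>. On G, scaling a variable of
      mean 1 by the i-th point gives the exponential law that the hypothesis on conditional laws
      prescribes.\<close>
    define h where "h \<omega> = emeasure Q (Pair \<omega> -` S)" for \<omega>
    have S_section: "Pair \<omega> -` S = {\<xi> \<in> space Q. \<forall>i<n. point_at r n i \<omega> \<in> D i \<and>
        point_at r n i \<omega> * \<xi> i \<in> C i}" if "\<omega> \<in> space M" for \<omega>
      using that by (auto simp: S_def space_pair_measure rect_iff)
    have h: "h \<omega> = indicator G \<omega> * (\<Prod>i<n. emeasure (exp_law (1 / nth_point (N \<omega>) i)) (C i)) +
        indicator G0 \<omega>" if \<omega>: "\<omega> \<in> space M" for \<omega>
    proof (cases "card (N \<omega> \<inter> {1..r}) = n")
      case True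
      show ?thesis
      proof (cases "\<omega> \<in> G")
        case G: True
        have pos: "nth_point (N \<omega>) i > 0" if "i < n" for i
          using point_at_ge_1[OF \<omega> True that] True by (simp add: point_at_def)
        have C': "{z. nth_point (N \<omega>) i * z \<in> C i} \<in> sets borel" if "i < n" for i
        proof -
          have "(\<lambda>z. nth_point (N \<omega>) i * z) -` C i \<inter> space borel \<in> sets borel"
            by (rule measurable_sets[of _ borel borel]) (use that in auto)
          then show ?thesis by (simp add: vimage_def)
        qed
        have "Pair \<omega> -` S = (\<Pi>\<^sub>E i\<in>{..<n}. {z. nth_point (N \<omega>) i * z \<in> C i})"
        proof -
          have "\<forall>i<n. nth_point (N \<omega>) i \<in> D i"
            using G True by (simp add: G_def point_at_def)
          then show ?thesis
            unfolding S_section[OF \<omega>] using True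
            by (intro set_eqI) (simp add: space_Q point_at_def PiE_iff Ball_def conj_commute)
        qed
        then have "h \<omega> = (\<Prod>i<n. emeasure (exp_law 1) {z. nth_point (N \<omega>) i * z \<in> C i})"
          unfolding h_def Q_def using C' by (simp only:) (subst QQ.emeasure_PiM, auto)
        also have "\<dots> = (\<Prod>i<n. emeasure (exp_law (1 / nth_point (N \<omega>) i)) (C i))"
          using pos by (intro prod.cong emeasure_exp_law_scale) auto
        finally show ?thesis
          using G True by (simp add: G0_def)
      next
        case False
        then have "Pair \<omega> -` S = {}"
          unfolding S_section[OF \<omega>] using \<omega> True by (auto simp: G_def)
        then show ?thesis
          using False True by (simp add: h_def G0_def)
      qed
    next
      case False
      then have "Pair \<omega> -` S = (if \<omega> \<in> G0 then space Q else {})"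
        unfolding S_section[OF \<omega>] using \<omega> by (auto simp: point_at_def G0_def)
      then show ?thesis
        using False by (simp add: h_def G_def Q.emeasure_space_1)
    qed
    have "emeasure (distr M ?B ?X) (Pi\<^sub>E I A) = emeasure M (?X -` Pi\<^sub>E I A \<inter> space M)"
      using rect by (simp add: emeasure_distr)
    also have "?X -` Pi\<^sub>E I A \<inter> space M =
        {\<omega> \<in> space M. \<forall>i<n. point_at r n i \<omega> \<in> D i \<and> weight_at r n i \<omega> \<in> C i}"
      by (auto simp: rect_iff)
    also have "\<dots> = (G \<inter> W) \<union> G0"
    proof (rule set_eqI)
      show "\<omega> \<in> {\<omega> \<in> space M. \<forall>i<n. point_at r n i \<omega> \<in> D i \<and> weight_at r n i \<omega> \<in> C i} \<longleftrightarrow>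
          \<omega> \<in> G \<inter> W \<union> G0" for \<omega>
        by (cases "card (N \<omega> \<inter> {1..r}) = n") (auto simp: G_def W_def G0_def point_at_def weight_at_def)
    qed
    also have "emeasure M \<dots> = emeasure M (G \<inter> W) + emeasure M G0"
      by (rule plus_emeasure[symmetric]) (auto simp: G_def G0_def)
    also have "emeasure M (G \<inter> W) =
        (\<integral>\<^sup>+\<omega>. indicator G \<omega> * (\<Prod>i<n. emeasure (exp_law (1 / nth_point (N \<omega>) i)) (C i)) \<partial>M)"
    proof -
      define g where "g = real_cond_exp M \<F> (indicator W)"
      have AE_g: "AE \<omega> in M. g \<omega> = (\<Prod>i<n. measure (exp_law (1 / nth_point (N \<omega>) i)) (C i))"
        unfolding g_def W_def by (rule weights_cond_indep_exponential) simp
      have intW: "integrable M (indicator W :: 'a \<Rightarrow> real)"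
        by (auto intro!: integrable_real_indicator simp: emeasure_eq_measure)
      have intg: "integrable M g"
        unfolding g_def by (rule F.real_cond_exp_int(1)[OF intW])
      have "emeasure M (G \<inter> W) = ennreal (measure M (G \<inter> W))"
        by (simp add: emeasure_eq_measure)
      also have "measure M (G \<inter> W) = (\<integral>\<omega>\<in>G. indicator W \<omega> \<partial>M)"
        by (simp add: set_lebesgue_integral_def indicator_inter_arith[symmetric])
      also have "\<dots> = (\<integral>\<omega>\<in>G. g \<omega> \<partial>M)"
        unfolding g_def by (rule F.real_cond_exp_intA[OF intW GF])
      also have "ennreal \<dots> = (\<integral>\<^sup>+\<omega>. ennreal (indicator G \<omega> * g \<omega>) \<partial>M)"
        unfolding set_lebesgue_integral_def real_scaleR_def
      proof (rule nn_integral_eq_integral[symmetric])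
        show "integrable M (\<lambda>\<omega>. indicator G \<omega> * g \<omega>)"
          using integrable_mult_indicator[OF _ intg, of G] by simp
        show "AE \<omega> in M. 0 \<le> indicator G \<omega> * g \<omega>"
          using AE_g by eventually_elim (auto intro!: mult_nonneg_nonneg prod_nonneg)
      qed
      also have "\<dots> = (\<integral>\<^sup>+\<omega>. indicator G \<omega> * (\<Prod>i<n. emeasure (exp_law (1 / nth_point (N \<omega>) i)) (C i)) \<partial>M)"
      proof (rule nn_integral_cong_AE)
        show "AE \<omega> in M. ennreal (indicator G \<omega> * g \<omega>) =
            indicator G \<omega> * (\<Prod>i<n. emeasure (exp_law (1 / nth_point (N \<omega>) i)) (C i))"
          using AE_g AE_space
        proof eventually_elim
          case (elim \<omega>)
          show ?case
          proof (cases "\<omega> \<in> G")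
            case True
            then have "nth_point (N \<omega>) i > 0" if "i < n" for i
              using point_at_ge_1[OF elim(2) _ that, of r] by (auto simp: G_def point_at_def)
            then have "emeasure (exp_law (1 / nth_point (N \<omega>) i)) (C i) =
                ennreal (measure (exp_law (1 / nth_point (N \<omega>) i)) (C i))" if "i < n" for i
              using that by (intro finite_measure.emeasure_eq_measure prob_space.finite_measure
                  prob_space_exponential_density) simp
            then show ?thesis
              using True elim(1) by (simp add: prod_ennreal)
          qed simp
        qed
      qed
      finally show ?thesis .
    qed
    also have "\<dots> + emeasure M G0 = (\<integral>\<^sup>+\<omega>. h \<omega> \<partial>M)"
    proof -
      have h_measurable: "h \<in> borel_measurable M"
        unfolding h_def by (rule Q.measurable_emeasure_Pair) (rule S)
      have "(\<integral>\<^sup>+\<omega>. indicator G \<omega> * (\<Prod>i<n. emeasure (exp_law (1 / nth_point (N \<omega>) i)) (C i)) \<partial>M) =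
          (\<integral>\<^sup>+\<omega>. indicator G \<omega> * h \<omega> \<partial>M)"
        by (intro nn_integral_cong) (auto simp: h G_def G0_def indicator_def)
      also have "\<dots> + emeasure M G0 = (\<integral>\<^sup>+\<omega>. indicator G \<omega> * h \<omega> + indicator G0 \<omega> \<partial>M)"
        using h_measurable by (subst nn_integral_add) auto
      also have "\<dots> = (\<integral>\<^sup>+\<omega>. h \<omega> \<partial>M)"
        by (intro nn_integral_cong) (auto simp: h G_def G0_def indicator_def)
      finally show ?thesis .
    qed
    also have "\<dots> = emeasure (M \<Otimes>\<^sub>M Q) S"
      unfolding h_def by (rule Q.emeasure_pair_measure_alt[symmetric]) (rule S)
    also have "\<dots> = emeasure (distr (M \<Otimes>\<^sub>M Q) ?B ?X') (Pi\<^sub>E I A)"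
      unfolding S_def using rect by (simp add: emeasure_distr)
    finally show "emeasure (distr M ?B ?X) (Pi\<^sub>E I A) = emeasure (distr (M \<Otimes>\<^sub>M Q) ?B ?X') (Pi\<^sub>E I A)" .
  qed auto
qed

end


section \<open>Characteristic functions of the jump process\<close>


text \<open>Bounded functions may be integrated separately over the countably many values of K,
  which lets the identities be proved with the number of points fixed.\<close>

lemma (in prob_space) expectation_count_cong:
  fixes f g :: "'a \<Rightarrow> complex"
  assumes [measurable]: "K \<in> measurable M (count_space UNIV)" "f \<in> borel_measurable M" "g \<in> borel_measurable M"
    and bound: "\<And>\<omega>. \<omega> \<in> space M \<Longrightarrow> norm (f \<omega>) \<le> 1" "\<And>\<omega>. \<omega> \<in> space M \<Longrightarrow> norm (g \<omega>) \<le> 1"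
    and eq: "\<And>k :: nat. (CLINT \<omega>:{\<omega> \<in> space M. K \<omega> = k}|M. f \<omega>) = (CLINT \<omega>:{\<omega> \<in> space M. K \<omega> = k}|M. g \<omega>)"
  shows "(CLINT \<omega>|M. f \<omega>) = (CLINT \<omega>|M. g \<omega>)"
proof -
  have *: "(CLINT \<omega>|M. F \<omega>) = (\<Sum>k. CLINT \<omega>:{\<omega> \<in> space M. K \<omega> = k}|M. F \<omega>)"
    if [measurable]: "F \<in> borel_measurable M" and "\<And>\<omega>. \<omega> \<in> space M \<Longrightarrow> norm (F \<omega>) \<le> 1" for F :: "'a \<Rightarrow> complex"
  proof -
    have "integrable M F"
      using that by (intro integrable_const_bound[where B = 1]) auto
    then have "set_integrable M (\<Union>k. {\<omega> \<in> space M. K \<omega> = k}) F"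
      unfolding set_integrable_def by (rule integrable_mult_indicator[rotated]) auto
    then have "(CLINT \<omega>:(\<Union>k. {\<omega> \<in> space M. K \<omega> = k})|M. F \<omega>) = (\<Sum>k. CLINT \<omega>:{\<omega> \<in> space M. K \<omega> = k}|M. F \<omega>)"
      by (intro lebesgue_integral_countable_add) auto
    moreover have "(\<Union>k. {\<omega> \<in> space M. K \<omega> = k}) = space M" by auto
    moreover have "(CLINT \<omega>:space M|M. F \<omega>) = (CLINT \<omega>|M. F \<omega>)"
      unfolding set_lebesgue_integral_def by (intro Bochner_Integration.integral_cong) auto
    ultimately show ?thesis by simp
  qed
  show ?thesis
    using *[of f] *[of g] assms by simp
qed

lemma (in prob_space) poisson_pgf:
  assumes K[measurable]: "K \<in> measurable M (count_space UNIV)"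
    and poisson: "\<And>k :: nat. prob {\<omega> \<in> space M. K \<omega> = k} = \<mu> ^ k / fact k * exp (- \<mu>)"
    and z: "norm (z :: complex) \<le> 1"
  shows "(CLINT \<omega>|M. z ^ K \<omega>) = exp (- (of_real \<mu> * (1 - z)))"
proof -
  let ?E = "\<lambda>k. {\<omega> \<in> space M. K \<omega> = k}"
  have "integrable M (\<lambda>\<omega>. z ^ K \<omega>)"
    using power_le_one[OF norm_ge_zero z] by (intro integrable_const_bound[where B = 1]) (auto simp: norm_power)
  then have "set_integrable M (\<Union>k. ?E k) (\<lambda>\<omega>. z ^ K \<omega>)"
    unfolding set_integrable_def by (rule integrable_mult_indicator[rotated]) auto
  then have "(CLINT \<omega>:(\<Union>k. ?E k)|M. z ^ K \<omega>) = (\<Sum>k. CLINT \<omega>:?E k|M. z ^ K \<omega>)"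
    by (intro lebesgue_integral_countable_add) auto
  moreover have "(CLINT \<omega>:(\<Union>k. ?E k)|M. z ^ K \<omega>) = (CLINT \<omega>|M. z ^ K \<omega>)"
    unfolding set_lebesgue_integral_def by (intro Bochner_Integration.integral_cong) auto
  moreover have "(CLINT \<omega>:?E k|M. z ^ K \<omega>) = of_real (exp (- \<mu>)) * ((of_real \<mu> * z) ^ k /\<^sub>R fact k)" for k
  proof -
    have "(CLINT \<omega>:?E k|M. z ^ K \<omega>) = (CLINT \<omega>:?E k|M. z ^ k)"
      unfolding set_lebesgue_integral_def by (intro Bochner_Integration.integral_cong) (auto simp: indicator_def)
    also have "\<dots> = prob (?E k) *\<^sub>R z ^ k"
      unfolding set_lebesgue_integral_def by (subst integral_scaleR_left) (auto simp: emeasure_eq_measure)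
    also have "\<dots> = of_real (exp (- \<mu>)) * ((of_real \<mu> * z) ^ k /\<^sub>R fact k)"
      unfolding poisson by (simp add: scaleR_conv_of_real power_mult_distrib field_simps)
    finally show ?thesis .
  qed
  moreover have "(\<lambda>k. of_real (exp (- \<mu>)) * ((of_real \<mu> * z) ^ k /\<^sub>R fact k)) sums
      (of_real (exp (- \<mu>)) * exp (of_real \<mu> * z))"
    by (intro sums_mult exp_converges)
  ultimately have "(CLINT \<omega>|M. z ^ K \<omega>) = of_real (exp (- \<mu>)) * exp (of_real \<mu> * z)"
    by (simp add: sums_iff)
  also have "\<dots> = exp (- (of_real \<mu> * (1 - z)))"
    by (simp add: exp_of_real[symmetric] exp_add[symmetric] algebra_simps del: exp_of_real)
  finally show ?thesis .
qed

context marked_point_process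
begin

text \<open>After \<open>joint_law\<close> the variables of mean 1 are integrated first, the points
  being frozen by Fubini. A point t with coefficient c t contributes the factor
  \<open>exp_cf (c t * t)\<close>.\<close>

lemma cf_count:
  assumes [measurable]: "c \<in> borel_measurable borel"
  shows "(CLINT \<omega>|M. \<Prod>i<n. iexp (c (point_at r n i \<omega>) * weight_at r n i \<omega>)) =
    (CLINT \<omega>|M. \<Prod>i<n. exp_cf (c (point_at r n i \<omega>) * point_at r n i \<omega>))"
proof -
  let ?I = "{..<n} <+> {..<n}" and ?Q = "PiM {..<n} (\<lambda>_. exp_law 1)"
  interpret QQ: product_prob_space "\<lambda>_ :: nat. exp_law 1" "{..<n}"
    by (intro product_prob_space_exp_law) simp
  interpret Q: prob_space ?Q
    by (intro prob_space_PiM QQ.M.prob_space_axioms)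
  interpret MQ: pair_prob_space M ?Q ..
  have sets_Q[measurable_cong]: "sets ?Q = sets (PiM {..<n} (\<lambda>_. borel))"
    by (intro sets_PiM_cong) auto
  define F :: "(nat + nat \<Rightarrow> real) \<Rightarrow> complex" where "F v = (\<Prod>i<n. iexp (c (v (Inl i)) * v (Inr i)))" for v
  have [measurable]: "(\<lambda>v. v (Inl i)) \<in> borel_measurable (PiM ?I (\<lambda>_. borel))"
    "(\<lambda>v. v (Inr i)) \<in> borel_measurable (PiM ?I (\<lambda>_. borel))" if "i < n" for i
    using that by (auto intro!: measurable_component_singleton)
  have F[measurable]: "F \<in> borel_measurable (PiM ?I (\<lambda>_. borel :: real measure))"
    unfolding F_def by measurable
  have point[measurable]: "point_at r n i \<in> borel_measurable M" if "i < n" for i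
    using that by measurable
  have X: "(\<lambda>\<omega>. restrict (case_sum (\<lambda>i. point_at r n i \<omega>) (\<lambda>i. weight_at r n i \<omega>)) ?I)
      \<in> measurable M (PiM ?I (\<lambda>_. borel))"
    by (intro measurable_restrict) auto
  have X': "(\<lambda>(\<omega>, \<xi>). restrict (case_sum (\<lambda>i. point_at r n i \<omega>) (\<lambda>i. point_at r n i \<omega> * \<xi> i)) ?I)
      \<in> measurable (M \<Otimes>\<^sub>M ?Q) (PiM ?I (\<lambda>_. borel))"
    unfolding case_prod_beta' by (intro measurable_restrict) auto
  have "(CLINT \<omega>|M. \<Prod>i<n. iexp (c (point_at r n i \<omega>) * weight_at r n i \<omega>)) =
      (CLINT \<omega>|M. F (restrict (case_sum (\<lambda>i. point_at r n i \<omega>) (\<lambda>i. weight_at r n i \<omega>)) ?I))"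
    unfolding F_def by (intro Bochner_Integration.integral_cong refl prod.cong) auto
  also have "\<dots> = (CLINT v|distr M (PiM ?I (\<lambda>_. borel))
      (\<lambda>\<omega>. restrict (case_sum (\<lambda>i. point_at r n i \<omega>) (\<lambda>i. weight_at r n i \<omega>)) ?I). F v)"
    by (rule integral_distr[OF X F, symmetric])
  also have "\<dots> = (CLINT p|M \<Otimes>\<^sub>M ?Q. F ((\<lambda>(\<omega>, \<xi>).
      restrict (case_sum (\<lambda>i. point_at r n i \<omega>) (\<lambda>i. point_at r n i \<omega> * \<xi> i)) ?I) p))"
    unfolding joint_law by (rule integral_distr[OF X' F])
  also have "\<dots> = (CLINT p|M \<Otimes>\<^sub>M ?Q. (\<lambda>(\<omega>, \<xi>).
      \<Prod>i<n. iexp (c (point_at r n i \<omega>) * point_at r n i \<omega> * \<xi> i)) p)"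
    unfolding F_def by (intro Bochner_Integration.integral_cong refl) (auto intro!: prod.cong simp: mult.assoc)
  also have "\<dots> = (CLINT \<omega>|M. CLINT \<xi>|?Q. \<Prod>i<n. iexp (c (point_at r n i \<omega>) * point_at r n i \<omega> * \<xi> i))"
  proof -
    have "integrable (M \<Otimes>\<^sub>M ?Q) (\<lambda>(\<omega>, \<xi>). \<Prod>i<n. iexp (c (point_at r n i \<omega>) * point_at r n i \<omega> * \<xi> i))"
      unfolding case_prod_beta'
      by (intro MQ.integrable_const_bound[where B = 1]) (auto simp: prod_norm[symmetric])
    from MQ.integral_fst'[OF this] show ?thesis by simp
  qed
  also have "\<dots> = (CLINT \<omega>|M. \<Prod>i<n. exp_cf (c (point_at r n i \<omega>) * point_at r n i \<omega>))"
  proof (intro Bochner_Integration.integral_cong refl)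
    fix \<omega>
    have "(CLINT \<xi>|?Q. \<Prod>i<n. iexp (c (point_at r n i \<omega>) * point_at r n i \<omega> * \<xi> i)) =
        (\<Prod>i<n. CLINT z|exp_law 1. iexp (c (point_at r n i \<omega>) * point_at r n i \<omega> * z))"
      by (rule QQ.product_integral_prod) (auto intro!: QQ.M.integrable_const_bound[where B = 1])
    then show "(CLINT \<xi>|?Q. \<Prod>i<n. iexp (c (point_at r n i \<omega>) * point_at r n i \<omega> * \<xi> i)) =
        (\<Prod>i<n. exp_cf (c (point_at r n i \<omega>) * point_at r n i \<omega>))"
      by (simp only: iexp_exp_law_integral[OF zero_less_one] exp_cf_def div_by_1)
  qed
  finally show ?thesis .
qed

lemma reindex_points:
  assumes "\<omega> \<in> space M" "card (N \<omega> \<inter> {1..r}) = n"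
  shows "(\<Sum>t\<in>N \<omega> \<inter> {1..r}. f t (Z t \<omega>)) = (\<Sum>i<n. f (point_at r n i \<omega>) (weight_at r n i \<omega>) :: 'c :: comm_monoid_add)"
    and "(\<Prod>t\<in>N \<omega> \<inter> {1..r}. g t) = (\<Prod>i<n. g (point_at r n i \<omega>) :: 'd :: comm_monoid_mult)"
proof -
  have *: "bij_betw (nth_point (N \<omega>)) {..<n} (N \<omega> \<inter> {1..r})"
    using bij_betw_nth_point[OF points_ge_1[OF assms(1)] locally_finite[OF assms(1)], of r] assms(2) by simp
  show "(\<Sum>t\<in>N \<omega> \<inter> {1..r}. f t (Z t \<omega>)) = (\<Sum>i<n. f (point_at r n i \<omega>) (weight_at r n i \<omega>))"
    using sum.reindex_bij_betw[OF *, of "\<lambda>t. f t (Z t \<omega>)"] assms(2)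
    by (simp add: point_at_def weight_at_def)
  show "(\<Prod>t\<in>N \<omega> \<inter> {1..r}. g t) = (\<Prod>i<n. g (point_at r n i \<omega>))"
    using prod.reindex_bij_betw[OF *, of g] assms(2) by (simp add: point_at_def)
qed

lemma sum_points_measurable:
  assumes [measurable]: "c \<in> borel_measurable borel"
  shows "(\<lambda>\<omega>. \<Sum>t\<in>N \<omega> \<inter> {1..r}. c t * Z t \<omega>) \<in> borel_measurable M"
proof -
  have "(\<lambda>\<omega>. \<Sum>i<n. c (point_at r n i \<omega>) * weight_at r n i \<omega>) \<in> borel_measurable M" for n
    by measurable
  then have "(\<lambda>\<omega>. \<Sum>i<card (N \<omega> \<inter> {1..r}). c (point_at r (card (N \<omega> \<inter> {1..r})) i \<omega>) *
      weight_at r (card (N \<omega> \<inter> {1..r})) i \<omega>) \<in> borel_measurable M"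
    using count_measurable by (rule measurable_compose_countable)
  then show ?thesis
    by (subst measurable_cong) (rule reindex_points(1)[OF _ refl])
qed

lemma prod_points_measurable:
  fixes h :: "real \<Rightarrow> complex"
  assumes [measurable]: "h \<in> borel_measurable borel"
  shows "(\<lambda>\<omega>. \<Prod>t\<in>N \<omega> \<inter> {1..r}. h t) \<in> borel_measurable M"
proof -
  have "(\<lambda>\<omega>. \<Prod>i<n. h (point_at r n i \<omega>)) \<in> borel_measurable M" for n
    by measurable
  then have "(\<lambda>\<omega>. \<Prod>i<card (N \<omega> \<inter> {1..r}). h (point_at r (card (N \<omega> \<inter> {1..r})) i \<omega>)) \<in> borel_measurable M"
    using count_measurable by (rule measurable_compose_countable)
  then show ?thesis
    by (subst measurable_cong) (rule reindex_points(2)[OF _ refl])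
qed

lemma points_cf:
  assumes c[measurable]: "c \<in> borel_measurable borel"
  shows "(CLINT \<omega>|M. iexp (\<Sum>t\<in>N \<omega> \<inter> {1..r}. c t * Z t \<omega>)) =
    (CLINT \<omega>|M. \<Prod>t\<in>N \<omega> \<inter> {1..r}. exp_cf (c t * t))"
proof (rule expectation_count_cong[OF count_measurable[of r]])
  have [measurable]: "(\<lambda>t. exp_cf (c t * t)) \<in> borel_measurable borel"
    unfolding exp_cf_def by measurable
  note [measurable] = sum_points_measurable[OF c, of r] prod_points_measurable[of "\<lambda>t. exp_cf (c t * t)" r]
  show "(\<lambda>\<omega>. iexp (\<Sum>t\<in>N \<omega> \<inter> {1..r}. c t * Z t \<omega>)) \<in> borel_measurable M"
    "(\<lambda>\<omega>. \<Prod>t\<in>N \<omega> \<inter> {1..r}. exp_cf (c t * t)) \<in> borel_measurable M"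
    by measurable
  show "norm (\<Prod>t\<in>N \<omega> \<inter> {1..r}. exp_cf (c t * t)) \<le> 1" for \<omega>
    unfolding prod_norm[symmetric] by (intro prod_le_1) (auto simp: norm_exp_cf_le)
  fix n
  let ?E = "{\<omega> \<in> space M. card (N \<omega> \<inter> {1..r}) = n}"
  have E: "?E \<in> sets M" by measurable
  define f where "f \<omega> = (\<Prod>i<n. iexp (c (point_at r n i \<omega>) * weight_at r n i \<omega>))" for \<omega>
  define g where "g \<omega> = (\<Prod>i<n. exp_cf (c (point_at r n i \<omega>) * point_at r n i \<omega>))" for \<omega>
  have f_measurable[measurable]: "f \<in> borel_measurable M" and g_measurable[measurable]: "g \<in> borel_measurable M"
    unfolding f_def g_def exp_cf_def by measurable
  have "norm (f \<omega>) \<le> 1" "norm (g \<omega>) \<le> 1" for \<omega>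
    unfolding f_def g_def prod_norm[symmetric] by (intro prod_le_1; simp add: norm_exp_cf_le)+
  then have int: "integrable M f" "integrable M g"
    by (auto intro!: integrable_const_bound[where B = 1])
  \<comment> \<open>\<open>cf_count\<close> integrates over the whole space, while the integrals
    wanted are over ?E. Off ?E both integrands are constantly 1, so both lose the same mass.\<close>
  have off: "f \<omega> = 1" "g \<omega> = 1" if "\<omega> \<in> space M - ?E" for \<omega>
    using that by (auto simp: f_def g_def point_at_def weight_at_def)
  have split: "(CLINT \<omega>:?E|M. F \<omega>) = (CLINT \<omega>|M. F \<omega>) - (CLINT \<omega>|M. indicator (space M - ?E) \<omega>)"
    if "integrable M F" "\<And>\<omega>. \<omega> \<in> space M - ?E \<Longrightarrow> F \<omega> = 1" for F :: "'a \<Rightarrow> complex"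
  proof -
    have "integrable M (indicator (space M - ?E) :: 'a \<Rightarrow> complex)"
      using E by (intro integrable_const_bound[where B = 1]) (auto simp: indicator_def)
    then have "(CLINT \<omega>|M. F \<omega>) - (CLINT \<omega>|M. indicator (space M - ?E) \<omega>) =
        (CLINT \<omega>|M. F \<omega> - indicator (space M - ?E) \<omega>)"
      using that(1) by simp
    also have "\<dots> = (CLINT \<omega>:?E|M. F \<omega>)"
      unfolding set_lebesgue_integral_def using that(2)
      by (intro Bochner_Integration.integral_cong refl) (simp add: indicator_def)
    finally show ?thesis ..
  qed
  have "(CLINT \<omega>:?E|M. iexp (\<Sum>t\<in>N \<omega> \<inter> {1..r}. c t * Z t \<omega>)) = (CLINT \<omega>:?E|M. f \<omega>)"
    unfolding set_lebesgue_integral_def f_def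
    by (intro Bochner_Integration.integral_cong refl)
      (auto simp: indicator_def reindex_points(1)[where f = "\<lambda>t z. c t * z"] exp_sum sum_distrib_left)
  also have "\<dots> = (CLINT \<omega>:?E|M. g \<omega>)"
  proof -
    have "(CLINT \<omega>|M. f \<omega>) = (CLINT \<omega>|M. g \<omega>)"
      unfolding f_def g_def by (rule cf_count[OF c])
    then show ?thesis
      using split[OF int(1) off(1)] split[OF int(2) off(2)] by simp
  qed
  also have "\<dots> = (CLINT \<omega>:?E|M. \<Prod>t\<in>N \<omega> \<inter> {1..r}. exp_cf (c t * t))"
    unfolding set_lebesgue_integral_def g_def
    by (intro Bochner_Integration.integral_cong refl) (auto simp: indicator_def reindex_points(2))
  finally show "(CLINT \<omega>:?E|M. iexp (\<Sum>t\<in>N \<omega> \<inter> {1..r}. c t * Z t \<omega>)) =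
      (CLINT \<omega>:?E|M. \<Prod>t\<in>N \<omega> \<inter> {1..r}. exp_cf (c t * t))" .
qed simp

end


section \<open>Campbell's formula by step functions on a grid\<close>

definition grid_point :: "real \<Rightarrow> nat \<Rightarrow> nat \<Rightarrow> real" where
  "grid_point r m k = 1 + real k * ((r - 1) / real (Suc m))"

definition grid_cell :: "real \<Rightarrow> nat \<Rightarrow> nat \<Rightarrow> real set" where
  "grid_cell r m k = {grid_point r m k<..grid_point r m (Suc k)}"

text \<open>The left end of the half-open cell that contains t, written with a ceiling so that it is
  evidently Borel in t. If t is a grid point, the ceiling selects the cell to its left.\<close>

definition grid_left :: "real \<Rightarrow> nat \<Rightarrow> real \<Rightarrow> real" where
  "grid_left r m t = 1 + (of_int \<lceil>(t - 1) / ((r - 1) / real (Suc m))\<rceil> - 1) * ((r - 1) / real (Suc m))"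

lemma grid_left_cell:
  assumes "r > 1" "t \<in> grid_cell r m k"
  shows "grid_left r m t = grid_point r m k"
proof -
  let ?d = "(r - 1) / real (Suc m)"
  have d: "?d > 0" using assms(1) by simp
  have "real k * ?d < t - 1" "t - 1 \<le> real (Suc k) * ?d"
    using assms(2) by (auto simp: grid_cell_def grid_point_def)
  then have "real k < (t - 1) / ?d" "(t - 1) / ?d \<le> real (Suc k)"
    using d by (simp_all only: pos_less_divide_eq pos_divide_le_eq)
  then have "\<lceil>(t - 1) / ?d\<rceil> = int k + 1"
    by (intro ceiling_unique) auto
  then show ?thesis
    by (simp add: grid_left_def grid_point_def)
qed

lemma UN_grid_cell:
  assumes "r > 1"
  shows "(\<Union>k<Suc m. grid_cell r m k) = {1<..r}"
proof -
  define d where "d = (r - 1) / real (Suc m)"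
  have gp: "grid_point r m k = 1 + real k * d" for k
    by (simp add: grid_point_def d_def)
  have d: "d > 0" using assms(1) by (simp add: d_def)
  have "(\<Union>k<l. grid_cell r m k) = {1<..grid_point r m l}" for l
  proof (induction l)
    case (Suc l)
    have "{1<..grid_point r m l} \<union> grid_cell r m l = {1<..grid_point r m (Suc l)}"
      unfolding grid_cell_def gp using d by (intro ivl_disj_un) (auto simp: distrib_right)
    then show ?case
      using Suc by (simp add: lessThan_Suc Un_commute)
  qed (simp add: grid_point_def)
  moreover have "grid_point r m (Suc m) = r"
    by (simp add: grid_point_def)
  ultimately show ?thesis by simp
qed

lemma grid_cell_disjoint:
  assumes "r > 1" "k \<noteq> l"
  shows "grid_cell r m k \<inter> grid_cell r m l = {}"
proof -
  have "grid_point r m k \<noteq> grid_point r m l"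
    using assms by (simp add: grid_point_def)
  then show ?thesis
    using grid_left_cell[OF assms(1)] by (metis disjoint_iff)
qed

text \<open>The approach is strictly from the left, also at grid points. Hence left-continuity of a
  function is what makes its grid approximations converge.\<close>

lemma grid_left_tendsto:
  assumes "r > 1"
  shows "filterlim (\<lambda>m. grid_left r m t) (at_left t) sequentially"
proof -
  let ?d = "\<lambda>m. (r - 1) / real (Suc m)"
  have bounds: "t - ?d m \<le> grid_left r m t" "grid_left r m t < t" for m
  proof -
    define d where "d = ?d m"
    have d: "d > 0" using assms by (simp add: d_def)
    have "(t - 1) / d \<le> of_int \<lceil>(t - 1) / d\<rceil>" "of_int \<lceil>(t - 1) / d\<rceil> - 1 < (t - 1) / d"
      by linarith+
    then have "((t - 1) / d - 1) * d \<le> (of_int \<lceil>(t - 1) / d\<rceil> - 1) * d"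
      "(of_int \<lceil>(t - 1) / d\<rceil> - 1) * d < (t - 1) / d * d"
      using d by (intro mult_right_mono mult_strict_right_mono; simp)+
    moreover have "(t - 1) / d * d = t - 1" "((t - 1) / d - 1) * d = t - 1 - d"
      using d by (simp_all add: field_simps)
    ultimately show "t - ?d m \<le> grid_left r m t" "grid_left r m t < t"
      unfolding grid_left_def d_def[symmetric] by linarith+
  qed
  have "(\<lambda>m. t - ?d m) \<longlonglongrightarrow> t - 0"
    using LIMSEQ_inverse_real_of_nat tendsto_mult_right[of _ 0 sequentially "r - 1"]
    by (intro tendsto_diff tendsto_const) (simp add: divide_inverse tendsto_mult_right_zero mult.commute)
  then have "(\<lambda>m. t - ?d m) \<longlonglongrightarrow> t" by simp
  then have "(\<lambda>m. grid_left r m t) \<longlonglongrightarrow> t"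
    by (rule tendsto_sandwich[OF _ _ _ tendsto_const, rotated 2])
      (simp_all only: bounds(1) less_imp_le[OF bounds(2)] eventually_True)
  moreover have "\<forall>\<^sub>F m in sequentially. grid_left r m t \<in> {..<t} \<and> grid_left r m t \<noteq> t"
    using bounds(2) by (intro always_eventually allI) (auto simp: less_le)
  ultimately show ?thesis
    by (simp add: filterlim_at)
qed

context marked_point_process
begin

abbreviation "intensity \<equiv> density lborel (\<lambda>s. ennreal (1 / s))"

lemma measure_intensity:
  assumes [measurable]: "A \<in> sets borel" and "A \<subseteq> {1<..r}"
  shows "integrable lborel (\<lambda>t. indicator A t * (1 / t))"
    and "measure intensity A = (\<integral>t. indicator A t * (1 / t) \<partial>lborel)"
proof -
  show "integrable lborel (\<lambda>t. indicator A t * (1 / t))"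
  proof (rule Bochner_Integration.integrable_bound)
    show "integrable lborel (indicator {1<..r} :: real \<Rightarrow> real)"
      by (intro integrable_real_indicator emeasure_bounded_finite) auto
    show "AE t in lborel. norm (indicator A t * (1 / t)) \<le> norm (indicator {1<..r} t :: real)"
      using assms(2) by (intro AE_I2) (auto simp: indicator_def)
  qed measurable
  have "measure intensity A = enn2real (\<integral>\<^sup>+t. ennreal (indicator A t * (1 / t)) \<partial>lborel)"
    unfolding measure_def
    by (subst emeasure_density) (auto intro!: arg_cong[where f = enn2real] nn_integral_cong simp: indicator_def)
  also have "\<dots> = (\<integral>t. indicator A t * (1 / t) \<partial>lborel)"
  proof (rule integral_eq_nn_integral[symmetric])
    show "AE t in lborel. 0 \<le> indicator A t * (1 / t)"
    proof (rule AE_I2)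
      show "0 \<le> indicator A t * (1 / t)" for t
        using assms(2) by (cases "t \<in> A") auto
    qed
  qed measurable
  finally show "measure intensity A = (\<integral>t. indicator A t * (1 / t) \<partial>lborel)" .
qed

lemma poisson_grid_pgf:
  fixes z :: "nat \<Rightarrow> complex"
  assumes r: "r > 1" and z: "\<And>k. norm (z k) \<le> 1"
  shows "(CLINT \<omega>|M. \<Prod>k<Suc m. z k ^ card (N \<omega> \<inter> grid_cell r m k)) =
    exp (- (\<Sum>k<Suc m. of_real (measure intensity (grid_cell r m k)) * (1 - z k)))"
proof -
  \<comment> \<open>The Poisson hypothesis speaks of infinite disjoint sequences, so the finitely
    many cells are continued by empty sets.\<close>
  define A where "A k = (if k < Suc m then grid_cell r m k else {})" for k
  have A: "A k \<in> sets borel" "bounded (A k)" "A k \<subseteq> {1<..}" for k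
    using UN_grid_cell[OF r, of m] by (auto simp: A_def grid_cell_def)
  have disj: "disjoint_family A"
    using grid_cell_disjoint[OF r] by (auto simp: disjoint_family_on_def A_def)
  have "indep_vars (\<lambda>_. count_space UNIV) (\<lambda>k \<omega>. card (N \<omega> \<inter> A k)) UNIV"
    by (rule poisson[unfolded poisson_on_def, THEN conjunct2, THEN spec[of _ A], THEN mp])
      (use disj A in simp)
  then have "indep_vars (\<lambda>_. borel) (\<lambda>k \<omega>. z k ^ card (N \<omega> \<inter> A k)) UNIV"
    by (rule indep_vars_compose2) auto
  then have "indep_vars (\<lambda>_. borel) (\<lambda>k \<omega>. z k ^ card (N \<omega> \<inter> A k)) {..<Suc m}"
    by (rule indep_vars_subset) auto
  then have "(CLINT \<omega>|M. \<Prod>k<Suc m. z k ^ card (N \<omega> \<inter> A k)) =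
      (\<Prod>k<Suc m. CLINT \<omega>|M. z k ^ card (N \<omega> \<inter> A k))"
  proof (rule indep_vars_lebesgue_integral[rotated])
    fix k
    have [measurable]: "(\<lambda>\<omega>. card (N \<omega> \<inter> A k)) \<in> measurable M (count_space UNIV)"
      using A by (intro counts_measurable)
    show "integrable M (\<lambda>\<omega>. z k ^ card (N \<omega> \<inter> A k))"
      using power_le_one[OF norm_ge_zero z]
      by (intro integrable_const_bound[where B = 1]) (auto simp: norm_power)
  qed simp
  also have "\<dots> = (\<Prod>k<Suc m. exp (- (of_real (measure intensity (A k)) * (1 - z k))))"
  proof (intro prod.cong refl poisson_pgf counts_measurable A z)
    fix k j
    show "prob {\<omega> \<in> space M. card (N \<omega> \<inter> A k) = j} =
        measure intensity (A k) ^ j / fact j * exp (- measure intensity (A k))"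
      by (rule poisson[unfolded poisson_on_def, THEN conjunct1, THEN bspec[of _ _ "A k"], THEN mp, THEN spec[of _ j]])
        (use A in simp_all)
  qed
  also have "\<dots> = exp (- (\<Sum>k<Suc m. of_real (measure intensity (A k)) * (1 - z k)))"
    by (simp only: sum_negf[symmetric] exp_sum finite_lessThan)
  also have "(\<Sum>k<Suc m. of_real (measure intensity (A k)) * (1 - z k)) =
      (\<Sum>k<Suc m. of_real (measure intensity (grid_cell r m k)) * (1 - z k))"
    by (intro sum.cong) (auto simp: A_def)
  also have "(\<lambda>\<omega>. \<Prod>k<Suc m. z k ^ card (N \<omega> \<inter> A k)) = (\<lambda>\<omega>. \<Prod>k<Suc m. z k ^ card (N \<omega> \<inter> grid_cell r m k))"
    by (intro ext prod.cong) (auto simp: A_def)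
  finally show ?thesis .
qed

text \<open>If h is replaced by its value at the left end of each cell, the product over the points
  becomes a product of powers of independent Poisson counts and the integral a finite sum. Refining
  the grid gives the formula by dominated convergence, as h is bounded by 1. The certain point at 1
  is separated first and yields the factor h 1.\<close>

lemma points_pgf:
  fixes h :: "real \<Rightarrow> complex"
  assumes r: "r > 1" and h[measurable]: "h \<in> borel_measurable borel" and bound: "\<And>t. norm (h t) \<le> 1"
    and left: "\<And>t. t > 1 \<Longrightarrow> (h \<longlongrightarrow> h t) (at_left t)"
  shows "(CLINT \<omega>|M. \<Prod>t\<in>N \<omega> \<inter> {1..r}. h t) =
    h 1 * exp (- (CLINT t:{1<..r}|lborel. (1 - h t) / t))"
proof -
  define hm where "hm m t = h (grid_left r m t)" for m t
  have hm_tendsto: "(\<lambda>m. hm m t) \<longlonglongrightarrow> h t" if "t > 1" for t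
    unfolding hm_def using filterlim_compose[OF left[OF that] grid_left_tendsto[OF r]] .
  have hm_measurable[measurable]: "hm m \<in> borel_measurable borel" for m
    unfolding hm_def grid_left_def by measurable
  have hm_bound: "norm (hm m t) \<le> 1" for m t
    unfolding hm_def by (rule bound)
  have fin: "finite (N \<omega> \<inter> {1<..r})" if "\<omega> \<in> space M" for \<omega>
    using locally_finite[OF that, of r] by (rule rev_finite_subset) auto
  have cells: "(\<Prod>t\<in>N \<omega> \<inter> {1<..r}. hm m t) =
      (\<Prod>k<Suc m. h (grid_point r m k) ^ card (N \<omega> \<inter> grid_cell r m k))" if \<omega>: "\<omega> \<in> space M" for m \<omega>
  proof -
    have sub: "grid_cell r m k \<subseteq> {1<..r}" if "k < Suc m" for k
      using UN_grid_cell[OF r, of m] that by blast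
    have "(\<Prod>t\<in>N \<omega> \<inter> {1<..r}. hm m t) = (\<Prod>t\<in>(\<Union>k<Suc m. N \<omega> \<inter> grid_cell r m k). hm m t)"
      unfolding UN_grid_cell[OF r, of m, symmetric] by (simp only: Int_UN_distrib)
    also have "\<dots> = (\<Prod>k<Suc m. \<Prod>t\<in>N \<omega> \<inter> grid_cell r m k. hm m t)"
    proof (rule prod.UNION_disjoint)
      show "\<forall>k\<in>{..<Suc m}. finite (N \<omega> \<inter> grid_cell r m k)"
        using sub fin[OF \<omega>] by (auto intro: finite_subset[rotated])
      show "\<forall>i\<in>{..<Suc m}. \<forall>j\<in>{..<Suc m}. i \<noteq> j \<longrightarrow> N \<omega> \<inter> grid_cell r m i \<inter> (N \<omega> \<inter> grid_cell r m j) = {}"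
        using grid_cell_disjoint[OF r] by blast
    qed simp
    also have "\<dots> = (\<Prod>k<Suc m. h (grid_point r m k) ^ card (N \<omega> \<inter> grid_cell r m k))"
    proof (rule prod.cong[OF refl])
      fix k
      have "(\<Prod>t\<in>N \<omega> \<inter> grid_cell r m k. hm m t) = (\<Prod>t\<in>N \<omega> \<inter> grid_cell r m k. h (grid_point r m k))"
        using grid_left_cell[OF r] by (intro prod.cong) (auto simp: hm_def)
      then show "(\<Prod>t\<in>N \<omega> \<inter> grid_cell r m k. hm m t) =
          h (grid_point r m k) ^ card (N \<omega> \<inter> grid_cell r m k)"
        by simp
    qed
    finally show ?thesis .
  qed
  have int_cell: "(CLINT t:{1<..r}|lborel. (1 - hm m t) / t) =
      (\<Sum>k<Suc m. of_real (measure intensity (grid_cell r m k)) * (1 - h (grid_point r m k)))" for m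
  proof -
    have sub: "grid_cell r m k \<subseteq> {1<..r}" if "k < Suc m" for k
      using UN_grid_cell[OF r, of m] that by blast
    have "indicator {1<..r} t *\<^sub>R ((1 - hm m t) / t) =
        (\<Sum>k<Suc m. of_real (indicator (grid_cell r m k) t * (1 / t)) * (1 - h (grid_point r m k)))" for t
    proof (cases "t \<in> {1<..r}")
      case True
      then obtain l where l: "l < Suc m" "t \<in> grid_cell r m l"
        using UN_grid_cell[OF r, of m] by blast
      have "of_real (indicator (grid_cell r m k) t * (1 / t)) * (1 - h (grid_point r m k)) =
          (if k = l then (1 - hm m t) / t else 0)" for k
        using l(2) grid_cell_disjoint[OF r, of k l m] by (auto simp: hm_def grid_left_cell[OF r] indicator_def)
      then show ?thesis
        using True l(1) by simp
    next
      case False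
      then have "t \<notin> grid_cell r m k" if "k < Suc m" for k
        using sub[OF that] by blast
      with False show ?thesis by simp
    qed
    then have "(CLINT t:{1<..r}|lborel. (1 - hm m t) / t) =
        (CLINT t|lborel. \<Sum>k<Suc m. of_real (indicator (grid_cell r m k) t * (1 / t)) * (1 - h (grid_point r m k)))"
      by (simp add: set_lebesgue_integral_def)
    also have "\<dots> = (\<Sum>k<Suc m. CLINT t|lborel. of_real (indicator (grid_cell r m k) t * (1 / t)) * (1 - h (grid_point r m k)))"
    proof (rule Bochner_Integration.integral_sum)
      fix k assume "k \<in> {..<Suc m}"
      then show "integrable lborel (\<lambda>t. of_real (indicator (grid_cell r m k) t * (1 / t)) * (1 - h (grid_point r m k)))"
        using sub by (intro integrable_mult_left integrable_of_real measure_intensity(1)) (auto simp: grid_cell_def)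
    qed
    also have "\<dots> = (\<Sum>k<Suc m. of_real (measure intensity (grid_cell r m k)) * (1 - h (grid_point r m k)))"
    proof (rule sum.cong[OF refl])
      fix k assume "k \<in> {..<Suc m}"
      then have "measure intensity (grid_cell r m k) = (\<integral>t. indicator (grid_cell r m k) t * (1 / t) \<partial>lborel)"
        using sub by (intro measure_intensity(2)) (auto simp: grid_cell_def)
      then show "(CLINT t|lborel. of_real (indicator (grid_cell r m k) t * (1 / t)) * (1 - h (grid_point r m k))) =
          of_real (measure intensity (grid_cell r m k)) * (1 - h (grid_point r m k))"
        by (simp only: integral_mult_left_zero integral_complex_of_real)
    qed
    finally show ?thesis .
  qed
  have "(\<lambda>m. CLINT \<omega>|M. \<Prod>t\<in>N \<omega> \<inter> {1<..r}. hm m t) \<longlonglongrightarrow> (CLINT \<omega>|M. \<Prod>t\<in>N \<omega> \<inter> {1<..r}. h t)"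
  proof (rule integral_dominated_convergence[where w = "\<lambda>_. 1"])
    have Ioc: "(\<lambda>\<omega>. \<Prod>t\<in>N \<omega> \<inter> {1<..r}. f t) \<in> borel_measurable M"
      if [measurable]: "f \<in> borel_measurable borel" for f :: "real \<Rightarrow> complex"
    proof -
      \<comment> \<open>Products over [1, r] are measurable already; the value 1 neutralises a point
        at 1.\<close>
      have "(\<lambda>t. if t > 1 then f t else 1) \<in> borel_measurable borel" by measurable
      then have "(\<lambda>\<omega>. \<Prod>t\<in>N \<omega> \<inter> {1..r}. if t > 1 then f t else 1) \<in> borel_measurable M"
        by (rule prod_points_measurable)
      moreover have "(\<Prod>t\<in>N \<omega> \<inter> {1..r}. if t > 1 then f t else 1) = (\<Prod>t\<in>N \<omega> \<inter> {1<..r}. f t)"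
        if "\<omega> \<in> space M" for \<omega>
        using locally_finite[OF that, of r] by (intro prod.mono_neutral_cong_right) auto
      ultimately show ?thesis
        by (subst (asm) measurable_cong)
    qed
    show "(\<lambda>\<omega>. \<Prod>t\<in>N \<omega> \<inter> {1<..r}. h t) \<in> borel_measurable M"
      "(\<lambda>\<omega>. \<Prod>t\<in>N \<omega> \<inter> {1<..r}. hm m t) \<in> borel_measurable M" for m
      by (intro Ioc h hm_measurable)+
    show "AE \<omega> in M. (\<lambda>m. \<Prod>t\<in>N \<omega> \<inter> {1<..r}. hm m t) \<longlonglongrightarrow> (\<Prod>t\<in>N \<omega> \<inter> {1<..r}. h t)"
      using hm_tendsto by (intro AE_I2 tendsto_prod) auto
    show "AE \<omega> in M. norm (\<Prod>t\<in>N \<omega> \<inter> {1<..r}. hm m t) \<le> 1" for m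
      unfolding prod_norm[symmetric] using hm_bound by (intro AE_I2 prod_le_1) auto
  qed simp
  moreover have "(CLINT \<omega>|M. \<Prod>t\<in>N \<omega> \<inter> {1<..r}. hm m t) =
      exp (- (CLINT t:{1<..r}|lborel. (1 - hm m t) / t))" for m
  proof -
    have "(CLINT \<omega>|M. \<Prod>t\<in>N \<omega> \<inter> {1<..r}. hm m t) =
        (CLINT \<omega>|M. \<Prod>k<Suc m. h (grid_point r m k) ^ card (N \<omega> \<inter> grid_cell r m k))"
      using cells by (intro Bochner_Integration.integral_cong) auto
    then show ?thesis
      unfolding int_cell using poisson_grid_pgf[OF r, of "\<lambda>k. h (grid_point r m k)" m] bound by simp
  qed
  moreover have "(\<lambda>m. exp (- (CLINT t:{1<..r}|lborel. (1 - hm m t) / t))) \<longlonglongrightarrow>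
      exp (- (CLINT t:{1<..r}|lborel. (1 - h t) / t))"
    unfolding set_lebesgue_integral_def
  proof (intro tendsto_intros integral_dominated_convergence[where w = "\<lambda>t. 2 * indicator {1<..r} t"])
    show "integrable lborel (\<lambda>t. 2 * indicator {1<..r} t :: real)"
      by (intro integrable_mult_right integrable_real_indicator emeasure_bounded_finite) auto
    show "AE t in lborel. (\<lambda>m. indicator {1<..r} t *\<^sub>R ((1 - hm m t) / t)) \<longlonglongrightarrow>
        indicator {1<..r} t *\<^sub>R ((1 - h t) / t)"
    proof (rule AE_I2)
      show "(\<lambda>m. indicator {1<..r} t *\<^sub>R ((1 - hm m t) / t)) \<longlonglongrightarrow>
        indicator {1<..r} t *\<^sub>R ((1 - h t) / t)" for t
        using hm_tendsto[of t] by (cases "t \<in> {1<..r}") (auto intro!: tendsto_intros)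
    qed
    show "AE t in lborel. norm (indicator {1<..r} t *\<^sub>R ((1 - hm m t) / t)) \<le> 2 * indicator {1<..r} t" for m
    proof (rule AE_I2)
      fix t
      have "norm (1 - hm m t) \<le> 2"
        using norm_triangle_ineq4[of 1 "hm m t"] hm_bound[of m t] by simp
      then show "norm (indicator {1<..r} t *\<^sub>R ((1 - hm m t) / t)) \<le> 2 * indicator {1<..r} t"
        by (auto simp: indicator_def norm_divide divide_le_eq)
    qed
  qed measurable
  ultimately have "(CLINT \<omega>|M. \<Prod>t\<in>N \<omega> \<inter> {1<..r}. h t) = exp (- (CLINT t:{1<..r}|lborel. (1 - h t) / t))"
    by (auto intro: LIMSEQ_unique)
  moreover have "(CLINT \<omega>|M. \<Prod>t\<in>N \<omega> \<inter> {1..r}. h t) = (CLINT \<omega>|M. h 1 * (\<Prod>t\<in>N \<omega> \<inter> {1<..r}. h t))"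
  proof (rule integral_cong_AE)
    show "AE \<omega> in M. (\<Prod>t\<in>N \<omega> \<inter> {1..r}. h t) = h 1 * (\<Prod>t\<in>N \<omega> \<inter> {1<..r}. h t)"
      using point_at_1 AE_space
    proof eventually_elim
      case (elim \<omega>)
      then have "N \<omega> \<inter> {1..r} = insert 1 (N \<omega> \<inter> {1<..r})"
        using r by auto
      then show ?case
        using fin[OF elim(2)] by simp
    qed
    show "(\<lambda>\<omega>. \<Prod>t\<in>N \<omega> \<inter> {1..r}. h t) \<in> borel_measurable M"
      by (rule prod_points_measurable) fact
    have "(\<lambda>t. if t > 1 then h t else 1) \<in> borel_measurable borel" by measurable
    then have "(\<lambda>\<omega>. h 1 * (\<Prod>t\<in>N \<omega> \<inter> {1..r}. if t > 1 then h t else 1)) \<in> borel_measurable M"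
      by (intro borel_measurable_times prod_points_measurable) auto
    moreover have "(\<Prod>t\<in>N \<omega> \<inter> {1..r}. if t > 1 then h t else 1) = (\<Prod>t\<in>N \<omega> \<inter> {1<..r}. h t)"
      if "\<omega> \<in> space M" for \<omega>
      using locally_finite[OF that, of r] by (intro prod.mono_neutral_cong_right) auto
    ultimately show "(\<lambda>\<omega>. h 1 * (\<Prod>t\<in>N \<omega> \<inter> {1<..r}. h t)) \<in> borel_measurable M"
      by (subst (asm) measurable_cong) auto
  qed
  ultimately show ?thesis by simp
qed

end


section \<open>The recursion for the jump process\<close>

lemma exp_cf_measurable [measurable]: "exp_cf \<in> borel_measurable borel"
  unfolding exp_cf_def[abs_def] by measurable

text \<open>With u = 1 - \<i> s t the integrand is - \<i> s / u, the derivative in t of Ln u. The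
  argument u stays on the line of real part 1, away from the branch cut.\<close>

lemma integral_one_minus_exp_cf:
  assumes "\<kappa> \<ge> 1"
  shows "(CLINT t:{1<..\<kappa>}|lborel. (1 - exp_cf (s * t)) / t) =
    Ln (1 - \<i> * of_real (\<kappa> * s)) - Ln (1 - \<i> * of_real s)"
proof -
  let ?f = "\<lambda>t :: real. - \<i> * of_real s / (1 - \<i> * of_real (t * s))"
  have Re: "1 - \<i> * of_real (t * s) \<notin> \<real>\<^sub>\<le>\<^sub>0" for t
    by (simp add: complex_nonpos_Reals_iff)
  have nz: "1 - \<i> * of_real (t * s) \<noteq> 0" for t
    by (rule exp_cf_denom)
  have "(\<integral>t. indicator {1..\<kappa>} t *\<^sub>R ?f t \<partial>lborel) =
      Ln (1 - \<i> * of_real (\<kappa> * s)) - Ln (1 - \<i> * of_real (1 * s))"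
  proof (rule integral_FTC_Icc[OF assms])
    fix t
    have "((\<lambda>z. Ln (1 - \<i> * (z * of_real s))) has_field_derivative ?f t) (at (of_real t))"
      using Re[of t] nz[of t] by (auto intro!: derivative_eq_intros simp: field_simps)
    then have "((\<lambda>t. Ln (1 - \<i> * (of_real t * of_real s))) has_vector_derivative ?f t) (at t)"
      by (rule has_vector_derivative_real_field)
    then show "((\<lambda>t. Ln (1 - \<i> * of_real (t * s))) has_vector_derivative ?f t) (at t within {1..\<kappa>})"
      by (simp add: has_vector_derivative_at_within)
  next
    show "continuous_on {1..\<kappa>} ?f"
      using nz by (intro continuous_intros) auto
  qed
  moreover have "(CLINT t:{1<..\<kappa>}|lborel. (1 - exp_cf (s * t)) / t) = (\<integral>t. indicator {1..\<kappa>} t *\<^sub>R ?f t \<partial>lborel)"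
    unfolding set_lebesgue_integral_def
  proof (rule integral_cong_AE)
    show "AE t in lborel. indicator {1<..\<kappa>} t *\<^sub>R ((1 - exp_cf (s * t)) / t) = indicator {1..\<kappa>} t *\<^sub>R ?f t"
      using AE_lborel_singleton[of 1]
    proof eventually_elim
      case (elim t)
      have "(1 - exp_cf (s * t)) / t = ?f t" if "t > 1"
        using that nz[of t] by (simp add: exp_cf_def field_simps)
      then show ?case
        using elim by (auto simp: indicator_def)
    qed
  qed measurable
  ultimately show ?thesis by simp
qed

text \<open>The reason why X(\<kappa>) is exponential with mean \<kappa>: the point at 1 contributes
  \<open>exp_cf s\<close>, and the Poisson points in (1, \<kappa>] contribute the quotient of
  \<open>exp_cf (\<kappa> * s)\<close> by \<open>exp_cf s\<close>.\<close>

lemma exp_cf_scale: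
  assumes "\<kappa> \<ge> 1"
  shows "exp_cf s * exp (- (CLINT t:{1<..\<kappa>}|lborel. (1 - exp_cf (s * t)) / t)) = exp_cf (\<kappa> * s)"
proof -
  have "exp (- (CLINT t:{1<..\<kappa>}|lborel. (1 - exp_cf (s * t)) / t)) =
      (1 - \<i> * of_real s) / (1 - \<i> * of_real (\<kappa> * s))"
    unfolding integral_one_minus_exp_cf[OF assms] minus_diff_eq exp_diff
    by (simp only: exp_Ln[OF exp_cf_denom])
  then show ?thesis
    by (simp only: exp_cf_def) (use exp_cf_denom[of s] in simp)
qed

context marked_point_process
begin

lemma jump_process_measurable: "jump_process N Z \<rho> \<in> borel_measurable M"
  using sum_points_measurable[of "\<lambda>_. 1" \<rho>] unfolding jump_process_def by simp

lemma jump_cf: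
  fixes \<theta> :: "real \<Rightarrow> real"
  assumes J: "finite J" "\<And>\<rho>. \<rho> \<in> J \<Longrightarrow> 1 \<le> \<rho> \<and> \<rho> \<le> r" and r: "r > 1"
  shows "(CLINT \<omega>|M. iexp (\<Sum>\<rho>\<in>J. \<theta> \<rho> * jump_process N Z \<rho> \<omega>)) =
    exp_cf (sum \<theta> J) * exp (- (CLINT t:{1<..r}|lborel. (1 - exp_cf ((\<Sum>\<rho>\<in>J. \<theta> \<rho> * indicator {..\<rho>} t) * t)) / t))"
proof -
  \<comment> \<open>The coefficient of the weight at t after interchanging the sums: every \<rho>
    \<ge> t counts it. The closed half-lines make c left-continuous, as \<open>points_pgf\<close>
    demands.\<close>
  define c where "c t = (\<Sum>\<rho>\<in>J. \<theta> \<rho> * indicator {..\<rho>} t)" for t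
  have c[measurable]: "c \<in> borel_measurable borel"
    unfolding c_def by measurable
  have c1: "c 1 = sum \<theta> J"
    unfolding c_def using J(2) by (intro sum.cong) auto
  have "(\<Sum>\<rho>\<in>J. \<theta> \<rho> * jump_process N Z \<rho> \<omega>) = (\<Sum>t\<in>N \<omega> \<inter> {1..r}. c t * Z t \<omega>)" if "\<omega> \<in> space M" for \<omega>
  proof -
    have "\<theta> \<rho> * jump_process N Z \<rho> \<omega> = (\<Sum>t\<in>N \<omega> \<inter> {1..r}. \<theta> \<rho> * indicator {..\<rho>} t * Z t \<omega>)"
      if "\<rho> \<in> J" for \<rho>
      unfolding jump_process_def sum_distrib_left using locally_finite[OF \<open>\<omega> \<in> space M\<close>, of r] J(2)[OF that]
      by (intro sum.mono_neutral_cong_left) auto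
    then have "(\<Sum>\<rho>\<in>J. \<theta> \<rho> * jump_process N Z \<rho> \<omega>) =
        (\<Sum>\<rho>\<in>J. \<Sum>t\<in>N \<omega> \<inter> {1..r}. \<theta> \<rho> * indicator {..\<rho>} t * Z t \<omega>)"
      by simp
    also have "\<dots> = (\<Sum>t\<in>N \<omega> \<inter> {1..r}. c t * Z t \<omega>)"
      unfolding c_def sum_distrib_right by (rule sum.swap)
    finally show ?thesis .
  qed
  then have "(CLINT \<omega>|M. iexp (\<Sum>\<rho>\<in>J. \<theta> \<rho> * jump_process N Z \<rho> \<omega>)) =
      (CLINT \<omega>|M. iexp (\<Sum>t\<in>N \<omega> \<inter> {1..r}. c t * Z t \<omega>))"
    by (intro Bochner_Integration.integral_cong) (simp_all only:)
  also have "\<dots> = (CLINT \<omega>|M. \<Prod>t\<in>N \<omega> \<inter> {1..r}. exp_cf (c t * t))"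
    by (rule points_cf[OF c])
  also have "\<dots> = exp_cf (c 1 * 1) * exp (- (CLINT t:{1<..r}|lborel. (1 - exp_cf (c t * t)) / t))"
  proof (rule points_pgf[OF r])
    show "(\<lambda>t. exp_cf (c t * t)) \<in> borel_measurable borel" by measurable
    show "norm (exp_cf (c t * t)) \<le> 1" for t by (rule norm_exp_cf_le)
    fix t :: real
    have "((\<lambda>u. indicator {..\<rho>} u :: real) \<longlongrightarrow> indicator {..\<rho>} t) (at_left t)" for \<rho>
    proof (rule tendsto_eventually)
      show "\<forall>\<^sub>F u in at_left t. indicator {..\<rho>} u = (indicator {..\<rho>} t :: real)"
      proof (cases "t \<le> \<rho>")
        case True
        then show ?thesis
          unfolding eventually_at_filter by (intro always_eventually) auto
      next
        case False
        then have "\<forall>\<^sub>F u in at_left t. u \<in> {\<rho><..<t}"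
          by (intro eventually_at_leftI[of \<rho>]) auto
        then show ?thesis
          by eventually_elim (use False in auto)
      qed
    qed
    then have "((\<lambda>u. c u * u) \<longlongrightarrow> c t * t) (at_left t)"
      unfolding c_def by (intro tendsto_intros)
    moreover have "isCont exp_cf u" for u
      unfolding exp_cf_def[abs_def] by (intro continuous_intros exp_cf_denom)
    ultimately show "((\<lambda>u. exp_cf (c u * u)) \<longlongrightarrow> exp_cf (c t * t)) (at_left t)"
      by (rule isCont_tendsto_compose[rotated])
  qed
  finally show ?thesis
    unfolding c1 mult_1_right unfolding c_def .
qed

text \<open>Up to \<kappa> the coefficient function is constant with value
  \<open>sum \<theta> J\<close>; beyond \<kappa> it is the same for R and for
  \<open>insert \<kappa> R\<close>. So the points beyond \<kappa> give both characteristic functions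
  the same factor exp(-T), and the others are evaluated by \<open>exp_cf_scale\<close>.\<close>

lemma jump_cf_insert:
  fixes \<theta> :: "real \<Rightarrow> real"
  assumes \<kappa>: "\<kappa> \<ge> 1" and R: "finite R" "\<And>\<rho>. \<rho> \<in> R \<Longrightarrow> \<rho> > \<kappa>"
  defines "X \<equiv> jump_process N Z"
  shows "(CLINT \<omega>|M. iexp (\<Sum>\<rho>\<in>insert \<kappa> R. \<theta> \<rho> * X \<rho> \<omega>)) * exp_cf (\<kappa> * sum \<theta> R) =
    exp_cf (\<kappa> * sum \<theta> (insert \<kappa> R)) * (CLINT \<omega>|M. iexp (\<Sum>\<rho>\<in>R. \<theta> \<rho> * X \<rho> \<omega>))"
proof -
  \<comment> \<open>Including \<kappa> + 1 keeps r above \<kappa>, hence above 1, also when R is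
    empty.\<close>
  define r where "r = Max (insert (\<kappa> + 1) R)"
  have "\<kappa> + 1 \<le> r" and R_le: "\<rho> \<le> r" if "\<rho> \<in> R" for \<rho>
    using R(1) that by (auto simp: r_def)
  have \<kappa>r: "\<kappa> + 1 \<le> r"
    using R(1) by (auto simp: r_def)
  define c where "c J t = (\<Sum>\<rho>\<in>J. \<theta> \<rho> * indicator {..\<rho>} t)" for J t
  let ?g = "\<lambda>J t. (1 - exp_cf (c J t * t)) / complex_of_real t"
  define T where "T = (CLINT t:{\<kappa><..r}|lborel. ?g R t)"
  have c_low: "c J t = sum \<theta> J" if "J \<subseteq> insert \<kappa> R" "t \<le> \<kappa>" for J t
    unfolding c_def using that R(2) by (intro sum.cong) fastforce+
  have c_high: "c (insert \<kappa> R) t = c R t" if "t > \<kappa>" for t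
    unfolding c_def using that R by (subst sum.insert) auto
  have low: "exp_cf (sum \<theta> J) * exp (- (CLINT t:{1<..r}|lborel. ?g J t)) = exp_cf (\<kappa> * sum \<theta> J) * exp (- T)"
    if J: "J = R \<or> J = insert \<kappa> R" for J
  proof -
    have [measurable]: "c J \<in> borel_measurable borel"
      unfolding c_def by measurable
    have int: "set_integrable lborel {a<..b} (?g J)" if "a \<ge> 1" for a b
      unfolding set_integrable_def
    proof (rule Bochner_Integration.integrable_bound)
      show "integrable lborel (\<lambda>t. 2 * indicator {a<..b} t :: real)"
        by (intro integrable_mult_right integrable_real_indicator emeasure_bounded_finite) auto
      show "AE t in lborel. norm (indicator {a<..b} t *\<^sub>R ?g J t) \<le> norm (2 * indicator {a<..b} t :: real)"
      proof (rule AE_I2)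
        fix t
        have "norm (1 - exp_cf (c J t * t)) \<le> 2"
          using norm_triangle_ineq4[of 1 "exp_cf (c J t * t)"] norm_exp_cf_le[of "c J t * t"] by simp
        then show "norm (indicator {a<..b} t *\<^sub>R ?g J t) \<le> norm (2 * indicator {a<..b} t :: real)"
          using that by (auto simp: indicator_def norm_divide divide_le_eq)
      qed
    qed measurable
    have "{1<..r} = {1<..\<kappa>} \<union> {\<kappa><..r}"
      using \<kappa> \<kappa>r by auto
    then have "(CLINT t:{1<..r}|lborel. ?g J t) = (CLINT t:{1<..\<kappa>}|lborel. ?g J t) + (CLINT t:{\<kappa><..r}|lborel. ?g J t)"
      using \<kappa> int by (simp only:) (intro set_integral_Un, auto)
    moreover have cJ: "c J t = sum \<theta> J" if "t \<le> \<kappa>" for t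
      using J that by (intro c_low) auto
    then have "(CLINT t:{1<..\<kappa>}|lborel. ?g J t) = (CLINT t:{1<..\<kappa>}|lborel. (1 - exp_cf (sum \<theta> J * t)) / t)"
      by (intro set_lebesgue_integral_cong) auto
    moreover have "(CLINT t:{\<kappa><..r}|lborel. ?g J t) = T"
      unfolding T_def using J c_high by (intro set_lebesgue_integral_cong) auto
    ultimately have "exp (- (CLINT t:{1<..r}|lborel. ?g J t)) =
        exp (- (CLINT t:{1<..\<kappa>}|lborel. (1 - exp_cf (sum \<theta> J * t)) / t)) * exp (- T)"
      by (simp only: minus_add_distrib exp_add)
    then show ?thesis
      using exp_cf_scale[OF \<kappa>, of "sum \<theta> J"] by (simp only: mult.assoc[symmetric])
  qed
  have "(CLINT \<omega>|M. iexp (\<Sum>\<rho>\<in>J. \<theta> \<rho> * X \<rho> \<omega>)) = exp_cf (\<kappa> * sum \<theta> J) * exp (- T)"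
    if J: "J = R \<or> J = insert \<kappa> R" for J
  proof -
    have "finite J" "\<And>\<rho>. \<rho> \<in> J \<Longrightarrow> 1 \<le> \<rho> \<and> \<rho> \<le> r"
      using J R \<kappa> \<kappa>r R_le by (auto dest: less_imp_le order_trans)
    then show ?thesis
      unfolding X_def using jump_cf[of J r \<theta>] low[OF J] \<kappa> \<kappa>r by (simp add: c_def)
  qed
  then show ?thesis by simp
qed

end


section \<open>Equality of joint laws\<close>


context prob_space
begin

text \<open>A probability law made from a signed weight v with values in [-1, 1]. The shift by 2
  puts the density between 1/m and 3/m, and m is the normalising mass.\<close>

definition tilted_law :: "real \<Rightarrow> ('a \<Rightarrow> real) \<Rightarrow> ('a \<Rightarrow> real) \<Rightarrow> real measure" where
  "tilted_law m v U = distr (density M (\<lambda>\<omega>. ennreal ((2 + v \<omega>) / m))) borel U"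

context
  fixes v U :: "'a \<Rightarrow> real" and m :: real
  assumes measurable_vU [measurable]: "v \<in> borel_measurable M" "U \<in> borel_measurable M"
    and v: "\<And>\<omega>. \<bar>v \<omega>\<bar> \<le> 1" and m: "m = expectation (\<lambda>\<omega>. 2 + v \<omega>)"
begin

lemma tilted_mass_pos: "m > 0"
proof -
  have b: "-1 \<le> v \<omega>" "v \<omega> \<le> 1" for \<omega>
    using v[of \<omega>] by linarith+
  have "norm (2 + v \<omega>) \<le> 3" "1 \<le> 2 + v \<omega>" for \<omega>
    using b[of \<omega>] by simp_all
  then have "1 \<le> expectation (\<lambda>\<omega>. 2 + v \<omega>)"
    by (intro integral_ge_const integrable_const_bound[where B = 3] AE_I2) measurable
  then show ?thesis
    unfolding m by simp
qed

lemma tilted_density_nonneg: "0 \<le> (2 + v \<omega>) / m"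
  using v[of \<omega>] tilted_mass_pos by (intro divide_nonneg_pos) auto

lemma integrable_tilted: "integrable M (\<lambda>\<omega>. of_real (v \<omega>) * iexp (s * U \<omega>))"
    "integrable M (\<lambda>\<omega>. iexp (s * U \<omega>))" "integrable M v"
  using v by (auto intro!: integrable_const_bound[where B = 1] simp: norm_mult)

lemma tilted_law_cf: "(CLINT x|tilted_law m v U. iexp (s * x)) =
    (2 * (CLINT \<omega>|M. iexp (s * U \<omega>)) + (CLINT \<omega>|M. of_real (v \<omega>) * iexp (s * U \<omega>))) / m"
proof -
  have "(CLINT x|tilted_law m v U. iexp (s * x)) = (CLINT \<omega>|M. ((2 + v \<omega>) / m) *\<^sub>R iexp (s * U \<omega>))"
    unfolding tilted_law_def using tilted_density_nonneg
    by (subst integral_distr) (auto simp: integral_density)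
  also have "\<dots> = (CLINT \<omega>|M. (2 * iexp (s * U \<omega>) + of_real (v \<omega>) * iexp (s * U \<omega>)) / m)"
    by (intro Bochner_Integration.integral_cong refl)
      (simp add: scaleR_conv_of_real distrib_right add_divide_distrib)
  also have "\<dots> = (2 * (CLINT \<omega>|M. iexp (s * U \<omega>)) + (CLINT \<omega>|M. of_real (v \<omega>) * iexp (s * U \<omega>))) / m"
    using integrable_tilted by (simp only: integral_divide_zero Bochner_Integration.integral_add
        integrable_mult_right integral_mult_right_zero)
  finally show ?thesis .
qed

lemma emeasure_tilted_law:
  assumes [measurable]: "A \<in> sets borel"
  shows "emeasure (tilted_law m v U) A = ennreal (expectation (\<lambda>\<omega>. (2 + v \<omega>) / m * indicator A (U \<omega>)))"
proof -
  have "emeasure (tilted_law m v U) A =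
      (\<integral>\<^sup>+\<omega>. ennreal ((2 + v \<omega>) / m) * indicator (U -` A \<inter> space M) \<omega> \<partial>M)"
    unfolding tilted_law_def by (simp add: emeasure_distr emeasure_density)
  also have "\<dots> = (\<integral>\<^sup>+\<omega>. ennreal ((2 + v \<omega>) / m * indicator A (U \<omega>)) \<partial>M)"
    by (intro nn_integral_cong) (auto simp: indicator_def)
  also have "\<dots> = ennreal (expectation (\<lambda>\<omega>. (2 + v \<omega>) / m * indicator A (U \<omega>)))"
  proof (rule nn_integral_eq_integral)
    show "integrable M (\<lambda>\<omega>. (2 + v \<omega>) / m * indicator A (U \<omega>))"
    proof (intro integrable_const_bound[where B = "3 / m"] AE_I2)
      fix \<omega>
      have "(2 + v \<omega>) / m \<le> 3 / m"
        using v[of \<omega>] tilted_mass_pos by (intro divide_right_mono) auto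
      then show "norm ((2 + v \<omega>) / m * indicator A (U \<omega>)) \<le> 3 / m"
        using tilted_density_nonneg[of \<omega>] tilted_mass_pos by (auto simp: indicator_def)
    qed measurable
    show "AE \<omega> in M. 0 \<le> (2 + v \<omega>) / m * indicator A (U \<omega>)"
      using tilted_density_nonneg by (intro AE_I2 mult_nonneg_nonneg) auto
  qed
  finally show ?thesis .
qed

lemma real_distribution_tilted_law: "real_distribution (tilted_law m v U)"
proof -
  have "expectation (\<lambda>\<omega>. (2 + v \<omega>) / m * indicator UNIV (U \<omega>)) = expectation (\<lambda>\<omega>. 2 + v \<omega>) / m"
    by simp
  also have "\<dots> = 1"
    using m tilted_mass_pos by simp
  finally have "emeasure (tilted_law m v U) UNIV = 1"
    by (simp only: emeasure_tilted_law[of UNIV, simplified] ennreal_1) simp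
  then have "prob_space (tilted_law m v U)"
    by (intro prob_spaceI) (simp add: tilted_law_def)
  then show ?thesis
    unfolding real_distribution_def real_distribution_axioms_def by (simp add: tilted_law_def)
qed

lemma measure_tilted_law:
  assumes A[measurable]: "A \<in> sets borel"
  shows "measure (tilted_law m v U) A =
    (2 * expectation (\<lambda>\<omega>. indicator A (U \<omega>)) + expectation (\<lambda>\<omega>. v \<omega> * indicator A (U \<omega>))) / m"
proof -
  have int: "integrable M (\<lambda>\<omega>. indicator A (U \<omega>) :: real)" "integrable M (\<lambda>\<omega>. v \<omega> * indicator A (U \<omega>))"
    using v by (auto intro!: integrable_const_bound[where B = 1] simp: indicator_def)
  have "0 \<le> expectation (\<lambda>\<omega>. (2 + v \<omega>) / m * indicator A (U \<omega>))"
    using tilted_density_nonneg by (intro Bochner_Integration.integral_nonneg mult_nonneg_nonneg) auto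
  then have "measure (tilted_law m v U) A = expectation (\<lambda>\<omega>. (2 + v \<omega>) / m * indicator A (U \<omega>))"
    unfolding measure_def emeasure_tilted_law[OF A] by simp
  also have "\<dots> = expectation (\<lambda>\<omega>. (2 * indicator A (U \<omega>) + v \<omega> * indicator A (U \<omega>)) / m)"
    by (intro Bochner_Integration.integral_cong refl) (simp add: distrib_right)
  also have "\<dots> = (2 * expectation (\<lambda>\<omega>. indicator A (U \<omega>)) + expectation (\<lambda>\<omega>. v \<omega> * indicator A (U \<omega>))) / m"
    using int by simp
  finally show ?thesis .
qed

end

end

text \<open>Shifted by 2, the signed weight becomes a positive density. The characteristic function
  of the tilted law is a combination of the weighted and the unweighted one, so Levy uniqueness
  identifies the tilted laws. The unweighted part, which is the case of weight 0, is then
  subtracted.\<close>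

lemma weighted_cf_determines:
  fixes w X :: "'a \<Rightarrow> real" and w' X' :: "'b \<Rightarrow> real"
  assumes M: "prob_space M" and M': "prob_space M'"
    and m: "w \<in> borel_measurable M" "X \<in> borel_measurable M"
    and m': "w' \<in> borel_measurable M'" "X' \<in> borel_measurable M'"
    and bound: "\<And>\<omega>. \<bar>w \<omega>\<bar> \<le> 1" and bound': "\<And>\<omega>. \<bar>w' \<omega>\<bar> \<le> 1"
    and weighted: "\<And>s. (CLINT \<omega>|M. of_real (w \<omega>) * iexp (s * X \<omega>)) = (CLINT \<omega>|M'. of_real (w' \<omega>) * iexp (s * X' \<omega>))"
    and unweighted: "\<And>s. (CLINT \<omega>|M. iexp (s * X \<omega>)) = (CLINT \<omega>|M'. iexp (s * X' \<omega>))"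
    and A: "A \<in> sets borel"
  shows "(\<integral>\<omega>. w \<omega> * indicator A (X \<omega>) \<partial>M) = (\<integral>\<omega>. w' \<omega> * indicator A (X' \<omega>) \<partial>M')"
proof -
  interpret M: prob_space M by fact
  interpret M': prob_space M' by fact
  have law: "M.tilted_law (\<integral>\<omega>. 2 + v \<omega> \<partial>M) v X = M'.tilted_law (\<integral>\<omega>. 2 + v' \<omega> \<partial>M') v' X' \<and>
      (\<integral>\<omega>. 2 + v \<omega> \<partial>M) = (\<integral>\<omega>. 2 + v' \<omega> \<partial>M')"
    if v: "v \<in> borel_measurable M" "\<And>\<omega>. \<bar>v \<omega>\<bar> \<le> 1" and v': "v' \<in> borel_measurable M'" "\<And>\<omega>. \<bar>v' \<omega>\<bar> \<le> 1"
      and eq: "\<And>s. (CLINT \<omega>|M. of_real (v \<omega>) * iexp (s * X \<omega>)) = (CLINT \<omega>|M'. of_real (v' \<omega>) * iexp (s * X' \<omega>))"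
    for v v'
  proof -
    \<comment> \<open>The weighted identity at s = 0 shows that the two laws are normalised by the
      same mass.\<close>
    have "complex_of_real (\<integral>\<omega>. v \<omega> \<partial>M) = complex_of_real (\<integral>\<omega>. v' \<omega> \<partial>M')"
      using eq[of 0] by simp
    then have mass: "(\<integral>\<omega>. 2 + v \<omega> \<partial>M) = (\<integral>\<omega>. 2 + v' \<omega> \<partial>M')"
      using M.integrable_tilted(3)[OF v(1) m(2) v(2) refl] M'.integrable_tilted(3)[OF v'(1) m'(2) v'(2) refl]
      by (simp add: M.prob_space M'.prob_space)
    have "char (M.tilted_law (\<integral>\<omega>. 2 + v \<omega> \<partial>M) v X) = char (M'.tilted_law (\<integral>\<omega>. 2 + v' \<omega> \<partial>M') v' X')"
    proof
      fix s
      have "char (M.tilted_law (\<integral>\<omega>. 2 + v \<omega> \<partial>M) v X) s = (2 * (CLINT \<omega>|M. iexp (s * X \<omega>)) +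
          (CLINT \<omega>|M. of_real (v \<omega>) * iexp (s * X \<omega>))) / of_real (\<integral>\<omega>. 2 + v \<omega> \<partial>M)"
        unfolding char_def by (rule M.tilted_law_cf[OF v(1) m(2) v(2) refl])
      also have "\<dots> = (2 * (CLINT \<omega>|M'. iexp (s * X' \<omega>)) +
          (CLINT \<omega>|M'. of_real (v' \<omega>) * iexp (s * X' \<omega>))) / of_real (\<integral>\<omega>. 2 + v' \<omega> \<partial>M')"
        by (simp only: eq unweighted mass)
      also have "\<dots> = char (M'.tilted_law (\<integral>\<omega>. 2 + v' \<omega> \<partial>M') v' X') s"
        unfolding char_def by (rule M'.tilted_law_cf[OF v'(1) m'(2) v'(2) refl, symmetric])
      finally show "char (M.tilted_law (\<integral>\<omega>. 2 + v \<omega> \<partial>M) v X) s =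
          char (M'.tilted_law (\<integral>\<omega>. 2 + v' \<omega> \<partial>M') v' X') s" .
    qed
    then show ?thesis
      using mass by (intro conjI Levy_uniqueness M.real_distribution_tilted_law[OF v(1) m(2) v(2) refl]
          M'.real_distribution_tilted_law[OF v'(1) m'(2) v'(2) refl])
  qed
  note mt = M.measure_tilted_law[OF _ m(2) _ refl A] M'.measure_tilted_law[OF _ m'(2) _ refl A]
  have 0: "(\<integral>\<omega>. indicator A (X \<omega>) \<partial>M) = ((\<integral>\<omega>. indicator A (X' \<omega>) \<partial>M') :: real)"
  proof -
    have "M.tilted_law (\<integral>\<omega>. 2 + 0 \<partial>M) (\<lambda>_. 0) X = M'.tilted_law (\<integral>\<omega>. 2 + 0 \<partial>M') (\<lambda>_. 0) X' \<and>
        (\<integral>\<omega>. 2 + 0 \<partial>M) = ((\<integral>\<omega>. 2 + 0 \<partial>M') :: real)"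
      by (rule law) auto
    moreover have "measure (M.tilted_law (\<integral>\<omega>. 2 + 0 \<partial>M) (\<lambda>_. 0) X) A = (\<integral>\<omega>. indicator A (X \<omega>) \<partial>M)"
      by (subst mt(1)) (auto simp: M.prob_space)
    moreover have "measure (M'.tilted_law (\<integral>\<omega>. 2 + 0 \<partial>M') (\<lambda>_. 0) X') A = (\<integral>\<omega>. indicator A (X' \<omega>) \<partial>M')"
      by (subst mt(2)) (auto simp: M'.prob_space)
    ultimately show ?thesis by metis
  qed
  have L: "M.tilted_law (\<integral>\<omega>. 2 + w \<omega> \<partial>M) w X = M'.tilted_law (\<integral>\<omega>. 2 + w' \<omega> \<partial>M') w' X'"
    and mass: "(\<integral>\<omega>. 2 + w \<omega> \<partial>M) = (\<integral>\<omega>. 2 + w' \<omega> \<partial>M')"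
    using law[OF m(1) bound m'(1) bound' weighted] by blast+
  have "(\<integral>\<omega>. 2 + w' \<omega> \<partial>M') > 0"
    by (rule M'.tilted_mass_pos[OF m'(1) m'(2) bound' refl])
  then show ?thesis
    using mt(1)[OF m(1) bound] mt(2)[OF m'(1) bound'] L[unfolded mass] unfolding mass 0 by simp
qed

text \<open>Coordinates are converted one at a time from exponentials into indicators, so that
  uniqueness in one dimension suffices. While coordinate a is converted, everything else acts as a
  weight. Weights must be real, so the exponential of the remaining coordinates is split into cosine
  and sine.\<close>

lemma cf_determines_rectangles:
  fixes X :: "'i \<Rightarrow> 'a \<Rightarrow> real" and X' :: "'i \<Rightarrow> 'b \<Rightarrow> real"
  assumes M: "prob_space M" and M': "prob_space M'" and J: "finite J"
    and X: "\<And>j. j \<in> J \<Longrightarrow> X j \<in> borel_measurable M" and X': "\<And>j. j \<in> J \<Longrightarrow> X' j \<in> borel_measurable M'"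
    and cf: "\<And>\<theta>. (CLINT \<omega>|M. iexp (\<Sum>j\<in>J. \<theta> j * X j \<omega>)) = (CLINT \<omega>|M'. iexp (\<Sum>j\<in>J. \<theta> j * X' j \<omega>))"
    and S: "\<And>j. j \<in> J \<Longrightarrow> S j \<in> sets borel"
  shows "(\<integral>\<omega>. (\<Prod>j\<in>J. indicator (S j) (X j \<omega>)) \<partial>M) = (\<integral>\<omega>. (\<Prod>j\<in>J. indicator (S j) (X' j \<omega>)) \<partial>M' :: real)"
proof -
  interpret M: prob_space M by fact
  interpret M': prob_space M' by fact
  define e where "e A \<theta> x = complex_of_real (\<Prod>j\<in>A. indicator (S j) (x j)) * iexp (\<Sum>j\<in>J - A. \<theta> j * x j)"
    for A and \<theta> x :: "'i \<Rightarrow> real"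
  have "(CLINT \<omega>|M. e A \<theta> (\<lambda>j. X j \<omega>)) = (CLINT \<omega>|M'. e A \<theta> (\<lambda>j. X' j \<omega>))" if "A \<subseteq> J" for A \<theta>
    using finite_subset[OF that J] that
  proof (induction A arbitrary: \<theta> rule: finite_induct)
    case empty
    then show ?case using cf by (simp add: e_def)
  next
    case (insert a A)
    then have a: "a \<in> J" "a \<notin> A" "A \<subseteq> J" and IH: "\<And>\<theta>. (CLINT \<omega>|M. e A \<theta> (\<lambda>j. X j \<omega>)) = (CLINT \<omega>|M'. e A \<theta> (\<lambda>j. X' j \<omega>))"
      by auto
    let ?B = "J - insert a A"
    have JA: "J - A = insert a ?B" and B: "finite ?B" "a \<notin> ?B" using a J by auto
    define p where "p x = (\<Prod>j\<in>A. indicator (S j) (x j) :: real)" for x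
    define L where "L x = (\<Sum>j\<in>?B. \<theta> j * x j)" for x :: "'i \<Rightarrow> real"
    have p: "\<bar>p x\<bar> \<le> 1" for x
      unfolding p_def abs_prod by (intro prod_le_1) (auto simp: indicator_def)
    have "(\<lambda>\<omega>. p (\<lambda>j. X j \<omega>)) \<in> borel_measurable M" "(\<lambda>\<omega>. p (\<lambda>j. X' j \<omega>)) \<in> borel_measurable M'"
      "(\<lambda>\<omega>. L (\<lambda>j. X j \<omega>)) \<in> borel_measurable M" "(\<lambda>\<omega>. L (\<lambda>j. X' j \<omega>)) \<in> borel_measurable M'"
      unfolding p_def L_def using a X X' S
      by (auto intro!: borel_measurable_prod borel_measurable_sum borel_measurable_times
          measurable_compose[OF _ borel_measurable_indicator, of _ M borel]
          measurable_compose[OF _ borel_measurable_indicator, of _ M' borel])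
    note [measurable] = this X[OF a(1)] X'[OF a(1)]
    \<comment> \<open>The induction hypothesis covers all \<theta>. Taking c = 1 and c = -1 yields
      both conjugate exponentials, of which cosine and sine are combinations.\<close>
    have plus: "(CLINT \<omega>|M. p (\<lambda>j. X j \<omega>) * iexp (c * L (\<lambda>j. X j \<omega>) + s * X a \<omega>)) =
        (CLINT \<omega>|M'. p (\<lambda>j. X' j \<omega>) * iexp (c * L (\<lambda>j. X' j \<omega>) + s * X' a \<omega>))" for c s
    proof -
      have "(\<Sum>j\<in>J - A. (\<lambda>j. if j = a then s else c * \<theta> j) j * x j) = c * L x + s * x a" for x
      proof -
        have "(\<Sum>j\<in>?B. (if j = a then s else c * \<theta> j) * x j) = (\<Sum>j\<in>?B. c * (\<theta> j * x j))"
          by (intro sum.cong) auto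
        then show ?thesis
          unfolding JA sum.insert[OF B] by (simp add: L_def sum_distrib_left)
      qed
      then show ?thesis
        using IH[of "\<lambda>j. if j = a then s else c * \<theta> j"] by (simp only: e_def p_def)
    qed
    have trig: "(CLINT \<omega>|M. of_real (p (\<lambda>j. X j \<omega>) * f (L (\<lambda>j. X j \<omega>))) * iexp (s * X a \<omega>)) =
        (CLINT \<omega>|M'. of_real (p (\<lambda>j. X' j \<omega>) * f (L (\<lambda>j. X' j \<omega>))) * iexp (s * X' a \<omega>))"
      if f: "\<And>y. of_real (f y) = u * iexp y + v * iexp (- y)" for f u v s
    proof -
      have *: "of_real (p x * f (L x)) * iexp (s * x a) =
          u * (p x * iexp (1 * L x + s * x a)) + v * (p x * iexp (-1 * L x + s * x a))" for x
        by (simp add: f ring_distribs mult_ac exp_add exp_diff exp_minus divide_inverse)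
      have "integrable M (\<lambda>\<omega>. p (\<lambda>j. X j \<omega>) * iexp (c * L (\<lambda>j. X j \<omega>) + s * X a \<omega>))"
        "integrable M' (\<lambda>\<omega>. p (\<lambda>j. X' j \<omega>) * iexp (c * L (\<lambda>j. X' j \<omega>) + s * X' a \<omega>))" for c
        using p by (auto intro!: M.integrable_const_bound[where B = 1] M'.integrable_const_bound[where B = 1]
            simp: norm_mult)
      then show ?thesis
        unfolding *[of "\<lambda>j. X j _"] *[of "\<lambda>j. X' j _"] using plus[of 1 s] plus[of "-1" s]
        by (simp only: Bochner_Integration.integral_add integrable_mult_right integral_mult_right_zero)
    qed
    have unw: "(CLINT \<omega>|M. iexp (s * X a \<omega>)) = (CLINT \<omega>|M'. iexp (s * X' a \<omega>))" for s
    proof -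
      have "(\<Sum>j\<in>J. (if j = a then s else 0) * x j) = s * x a" for x :: "'i \<Rightarrow> real"
        using a(1) J by (simp add: if_distrib[of "\<lambda>y. y * _"] cong: if_cong)
      then show ?thesis
        using cf[of "\<lambda>j. if j = a then s else 0"] by (simp only:)
    qed
    have step: "(\<integral>\<omega>. p (\<lambda>j. X j \<omega>) * f (L (\<lambda>j. X j \<omega>)) * indicator (S a) (X a \<omega>) \<partial>M) =
        (\<integral>\<omega>. p (\<lambda>j. X' j \<omega>) * f (L (\<lambda>j. X' j \<omega>)) * indicator (S a) (X' a \<omega>) \<partial>M')"
      if f: "\<And>y. of_real (f y) = u * iexp y + v * iexp (- y)" and f1: "\<And>y. \<bar>f y\<bar> \<le> 1"
        and [measurable]: "f \<in> borel_measurable borel" for f u v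
    proof (rule weighted_cf_determines[OF M M' _ X[OF a(1)] _ X'[OF a(1)] _ _ trig[OF f] unw S[OF a(1)]])
      have pf: "\<bar>p x * f (L x)\<bar> \<le> 1" for x
        using mult_mono[OF p[of x] f1[of "L x"]] by (simp add: abs_mult)
      show "\<bar>p (\<lambda>j. X j \<omega>) * f (L (\<lambda>j. X j \<omega>))\<bar> \<le> 1" for \<omega>
        by (rule pf)
      show "\<bar>p (\<lambda>j. X' j \<omega>) * f (L (\<lambda>j. X' j \<omega>))\<bar> \<le> 1" for \<omega>
        by (rule pf)
    qed measurable
    have c: "(\<integral>\<omega>. p (\<lambda>j. X j \<omega>) * cos (L (\<lambda>j. X j \<omega>)) * indicator (S a) (X a \<omega>) \<partial>M) =
        (\<integral>\<omega>. p (\<lambda>j. X' j \<omega>) * cos (L (\<lambda>j. X' j \<omega>)) * indicator (S a) (X' a \<omega>) \<partial>M')"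
      by (rule step[of cos "1 / 2" "1 / 2"]) (auto simp: complex_eq_iff Re_exp Im_exp)
    have s: "(\<integral>\<omega>. p (\<lambda>j. X j \<omega>) * sin (L (\<lambda>j. X j \<omega>)) * indicator (S a) (X a \<omega>) \<partial>M) =
        (\<integral>\<omega>. p (\<lambda>j. X' j \<omega>) * sin (L (\<lambda>j. X' j \<omega>)) * indicator (S a) (X' a \<omega>) \<partial>M')"
      by (rule step[of sin "- \<i> / 2" "\<i> / 2"]) (auto simp: complex_eq_iff Re_exp Im_exp)
    have e: "e (insert a A) \<theta> x = of_real (p x * cos (L x) * indicator (S a) (x a)) +
        \<i> * of_real (p x * sin (L x) * indicator (S a) (x a))" for x
    proof -
      have "e (insert a A) \<theta> x = of_real (indicator (S a) (x a) * p x) * iexp (L x)"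
        by (simp only: e_def p_def L_def prod.insert[OF insert.hyps(1,2)])
      also have "iexp (L x) = of_real (cos (L x)) + \<i> * of_real (sin (L x))"
        by (simp add: complex_eq_iff Re_exp Im_exp)
      finally show ?thesis
        by (simp only: of_real_mult distrib_left mult_ac)
    qed
    have bnd: "norm (p x * f (L x) * indicator (S a) (x a)) \<le> 1" if "\<And>y. \<bar>f y\<bar> \<le> 1" for f and x :: "'i \<Rightarrow> real"
      using mult_mono[OF p[of x] that[of "L x"]] by (auto simp: abs_mult indicator_def)
    have [measurable]: "S a \<in> sets borel" using S a(1) .
    have int: "integrable M (\<lambda>\<omega>. p (\<lambda>j. X j \<omega>) * f (L (\<lambda>j. X j \<omega>)) * indicator (S a) (X a \<omega>))"
      "integrable M' (\<lambda>\<omega>. p (\<lambda>j. X' j \<omega>) * f (L (\<lambda>j. X' j \<omega>)) * indicator (S a) (X' a \<omega>))"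
      if "\<And>y. \<bar>f y\<bar> \<le> 1" and [measurable]: "f \<in> borel_measurable borel" for f
    proof -
      show "integrable M (\<lambda>\<omega>. p (\<lambda>j. X j \<omega>) * f (L (\<lambda>j. X j \<omega>)) * indicator (S a) (X a \<omega>))"
        by (rule M.integrable_const_bound[OF AE_I2[OF bnd[of f "\<lambda>j. X j _", OF that(1)]]]) measurable
      show "integrable M' (\<lambda>\<omega>. p (\<lambda>j. X' j \<omega>) * f (L (\<lambda>j. X' j \<omega>)) * indicator (S a) (X' a \<omega>))"
        by (rule M'.integrable_const_bound[OF AE_I2[OF bnd[of f "\<lambda>j. X' j _", OF that(1)]]]) measurable
    qed
    note int_cos = int[of cos, OF abs_cos_le_one borel_measurable_continuous_onI[OF continuous_on_cos[OF continuous_on_id]]]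
    note int_sin = int[of sin, OF abs_sin_le_one borel_measurable_continuous_onI[OF continuous_on_sin[OF continuous_on_id]]]
    show ?case
      unfolding e using int_cos int_sin c s
      by (simp only: Bochner_Integration.integral_add integrable_of_real integrable_mult_right
          integral_mult_right_zero integral_complex_of_real)
  qed
  from this[of J "\<lambda>_. 0"] have "complex_of_real (\<integral>\<omega>. (\<Prod>j\<in>J. indicator (S j) (X j \<omega>)) \<partial>M) =
      complex_of_real (\<integral>\<omega>. (\<Prod>j\<in>J. indicator (S j) (X' j \<omega>)) \<partial>M')"
    by (simp only: e_def Diff_cancel sum.empty of_real_0 mult_zero_right exp_zero mult_1_right
        integral_complex_of_real)
  then show ?thesis
    by (simp only: of_real_eq_iff)
qed


text \<open>Parameters are inserted from the largest to the smallest, so that each new \<kappa> lies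
  below R. The factor \<open>exp_cf (\<kappa> * sum \<theta> R)\<close> is cancelled because it is
  nonzero.\<close>

lemma cf_process_eq:
  fixes X :: "real \<Rightarrow> 'a \<Rightarrow> real" and X' :: "real \<Rightarrow> 'b \<Rightarrow> real"
  assumes J: "finite J" "J \<subseteq> {1..}" and "prob_space M" "prob_space M'"
    and X: "\<And>\<kappa> R. \<kappa> \<ge> 1 \<Longrightarrow> finite R \<Longrightarrow> (\<And>\<rho>. \<rho> \<in> R \<Longrightarrow> \<rho> > \<kappa>) \<Longrightarrow>
      (CLINT \<omega>|M. iexp (\<Sum>\<rho>\<in>insert \<kappa> R. \<theta> \<rho> * X \<rho> \<omega>)) * exp_cf (\<kappa> * sum \<theta> R) =
      exp_cf (\<kappa> * sum \<theta> (insert \<kappa> R)) * (CLINT \<omega>|M. iexp (\<Sum>\<rho>\<in>R. \<theta> \<rho> * X \<rho> \<omega>))"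
    and X': "\<And>\<kappa> R. \<kappa> \<ge> 1 \<Longrightarrow> finite R \<Longrightarrow> (\<And>\<rho>. \<rho> \<in> R \<Longrightarrow> \<rho> > \<kappa>) \<Longrightarrow>
      (CLINT \<omega>|M'. iexp (\<Sum>\<rho>\<in>insert \<kappa> R. \<theta> \<rho> * X' \<rho> \<omega>)) * exp_cf (\<kappa> * sum \<theta> R) =
      exp_cf (\<kappa> * sum \<theta> (insert \<kappa> R)) * (CLINT \<omega>|M'. iexp (\<Sum>\<rho>\<in>R. \<theta> \<rho> * X' \<rho> \<omega>))"
  shows "(CLINT \<omega>|M. iexp (\<Sum>\<rho>\<in>J. \<theta> \<rho> * X \<rho> \<omega>)) = (CLINT \<omega>|M'. iexp (\<Sum>\<rho>\<in>J. \<theta> \<rho> * X' \<rho> \<omega>))"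
  using J
proof (induction J rule: finite_linorder_min_induct)
  case empty
  interpret M: prob_space M by fact
  interpret M': prob_space M' by fact
  show ?case by (simp add: M.prob_space M'.prob_space)
next
  case (insert \<kappa> R)
  have "(CLINT \<omega>|M. iexp (\<Sum>\<rho>\<in>insert \<kappa> R. \<theta> \<rho> * X \<rho> \<omega>)) * exp_cf (\<kappa> * sum \<theta> R) =
      (CLINT \<omega>|M'. iexp (\<Sum>\<rho>\<in>insert \<kappa> R. \<theta> \<rho> * X' \<rho> \<omega>)) * exp_cf (\<kappa> * sum \<theta> R)"
    using X[of \<kappa> R] X'[of \<kappa> R] insert by simp
  then show ?case
    using exp_cf_nonzero by simp
qed

section \<open>From finitely many parameters to processes and their paths\<close>

lemma (in prob_space) emeasure_distr_rectangle:
  fixes U :: "'i \<Rightarrow> 'a \<Rightarrow> real"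
  assumes U: "(\<lambda>\<omega>. \<lambda>i\<in>I. U i \<omega>) \<in> measurable M (\<Pi>\<^sub>M i\<in>I. borel)"
    and J: "finite J" "J \<subseteq> I" and A: "\<And>i. i \<in> J \<Longrightarrow> A i \<in> sets borel"
  shows "emeasure (distr M (\<Pi>\<^sub>M i\<in>I. borel) (\<lambda>\<omega>. \<lambda>i\<in>I. U i \<omega>)) (prod_emb I (\<lambda>_. borel) J (Pi\<^sub>E J A)) =
    ennreal (expectation (\<lambda>\<omega>. \<Prod>j\<in>J. indicator (A j) (U j \<omega>)))"
proof -
  let ?E = "prod_emb I (\<lambda>_. borel) J (Pi\<^sub>E J A)"
  let ?F = "(\<lambda>\<omega>. \<lambda>i\<in>I. U i \<omega>) -` ?E \<inter> space M"
  have E: "?E \<in> sets (\<Pi>\<^sub>M i\<in>I. borel)"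
    using J A by (intro sets_PiM_I) auto
  have F: "?F \<in> sets M" using U E by (rule measurable_sets)
  have "(\<Prod>j\<in>J. indicator (A j) (U j \<omega>)) = (indicator ?F \<omega> :: real)" if "\<omega> \<in> space M" for \<omega>
  proof -
    have "\<omega> \<in> ?F \<longleftrightarrow> (\<forall>j\<in>J. U j \<omega> \<in> A j)"
      using that J(2) by (auto simp: prod_emb_def PiE_iff)
    then show ?thesis
      using J(1) by (auto simp: indicator_def)
  qed
  then have "expectation (\<lambda>\<omega>. \<Prod>j\<in>J. indicator (A j) (U j \<omega>)) = expectation (indicator ?F :: 'a \<Rightarrow> real)"
    by (intro Bochner_Integration.integral_cong) auto
  also have "\<dots> = prob ?F" using F by simp
  finally show ?thesis
    using emeasure_distr[OF U E] by (simp add: emeasure_eq_measure)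
qed

lemma distr_process_eqI:
  fixes X :: "'i \<Rightarrow> 'a \<Rightarrow> real" and X' :: "'i \<Rightarrow> 'b \<Rightarrow> real"
  assumes M: "prob_space M" and M': "prob_space M'"
    and X: "\<And>i. i \<in> I \<Longrightarrow> X i \<in> borel_measurable M" and X': "\<And>i. i \<in> I \<Longrightarrow> X' i \<in> borel_measurable M'"
    and cf: "\<And>J \<theta>. finite J \<Longrightarrow> J \<subseteq> I \<Longrightarrow>
      (CLINT \<omega>|M. iexp (\<Sum>j\<in>J. \<theta> j * X j \<omega>)) = (CLINT \<omega>|M'. iexp (\<Sum>j\<in>J. \<theta> j * X' j \<omega>))"
  shows "distr M (\<Pi>\<^sub>M i\<in>I. borel) (\<lambda>\<omega>. \<lambda>i\<in>I. X i \<omega>) = distr M' (\<Pi>\<^sub>M i\<in>I. borel) (\<lambda>\<omega>. \<lambda>i\<in>I. X' i \<omega>)"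
proof -
  interpret M: prob_space M by fact
  interpret M': prob_space M' by fact
  let ?B = "\<Pi>\<^sub>M i\<in>I. (borel :: real measure)"
  have m: "(\<lambda>\<omega>. \<lambda>i\<in>I. X i \<omega>) \<in> measurable M ?B" and m': "(\<lambda>\<omega>. \<lambda>i\<in>I. X' i \<omega>) \<in> measurable M' ?B"
    using X X' by (auto intro!: measurable_restrict)
  show ?thesis
  proof (rule measure_eqI_PiM_infinite)
    fix A :: "'i \<Rightarrow> real set" and J assume J: "finite J" "J \<subseteq> I" and A: "\<And>i. i \<in> J \<Longrightarrow> A i \<in> sets borel"
    have "(\<integral>\<omega>. (\<Prod>j\<in>J. indicator (A j) (X j \<omega>)) \<partial>M) = (\<integral>\<omega>. (\<Prod>j\<in>J. indicator (A j) (X' j \<omega>)) \<partial>M' :: real)"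
      using J A X X' by (intro cf_determines_rectangles M M' cf) auto
    then show "emeasure (distr M ?B (\<lambda>\<omega>. \<lambda>i\<in>I. X i \<omega>)) (prod_emb I (\<lambda>_. borel) J (Pi\<^sub>E J A)) =
        emeasure (distr M' ?B (\<lambda>\<omega>. \<lambda>i\<in>I. X' i \<omega>)) (prod_emb I (\<lambda>_. borel) J (Pi\<^sub>E J A))"
      using M.emeasure_distr_rectangle[OF m J, of A] M'.emeasure_distr_rectangle[OF m' J, of A] A by simp
  qed (auto intro!: M.finite_measure_distr m)
qed

text \<open>The weights sit at random positions, so their sign is transferred through
  \<open>joint_law\<close> from the product of a point and a variable of mean 1. Countably many
  triples of a natural bound r, a count n and a rank i reach every point. Monotonicity of the jump
  process rests on this.\<close>

lemma (in marked_point_process) AE_weights_nonneg: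
  "AE \<omega> in M. \<forall>t\<in>N \<omega>. Z t \<omega> \<ge> 0"
proof -
  have "AE \<omega> in M. \<forall>n i. i < n \<longrightarrow> weight_at (real r) n i \<omega> \<ge> 0" for r :: nat
  proof (intro AE_all_countable[THEN iffD2] allI, rule AE_impI)
    fix n i :: nat assume i: "i < n"
    let ?I = "{..<n} <+> {..<n}" and ?Q = "PiM {..<n} (\<lambda>_. exp_law 1)"
    interpret Q: prob_space ?Q
      by (intro prob_space_PiM prob_space_exponential_density) simp
    interpret MQ: pair_sigma_finite M ?Q ..
    interpret QQ: product_prob_space "\<lambda>_ :: nat. exp_law 1" "{..<n}"
      by (intro product_prob_space_exp_law) simp
    have sets_Q[measurable_cong]: "sets ?Q = sets (PiM {..<n} (\<lambda>_. borel))"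
      by (intro sets_PiM_cong) auto
    have point[measurable]: "point_at (real r) n j \<in> borel_measurable M" if "j < n" for j
      using that by measurable
    have X: "(\<lambda>\<omega>. restrict (case_sum (\<lambda>j. point_at (real r) n j \<omega>) (\<lambda>j. weight_at (real r) n j \<omega>)) ?I)
        \<in> measurable M (PiM ?I (\<lambda>_. borel))"
      by (intro measurable_restrict) auto
    have X': "(\<lambda>(\<omega>, \<xi>). restrict (case_sum (\<lambda>j. point_at (real r) n j \<omega>) (\<lambda>j. point_at (real r) n j \<omega> * \<xi> j)) ?I)
        \<in> measurable (M \<Otimes>\<^sub>M ?Q) (PiM ?I (\<lambda>_. borel))"
      unfolding case_prod_beta' by (intro measurable_restrict) auto
    have S: "{v \<in> space (PiM ?I (\<lambda>_. borel)). v (Inr i) \<ge> 0} \<in> sets (PiM ?I (\<lambda>_. borel :: real measure))"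
    proof -
      have [measurable]: "(\<lambda>v. v (Inr i)) \<in> borel_measurable (PiM ?I (\<lambda>_. borel :: real measure))"
        using i by (intro measurable_component_singleton) auto
      show ?thesis by measurable
    qed
    have "AE z in exp_law 1. 0 \<le> z"
      by (subst AE_density) (auto simp: exponential_density_def)
    then have AE_i: "AE \<xi> in ?Q. 0 \<le> \<xi> i"
      using i by (intro QQ.AE_component) auto
    have "AE \<omega> in M. AE \<xi> in ?Q. 0 \<le> point_at (real r) n i \<omega> * \<xi> i"
    proof (rule AE_I2)
      fix \<omega> assume \<omega>: "\<omega> \<in> space M"
      have p: "point_at (real r) n i \<omega> \<ge> 0"
        using point_at_ge_1[OF \<omega> _ i, of "real r"]
        by (cases "card (N \<omega> \<inter> {1..real r}) = n") (auto simp: point_at_def)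
      from AE_i show "AE \<xi> in ?Q. 0 \<le> point_at (real r) n i \<omega> * \<xi> i"
        by eventually_elim (use p in simp)
    qed
    moreover have "{p \<in> space (M \<Otimes>\<^sub>M ?Q). 0 \<le> point_at (real r) n i (fst p) * snd p i} \<in> sets (M \<Otimes>\<^sub>M ?Q)"
      using i by measurable (use i in simp)
    ultimately have "AE p in M \<Otimes>\<^sub>M ?Q. 0 \<le> point_at (real r) n i (fst p) * snd p i"
      by (intro MQ.AE_pair_measure) auto
    then have "AE v in distr (M \<Otimes>\<^sub>M ?Q) (PiM ?I (\<lambda>_. borel)) (\<lambda>(\<omega>, \<xi>).
        restrict (case_sum (\<lambda>j. point_at (real r) n j \<omega>) (\<lambda>j. point_at (real r) n j \<omega> * \<xi> j)) ?I). v (Inr i) \<ge> 0"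
      using i by (subst AE_distr_iff[OF X' S]) (auto simp: case_prod_beta')
    then have "AE v in distr M (PiM ?I (\<lambda>_. borel))
        (\<lambda>\<omega>. restrict (case_sum (\<lambda>j. point_at (real r) n j \<omega>) (\<lambda>j. weight_at (real r) n j \<omega>)) ?I). v (Inr i) \<ge> 0"
      by (simp only: joint_law)
    then show "AE \<omega> in M. weight_at (real r) n i \<omega> \<ge> 0"
      using i by (subst (asm) AE_distr_iff[OF X S]) auto
  qed
  then have "AE \<omega> in M. \<forall>r :: nat. \<forall>n i. i < n \<longrightarrow> weight_at (real r) n i \<omega> \<ge> 0"
    by (simp add: AE_all_countable)
  then show ?thesis
    using AE_space
  proof eventually_elim
    case (elim \<omega>)
    show ?case
    proof
      fix t assume t: "t \<in> N \<omega>"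
      obtain r :: nat where r: "t \<le> real r" using real_arch_simple by blast
      let ?n = "card (N \<omega> \<inter> {1..real r})"
      have "t \<in> N \<omega> \<inter> {1..real r}"
        using t r points_ge_1[OF elim(2)] by auto
      then obtain i where i: "i < ?n" "t = nth_point (N \<omega>) i"
        using bij_betw_imp_surj_on[OF bij_betw_nth_point[OF points_ge_1[OF elim(2)] locally_finite[OF elim(2)], of "real r"]]
        by (metis imageE lessThan_iff)
      from elim(1) i(1) have "weight_at (real r) ?n i \<omega> \<ge> 0" by blast
      then show "Z t \<omega> \<ge> 0"
        using i by (simp add: weight_at_def)
    qed
  qed
qed

lemma (in marked_point_process) AE_jump_process_paths:
  "AE \<omega> in M. mono_on {1..} (\<lambda>\<rho>. jump_process N Z \<rho> \<omega>) \<and> cadlag_on {1..} (\<lambda>\<rho>. jump_process N Z \<rho> \<omega>)"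
  using AE_weights_nonneg AE_space
proof eventually_elim
  case (elim \<omega>)
  note fin = locally_finite[OF elim(2)]
  let ?X = "\<lambda>\<rho>. jump_process N Z \<rho> \<omega>"
  have "mono_on {1..} ?X"
    unfolding jump_process_def using elim(1) fin by (intro mono_onI sum_mono2) auto
  moreover have "cadlag_on {1..} ?X"
    unfolding cadlag_on_def
  proof (intro ballI conjI)
    fix t :: real assume t: "t \<in> {1..}"
    \<comment> \<open>Local finiteness isolates t from the other points, so near t the path is
      constant on either side.\<close>
    have "\<exists>e>0. \<forall>s\<in>N \<omega> \<inter> {1..t + 1} - {t}. e \<le> \<bar>s - t\<bar>"
    proof (cases "N \<omega> \<inter> {1..t + 1} - {t} = {}")
      case False
      then show ?thesis
        using fin[of "t + 1"] by (intro exI[of _ "Min ((\<lambda>s. \<bar>s - t\<bar>) ` (N \<omega> \<inter> {1..t + 1} - {t}))"]) auto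
    qed (auto intro: exI[of _ 1])
    then obtain e where e: "e > 0" "\<And>s. s \<in> N \<omega> \<Longrightarrow> 1 \<le> s \<Longrightarrow> s \<le> t + 1 \<Longrightarrow> s \<noteq> t \<Longrightarrow> e \<le> \<bar>s - t\<bar>"
      by force
    let ?e = "min e 1"
    have "N \<omega> \<inter> {1..\<rho>} = N \<omega> \<inter> {1..t}" if "t < \<rho>" "\<rho> < t + ?e" for \<rho>
      using e(2) that by force
    then have right: "?X \<rho> = ?X t" if "\<rho> \<in> {t<..<t + ?e}" for \<rho>
      using that by (simp add: jump_process_def)
    have "N \<omega> \<inter> {1..\<rho>} = N \<omega> \<inter> {1..<t}" if "t - ?e < \<rho>" "\<rho> < t" for \<rho>
      using e(2) that by force
    then have left: "?X \<rho> = (\<Sum>s\<in>N \<omega> \<inter> {1..<t}. Z s \<omega>)" if "\<rho> \<in> {t - ?e<..<t}" for \<rho>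
      using that by (simp add: jump_process_def)
    have "\<forall>\<^sub>F \<rho> in at t. \<rho> \<in> {t - ?e<..<t + ?e} - {t}"
      using e(1) by (intro eventually_at_topological[THEN iffD2] exI[of _ "{t - ?e<..<t + ?e}"]) auto
    then have near: "\<forall>\<^sub>F \<rho> in at t within S. \<rho> \<in> {t - ?e<..<t + ?e} \<and> \<rho> \<in> S \<and> \<rho> \<noteq> t" for S
      by (auto simp: eventually_at_filter elim!: eventually_mono)
    show "(?X \<longlongrightarrow> ?X t) (at t within {1..} \<inter> {t<..})"
      by (intro tendsto_eventually eventually_mono[OF near] right) auto
    show "\<exists>l. (?X \<longlongrightarrow> l) (at t within {1..} \<inter> {..<t})"
      by (intro exI[of _ "\<Sum>s\<in>N \<omega> \<inter> {1..<t}. Z s \<omega>"] tendsto_eventually eventually_mono[OF near] left) auto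
  qed
  ultimately show ?case ..
qed


section \<open>Paths of a Busemann edge\<close>


context busemann_process
begin

text \<open>Right-continuity at \<open>1\<close>: the means of the nonnegative differences \<open>B\<^sup>\<rho> - Y\<close> tend to \<open>0\<close>
  as \<open>\<rho>\<close> decreases to \<open>1\<close>.\<close>

lemma AE_B_near_weight:
  "AE \<omega> in M. \<forall>\<epsilon>>0. \<exists>\<rho>>1. B \<rho> (x - e1) x \<omega> < Y x \<omega> + \<epsilon>"
proof -
  define r where "r n = 1 + 1 / real (Suc n)" for n
  define D where "D n \<omega> = B (r n) (x - e1) x \<omega> - Y x \<omega>" for n \<omega>
  have r: "r n > 1" for n by (simp add: r_def)
  have Y_meas[measurable]: "Y x \<in> borel_measurable M"
    using distributed_measurable[OF Y_exponential] by simp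
  note [measurable] = B_measurable[OF r]
  have D_meas[measurable]: "D n \<in> borel_measurable M" for n
    unfolding D_def by measurable
  have int: "expectation X = 1 / l" "integrable M X"
    if X: "distributed M lborel X (exponential_density l)" and l: "l > 0" for X l
  proof -
    show "expectation X = 1 / l"
      using l X by (rule exponential_distributed_expectation)
    \<comment> \<open>The integral of a non-integrable function is 0 by convention, whereas the
      expectation 1 / l is not 0.\<close>
    then show "integrable M X"
      using not_integrable_integral_eq[of M X] l by fastforce
  qed
  have r0: "1 / r n > 0" for n using r[of n] by simp
  have iB: "expectation (B (r n) (x - e1) x) = 1 / (1 / r n)" "integrable M (B (r n) (x - e1) x)" for n
    by (rule int[OF horizontal_exponential[OF r] r0])+
  have iY: "expectation (Y x) = 1 / 1" "integrable M (Y x)"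
    by (rule int[OF Y_exponential zero_less_one])+
  have iD: "integrable M (D n)" for n
    unfolding D_def by (intro Bochner_Integration.integrable_diff iB iY)
  have ED: "expectation (D n) = 1 / real (Suc n)" for n
    unfolding D_def using iB[of n] iY
    by (subst Bochner_Integration.integral_diff) (auto simp: r_def)
  have D_nonneg: "AE \<omega> in M. 0 \<le> D n \<omega>" for n
    using single_event
  proof eventually_elim
    case (elim \<omega>)
    then have "Y x \<omega> = min (B (r n) (x - e1) x \<omega>) (B (r n) (x - e2) x \<omega>)"
      using r[of n] by blast
    then show ?case
      by (simp add: D_def)
  qed
  have nnD: "(\<integral>\<^sup>+\<omega>. ennreal (D n \<omega>) \<partial>M) = ennreal (1 / real (Suc n))" for n
    using nn_integral_eq_integral[OF iD D_nonneg] by (simp only: ED)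
  \<comment> \<open>The mean of the infimum is at most that of every D n, which is r n - 1 = 1 / (n
    + 1). Hence the infimum vanishes almost surely.\<close>
  let ?I = "\<lambda>\<omega>. INF n. ennreal (D n \<omega>)"
  have le: "(\<integral>\<^sup>+\<omega>. ?I \<omega> \<partial>M) \<le> ennreal (1 / real (Suc n))" for n
    unfolding nnD[symmetric] by (intro nn_integral_mono INF_lower) simp
  have "(\<integral>\<^sup>+\<omega>. ?I \<omega> \<partial>M) \<le> ennreal 0"
  proof (rule tendsto_lowerbound)
    show "(\<lambda>n. ennreal (1 / real (Suc n))) \<longlonglongrightarrow> ennreal 0"
      by (intro tendsto_ennrealI LIMSEQ_Suc[OF lim_1_over_n])
  qed (use le in auto)
  then have "AE \<omega> in M. ?I \<omega> = 0"
    by (subst nn_integral_0_iff_AE[symmetric]) auto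
  then show ?thesis
  proof eventually_elim
    case (elim \<omega>)
    show ?case
    proof (intro allI impI)
      fix \<epsilon> :: real assume "\<epsilon> > 0"
      then have "?I \<omega> < ennreal \<epsilon>"
        using elim by simp
      then obtain n where "ennreal (D n \<omega>) < ennreal \<epsilon>"
        by (auto simp: INF_less_iff)
      then have "D n \<omega> < \<epsilon>"
        using \<open>\<epsilon> > 0\<close> by (meson ennreal_leI not_le)
      then show "\<exists>\<rho>>1. B \<rho> (x - e1) x \<omega> < Y x \<omega> + \<epsilon>"
        using r[of n] by (intro exI[of _ "r n"]) (simp add: D_def)
    qed
  qed
qed

text \<open>On (1, \<infinity>) the paths inherit their regularity from B. At 1 monotonicity reduces
  right-continuity to the existence of parameters whose value is arbitrarily close to the weight,
  which \<open>AE_B_near_weight\<close> supplies.\<close>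

lemma AE_busemann_edge_paths:
  "AE \<omega> in M. mono_on {1..} (\<lambda>\<rho>. busemann_edge Y B x \<rho> \<omega>) \<and> cadlag_on {1..} (\<lambda>\<rho>. busemann_edge Y B x \<rho> \<omega>)"
  using AE_B_near_weight[of x] single_event cadlag
proof eventually_elim
  case (elim \<omega>)
  let ?E = "\<lambda>\<rho>. busemann_edge Y B x \<rho> \<omega>" and ?b = "\<lambda>\<rho>. B \<rho> (x - e1) x \<omega>"
  have E: "?E \<rho> = ?b \<rho>" if "\<rho> > 1" for \<rho>
    using that by (simp add: busemann_edge_def)
  have E1: "?E 1 = Y x \<omega>" by (simp add: busemann_edge_def)
  have ge: "Y x \<omega> \<le> ?b \<rho>" if "\<rho> > 1" for \<rho>
  proof -
    have "Y x \<omega> = min (?b \<rho>) (B \<rho> (x - e2) x \<omega>)"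
      using elim(2) that by blast
    then show ?thesis by simp
  qed
  have "?b \<kappa> \<le> ?b \<rho>" if "1 < \<kappa>" "\<kappa> < \<rho>" for \<kappa> \<rho>
  proof -
    have "B \<kappa> (x - e1) (x - e1 + e1) \<omega> \<le> B \<rho> (x - e1) (x - e1 + e1) \<omega>"
      using elim(2) that by blast
    then show ?thesis by simp
  qed
  then have le: "?E \<kappa> \<le> ?E \<rho>" if "1 \<le> \<kappa>" "\<kappa> \<le> \<rho>" for \<kappa> \<rho>
    using that ge[of \<rho>] E1 E[of \<kappa>] E[of \<rho>] by (cases "\<kappa> = 1"; cases "\<kappa> = \<rho>") auto
  have "mono_on {1..} ?E"
    using le by (intro mono_onI) auto
  moreover have "cadlag_on {1..} ?E"
    unfolding cadlag_on_def
  proof (intro ballI)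
    fix t :: real assume "t \<in> {1..}"
    then consider "t = 1" | "t > 1" by fastforce
    then show "(?E \<longlongrightarrow> ?E t) (at t within {1..} \<inter> {t<..}) \<and> (\<exists>l. (?E \<longlongrightarrow> l) (at t within {1..} \<inter> {..<t}))"
    proof cases
      case 1
      have "{1..} \<inter> {1<..} = {1 :: real<..}" "{1..} \<inter> {..<1} = ({} :: real set)" by auto
      moreover have "(?E \<longlongrightarrow> ?E 1) (at_right 1)"
      proof (rule order_tendstoI)
        fix a assume "a < ?E 1"
        then have "a < ?E \<rho>" if "\<rho> > 1" for \<rho>
          using le[of 1 \<rho>] that by simp
        then show "\<forall>\<^sub>F \<rho> in at_right 1. a < ?E \<rho>"
          by (auto simp: eventually_at_filter)
      next
        fix a assume "?E 1 < a"
        then have "a - Y x \<omega> > 0" using E1 by simp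
        then obtain \<rho>' where \<rho>': "\<rho>' > 1" "?b \<rho>' < Y x \<omega> + (a - Y x \<omega>)"
          using elim(1) by blast
        then have "?E \<rho> < a" if "\<rho> \<in> {1<..<\<rho>'}" for \<rho>
          using le[of \<rho> \<rho>'] E[of \<rho>'] that by simp
        then show "\<forall>\<^sub>F \<rho> in at_right 1. ?E \<rho> < a"
          using \<rho>'(1) by (auto simp: eventually_at_right_field intro!: exI[of _ \<rho>'])
      qed
      ultimately show ?thesis
        using 1 by auto
    next
      case 2
      have lim: "(?b \<longlongrightarrow> ?b t) (at t within {1<..} \<inter> {t<..})" "\<exists>l. (?b \<longlongrightarrow> l) (at t within {1<..} \<inter> {..<t})"
        using elim(3)[rule_format, of "x - e1" x] 2 unfolding cadlag_on_def by simp_all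
      have filt: "at t within {1..} \<inter> S = at t within {1<..} \<inter> S" for S :: "real set"
        using 2 by (intro at_within_nhd[of t "{1<..}"]) auto
      have "\<forall>\<^sub>F \<rho> in at t within {1<..} \<inter> S. ?b \<rho> = ?E \<rho>" for S
        using E by (auto simp: eventually_at_filter)
      then have "(?b \<longlongrightarrow> l) (at t within {1<..} \<inter> S) \<Longrightarrow> (?E \<longlongrightarrow> l) (at t within {1<..} \<inter> S)" for S l
        using filterlim_cong[of "nhds l" "nhds l" "at t within {1<..} \<inter> S" "at t within {1<..} \<inter> S" ?b ?E] by blast
      with lim show ?thesis
        unfolding filt E[OF 2] by blast
    qed
  qed
  ultimately show ?case ..
qed

end

theorem theorem3p4:
  fixes M :: "'a measure" and P :: "'b measure"
    and Y :: "site \<Rightarrow> 'a \<Rightarrow> real" and B :: "real \<Rightarrow> site \<Rightarrow> site \<Rightarrow> 'a \<Rightarrow> real"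
    and N :: "'b \<Rightarrow> real set" and Z :: "real \<Rightarrow> 'b \<Rightarrow> real"
    and x :: site
  assumes "busemann_process M Y B"
    and "marked_point_process P N Z"
  shows "(AE \<omega> in M. mono_on {1..} (\<lambda>\<rho>. busemann_edge Y B x \<rho> \<omega>) \<and>
                     cadlag_on {1..} (\<lambda>\<rho>. busemann_edge Y B x \<rho> \<omega>)) \<and>
         (AE \<omega> in P. mono_on {1..} (\<lambda>\<rho>. jump_process N Z \<rho> \<omega>) \<and>
                     cadlag_on {1..} (\<lambda>\<rho>. jump_process N Z \<rho> \<omega>)) \<and>
         distr M (\<Pi>\<^sub>M \<rho>\<in>{1..}. borel) (\<lambda>\<omega>. \<lambda>\<rho>\<in>{1..}. busemann_edge Y B x \<rho> \<omega>) =
         distr P (\<Pi>\<^sub>M \<rho>\<in>{1..}. borel) (\<lambda>\<omega>. \<lambda>\<rho>\<in>{1..}. jump_process N Z \<rho> \<omega>)"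
proof -
  interpret Bm: busemann_process M Y B by fact
  interpret Pm: marked_point_process P N Z by fact
  have "distr M (\<Pi>\<^sub>M \<rho>\<in>{1..}. borel) (\<lambda>\<omega>. \<lambda>\<rho>\<in>{1..}. busemann_edge Y B x \<rho> \<omega>) =
        distr P (\<Pi>\<^sub>M \<rho>\<in>{1..}. borel) (\<lambda>\<omega>. \<lambda>\<rho>\<in>{1..}. jump_process N Z \<rho> \<omega>)"
  proof (rule distr_process_eqI[OF Bm.prob_space_axioms Pm.prob_space_axioms])
    fix J :: "real set" and \<theta> :: "real \<Rightarrow> real" assume J: "finite J" "J \<subseteq> {1..}"
    show "(CLINT \<omega>|M. iexp (\<Sum>\<rho>\<in>J. \<theta> \<rho> * busemann_edge Y B x \<rho> \<omega>)) =
        (CLINT \<omega>|P. iexp (\<Sum>\<rho>\<in>J. \<theta> \<rho> * jump_process N Z \<rho> \<omega>))"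
      by (rule cf_process_eq[OF J Bm.prob_space_axioms Pm.prob_space_axioms Bm.edge_cf_insert Pm.jump_cf_insert])
  qed (auto intro: Bm.edge_measurable Pm.jump_process_measurable)
  with Bm.AE_busemann_edge_paths Pm.AE_jump_process_paths show ?thesis
    by blast
qed

end
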